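(* Let $X$ be a real Banach space and let $M$ be a (closed) subspace of $X$ which is an ideal of $X$. Let $\mathcal{A}$ be an operator ideal such that $\mathcal{A}=\mathcal{A}^{d}$. If $X$ has the Lip-$\mathcal{A}$-BAP, then $$\beta_M^*\in\overline{\mathcal{A}^\lambda(M^*,\mathfrak{F}(M)^* )}^{w^*}$$ for some $\lambda\ge1$, where $w^*$ is the weak-star topology on $\mathcal{L}(M^*,\mathfrak{F}(M)^* )=(M^*\widehat{\otimes}_\pi\mathfrak{F}(M))^*$.
   Context: All Banach spaces are real. For Banach spaces $X,Y$, $\mathcal{L}(X,Y)$ is the space of bounded linear operators, and $\mathrm{Lip}_0(X,Y)$ is the Banach space of Lipschitz maps $f:X\to Y$ with $f(0)=0$, with norm $\|f\|_{\mathrm{Lip}}=\sup_{x\neq y}\|f(x)-f(y)\|/\|x-y\|$; $\mathrm{Lip}_0(X)=\mathrm{Lip}_0(X,\mathbb{R})$. For $x\in X$ let $\delta_x\in \mathrm{Lip}_0(X)^*$, $\delta_x(f)=f(x)$. The Lipschitz-free space is $\mathfrak{F}(X)=\overline{\mathrm{span}}\{\delta_x: x\in X\}\subseteq \mathrm{Lip}_0(X)^*$, and $\delta_X:X\to\mathfrak{F}(X)$, $\delta_X(x)=\delta_x$. For each $f\in\mathrm{Lip}_0(X,Y)$ there is a unique $L_f\in\mathcal{L}(\mathfrak{F}(X),Y)$ with $L_f\delta_X=f$, and $\|L_f\|=\|f\|_{\mathrm{Lip}}$. The map $\beta_X:\mathfrak{F}(X)\to X$ is the bounded linear quotient map determined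 by $x^*(\beta_X(\mu))=\langle x^*,\mu\rangle$ for all $x^*\in X^*\subseteq\mathrm{Lip}_0(X)$; so $\beta_X(\delta_x)=x$. The same notation is used for $M$ in place of $X$. Operator ideals are (linear) operator ideals in the usual sense. $\mathcal{A}^d(X,Y)=\{T\in\mathcal{L}(X,Y):T^*\in\mathcal{A}(Y^*,X^* )\}$. For $\lambda\ge 1$: $\mathcal{A}^\lambda(X,Y)=\{T\in\mathcal{A}(X,Y):\|T\|\le\lambda\}$; $\mathrm{Lip}_{\mathcal{A}}(X,Y)=\{f\in\mathrm{Lip}_0(X,Y): L_f\in\mathcal{A}(\mathfrak{F}(X),Y)\}$; $\mathrm{Lip}_{\mathcal{A}}^\lambda(X,Y)=\{f\in\mathrm{Lip}_{\mathcal{A}}(X,Y):\|f\|_{\mathrm{Lip}}\le\lambda\}$. $\tau_c$ denotes the compact-open topology (uniform convergence on compact subsets of the domain). $X$ has the Lip-$\mathcal{A}$-BAP if $\mathrm{Id}_X\in\overline{\mathrm{Lip}_{\mathcal{A}}^\lambda(X,X)}^{\tau_c}$ for some $\lambda\ge1$. A subspace $M$ of $X$ is an ideal in $X$ (or locally complemented in $X$) if $M^\perp$ is the kernel of a norm-one projection on $X^*$; equivalently, there is a Hahn-Banach extension operator, i.e. a bounded linear $\sigma:M^*\to X^*$ with $\sigma(y^* )(y)=y^*(y)$ and $\|\sigma(y^* )\|=\|y^*\|$ for all $y^*\in M^*$, $y\in M$. For Banach spaces $E,F$, the weak-star topology on $\mathcal{L}(E,F^* )$ is the one coming from the identification $\mathcal{L}(E,F^*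 )=(E\widehat{\otimes}_\pi F)^*$, where $\widehat{\otimes}_\pi$ is the projective tensor product and $\langle e\otimes f,T\rangle=(Te)(f)$. *)

theory Defs
  imports "HOL-Analysis.Analysis" "HOL-Library.Function_Algebras"
begin

section \<open>Normed spaces on subspaces of a vector space\<close>

text \<open>
  The spaces \<open>X\<^sup>*\<close>, \<open>Lip\<^sub>0(X)\<close>, \<open>F(X)\<close>, \<open>M\<close>, \<open>F(M)\<^sup>*\<close>, ... and the arguments of an operator ideal have
  to range over all Banach spaces, so a normed space is a pair of a linear subspace of some
  real vector space type and a norm on it (whose values off the subspace are irrelevant).
  Function types carry the pointwise vector space structure.

  Maps defined on a space are total functions that vanish off its carrier; with this
  convention a map on the space is represented by exactly one function, and sets of maps are
  linear subspaces of the function type.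
\<close>

instantiation "fun" :: (type, real_vector) real_vector
begin

definition scaleR_fun :: "real \<Rightarrow> ('a \<Rightarrow> 'b) \<Rightarrow> 'a \<Rightarrow> 'b"
  where "scaleR_fun c f = (\<lambda>x. c *\<^sub>R f x)"

instance
  by standard (auto simp: scaleR_fun_def fun_eq_iff scaleR_add_right scaleR_add_left)

end

datatype 'v nspace = NSpace (carrier: "'v set") (nrm: "'v \<Rightarrow> real")

definition type_space :: "'a::real_normed_vector set \<Rightarrow> 'a nspace"
  where "type_space S = NSpace S norm"

abbreviation real_space :: "real nspace"
  where "real_space \<equiv> type_space UNIV"

definition normed_space :: "'v::real_vector nspace \<Rightarrow> bool"
  where "normed_space E \<longleftrightarrow>
    subspace (carrier E) \<and>
    (\<forall>x\<in>carrier E. 0 \<le> nrm E x \<and> (nrm E x = 0 \<longleftrightarrow> x = 0)) \<and>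
    (\<forall>x\<in>carrier E. \<forall>y\<in>carrier E. nrm E (x + y) \<le> nrm E x + nrm E y) \<and>
    (\<forall>c. \<forall>x\<in>carrier E. nrm E (c *\<^sub>R x) = \<bar>c\<bar> * nrm E x)"

definition banach_space :: "'v::real_vector nspace \<Rightarrow> bool"
  where "banach_space E \<longleftrightarrow>
    normed_space E \<and>
    (\<forall>s::nat \<Rightarrow> 'v.
      (\<forall>n. s n \<in> carrier E) \<and>
      (\<forall>\<epsilon>>0. \<exists>N. \<forall>m\<ge>N. \<forall>n\<ge>N. nrm E (s m - s n) < \<epsilon>) \<longrightarrow>
      (\<exists>x\<in>carrier E. (\<lambda>n. nrm E (s n - x)) \<longlonglongrightarrow> 0))"

definition norm_closure :: "'v::real_vector nspace \<Rightarrow> 'v set \<Rightarrow> 'v set"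
  where "norm_closure E S = {x \<in> carrier E. \<forall>\<epsilon>>0. \<exists>y\<in>S. nrm E (x - y) < \<epsilon>}"

definition lin_maps :: "'v::real_vector nspace \<Rightarrow> ('v \<Rightarrow> 'w::real_vector) set"
  where "lin_maps E = {T.
    (\<forall>x\<in>carrier E. \<forall>y\<in>carrier E. T (x + y) = T x + T y) \<and>
    (\<forall>c. \<forall>x\<in>carrier E. T (c *\<^sub>R x) = c *\<^sub>R T x) \<and>
    (\<forall>x. x \<notin> carrier E \<longrightarrow> T x = 0)}"

definition bd_ops :: "'v::real_vector nspace \<Rightarrow> 'w::real_vector nspace \<Rightarrow> ('v \<Rightarrow> 'w) set"
  where "bd_ops E F = {T \<in> lin_maps E.
    T ` carrier E \<subseteq> carrier F \<and> (\<exists>C. \<forall>x\<in>carrier E. nrm F (T x) \<le> C * nrm E x)}"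

definition op_norm :: "'v::real_vector nspace \<Rightarrow> 'w::real_vector nspace \<Rightarrow> ('v \<Rightarrow> 'w) \<Rightarrow> real"
  where "op_norm E F T = (SUP x\<in>{x \<in> carrier E. nrm E x \<le> 1}. nrm F (T x))"

definition dual_space :: "'v::real_vector nspace \<Rightarrow> ('v \<Rightarrow> real) nspace"
  where "dual_space E = NSpace (bd_ops E real_space) (op_norm E real_space)"

definition dual_op :: "'v::real_vector nspace \<Rightarrow> 'w::real_vector nspace \<Rightarrow> ('v \<Rightarrow> 'w) \<Rightarrow>
    ('w \<Rightarrow> real) \<Rightarrow> ('v \<Rightarrow> real)"
  where "dual_op E F T = (\<lambda>g. if g \<in> carrier (dual_space F) then g \<circ> T else 0)"

definition isometry_onto :: "'v::real_vector nspace \<Rightarrow> 'w::real_vector nspace \<Rightarrow> ('v \<Rightarrow> 'w) \<Rightarrow> bool"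
  where "isometry_onto E F \<phi> \<longleftrightarrow>
    \<phi> \<in> bd_ops E F \<and> \<phi> ` carrier E = carrier F \<and> (\<forall>x\<in>carrier E. nrm F (\<phi> x) = nrm E x)"


section \<open>Lipschitz maps and Lipschitz-free spaces\<close>

definition lip0 :: "'v::real_vector nspace \<Rightarrow> 'w::real_vector nspace \<Rightarrow> ('v \<Rightarrow> 'w) set"
  where "lip0 E F = {f.
    f ` carrier E \<subseteq> carrier F \<and> f 0 = 0 \<and> (\<forall>x. x \<notin> carrier E \<longrightarrow> f x = 0) \<and>
    (\<exists>C. \<forall>x\<in>carrier E. \<forall>y\<in>carrier E. nrm F (f x - f y) \<le> C * nrm E (x - y))}"

text \<open>Inserting \<open>0\<close> only matters for the zero space, where the set of quotients is empty.\<close>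

definition lip_norm :: "'v::real_vector nspace \<Rightarrow> 'w::real_vector nspace \<Rightarrow> ('v \<Rightarrow> 'w) \<Rightarrow> real"
  where "lip_norm E F f =
    Sup (insert 0 {nrm F (f x - f y) / nrm E (x - y) | x y.
      x \<in> carrier E \<and> y \<in> carrier E \<and> x \<noteq> y})"

definition lip0_space :: "'v::real_vector nspace \<Rightarrow> ('v \<Rightarrow> real) nspace"
  where "lip0_space E = NSpace (lip0 E real_space) (lip_norm E real_space)"

definition delta :: "'v::real_vector nspace \<Rightarrow> 'v \<Rightarrow> ('v \<Rightarrow> real) \<Rightarrow> real"
  where "delta E x = (\<lambda>f. if f \<in> carrier (lip0_space E) then f x else 0)"

definition free_space :: "'v::real_vector nspace \<Rightarrow> (('v \<Rightarrow> real) \<Rightarrow> real) nspace"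
  where "free_space E =
    NSpace (norm_closure (dual_space (lip0_space E)) (span (delta E ` carrier E)))
      (nrm (dual_space (lip0_space E)))"

text \<open>The linearization \<open>L\<^sub>f\<close> of a map \<open>f \<in> Lip\<^sub>0(E, F)\<close>.\<close>

definition linearization :: "'v::real_vector nspace \<Rightarrow> 'w::real_vector nspace \<Rightarrow> ('v \<Rightarrow> 'w) \<Rightarrow>
    (('v \<Rightarrow> real) \<Rightarrow> real) \<Rightarrow> 'w"
  where "linearization E F f =
    (THE L. L \<in> bd_ops (free_space E) F \<and> (\<forall>x\<in>carrier E. L (delta E x) = f x))"

definition beta :: "'v::real_vector nspace \<Rightarrow> (('v \<Rightarrow> real) \<Rightarrow> real) \<Rightarrow> 'v"
  where "beta E =
    (THE b. b \<in> bd_ops (free_space E) E \<and>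
      (\<forall>g\<in>carrier (dual_space E). \<forall>\<mu>\<in>carrier (free_space E). g (b \<mu>) = \<mu> g))"


section \<open>Operator ideals\<close>

text \<open>
  A class of operators assigns a set of operators to each pair of Banach spaces. Since no type
  contains all Banach spaces, the spaces range over all Banach spaces on linear subspaces of an
  arbitrary real vector space type \<open>'u\<close>; up to isometry these are all Banach spaces of linear
  dimension at most that of \<open>'u\<close>. If \<open>(('a \<Rightarrow> real) \<Rightarrow> real) \<Rightarrow> real\<close> embeds linearly into \<open>'u\<close>, then
  for every Banach space \<open>X\<close> on \<open>'a\<close> the spaces \<open>X\<close>, \<open>X\<^sup>*\<close>, \<open>F(X)\<close> and \<open>F(X)\<^sup>*\<close> have isometric copies
  on \<open>'u\<close>.
\<close>

type_synonym 'u op_class = "'u nspace \<Rightarrow> 'u nspace \<Rightarrow> ('u \<Rightarrow> 'u) set"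

definition operator_ideal :: "'u::real_vector op_class \<Rightarrow> bool"
  where "operator_ideal \<A> \<longleftrightarrow>
    (\<forall>E F. banach_space E \<and> banach_space F \<longrightarrow>
      \<A> E F \<subseteq> bd_ops E F \<and> subspace (\<A> E F) \<and>
      (\<forall>T\<in>bd_ops E F. (\<exists>B. finite B \<and> T ` carrier E \<subseteq> span B) \<longrightarrow> T \<in> \<A> E F)) \<and>
    (\<forall>E\<^sub>0 E F F\<^sub>0. banach_space E\<^sub>0 \<and> banach_space E \<and> banach_space F \<and> banach_space F\<^sub>0 \<longrightarrow>
      (\<forall>R\<in>bd_ops E\<^sub>0 E. \<forall>S\<in>\<A> E F. \<forall>T\<in>bd_ops F F\<^sub>0. T \<circ> S \<circ> R \<in> \<A> E\<^sub>0 F\<^sub>0))"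

text \<open>
  \<open>\<A>(E, F)\<close> for spaces on other types: \<open>E\<close> and \<open>F\<close> are replaced by isometric copies on \<open>'u\<close>. By the
  ideal property the choice of the copies does not matter.
\<close>

definition is_copy :: "'v::real_vector nspace \<Rightarrow> 'u::real_vector nspace \<Rightarrow> ('v \<Rightarrow> 'u) \<Rightarrow> bool"
  where "is_copy E E' \<phi> \<longleftrightarrow> banach_space E' \<and> isometry_onto E E' \<phi>"

definition ideal_ops :: "'u::real_vector op_class \<Rightarrow> 'v::real_vector nspace \<Rightarrow>
    'w::real_vector nspace \<Rightarrow> ('v \<Rightarrow> 'w) set"
  where "ideal_ops \<A> E F = {T \<in> bd_ops E F.
    \<exists>E' F' \<phi> \<psi>. is_copy E E' \<phi> \<and> is_copy F F' \<psi> \<and>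
      (\<exists>T'\<in>\<A> E' F'. \<forall>x\<in>carrier E. T' (\<phi> x) = \<psi> (T x))}"

definition dual_class :: "'u::real_vector op_class \<Rightarrow> 'u op_class"
  where "dual_class \<A> E F =
    {T \<in> bd_ops E F. dual_op E F T \<in> ideal_ops \<A> (dual_space F) (dual_space E)}"

text \<open>
  \<open>\<A> = \<A>\<^sup>d\<close>. The components are compared for those \<open>E\<close>, \<open>F\<close> whose duals have a copy on \<open>'u\<close>; for the
  other pairs the class does not specify which operators \<open>F\<^sup>* \<rightarrow> E\<^sup>*\<close> it contains.
\<close>

definition eq_dual_class :: "'u::real_vector op_class \<Rightarrow> bool"
  where "eq_dual_class \<A> \<longleftrightarrow>
    (\<forall>E F. banach_space E \<and> banach_space F \<and>
      (\<exists>E' \<phi>. is_copy (dual_space E) (E' :: 'u nspace) \<phi>) \<and>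
      (\<exists>F' \<psi>. is_copy (dual_space F) (F' :: 'u nspace) \<psi>) \<longrightarrow>
      \<A> E F = dual_class \<A> E F)"

definition ideal_ops_bd :: "'u::real_vector op_class \<Rightarrow> real \<Rightarrow> 'v::real_vector nspace \<Rightarrow>
    'w::real_vector nspace \<Rightarrow> ('v \<Rightarrow> 'w) set"
  where "ideal_ops_bd \<A> r E F = {T \<in> ideal_ops \<A> E F. op_norm E F T \<le> r}"

definition lip_ideal :: "'u::real_vector op_class \<Rightarrow> 'v::real_vector nspace \<Rightarrow>
    'w::real_vector nspace \<Rightarrow> ('v \<Rightarrow> 'w) set"
  where "lip_ideal \<A> E F =
    {f \<in> lip0 E F. linearization E F f \<in> ideal_ops \<A> (free_space E) F}"

definition lip_ideal_bd :: "'u::real_vector op_class \<Rightarrow> real \<Rightarrow> 'v::real_vector nspace \<Rightarrow>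
    'w::real_vector nspace \<Rightarrow> ('v \<Rightarrow> 'w) set"
  where "lip_ideal_bd \<A> r E F = {f \<in> lip_ideal \<A> E F. lip_norm E F f \<le> r}"

definition compact_open_topology :: "('a::topological_space \<Rightarrow> 'b::topological_space) topology"
  where "compact_open_topology =
    topology_generated_by
      {{f. continuous_on UNIV f \<and> f ` K \<subseteq> U} | K U. compact K \<and> open U}"

definition lip_BAP :: "'u::real_vector op_class \<Rightarrow> 'a::banach itself \<Rightarrow> bool"
  where "lip_BAP \<A> _ \<longleftrightarrow>
    (\<exists>r\<ge>1. (id :: 'a \<Rightarrow> 'a) \<in> compact_open_topology closure_of
      lip_ideal_bd \<A> r (type_space UNIV) (type_space UNIV))"


section \<open>Ideals in Banach spaces\<close>

definition annihilator :: "'v::real_vector set \<Rightarrow> 'v nspace \<Rightarrow> ('v \<Rightarrow> real) set"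
  where "annihilator M E = {g \<in> carrier (dual_space E). \<forall>x\<in>M. g x = 0}"

text \<open>
  A projection of norm at most one has norm one unless it is zero, so the bound \<open>\<le> 1\<close>
  differs from \<open>= 1\<close> only in that it admits the trivial subspace \<open>M = {0}\<close>, for which the
  Hahn-Banach extension operator is zero.
\<close>

definition ideal_in :: "'v::real_vector set \<Rightarrow> 'v nspace \<Rightarrow> bool"
  where "ideal_in M E \<longleftrightarrow>
    (\<exists>P\<in>bd_ops (dual_space E) (dual_space E).
      (\<forall>g. P (P g) = P g) \<and> op_norm (dual_space E) (dual_space E) P \<le> 1 \<and>
      {g \<in> carrier (dual_space E). P g = 0} = annihilator M E)"


section \<open>Projective tensor products and the weak-star topology\<close>

text \<open>
  The algebraic tensor product \<open>E \<otimes> F\<close> is the span of the evaluations \<open>x \<otimes> y : B \<mapsto> B(x, y)\<close> on the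
  space of bilinear forms on \<open>E \<times> F\<close>.
\<close>

definition bilinear_forms :: "'v::real_vector nspace \<Rightarrow> 'w::real_vector nspace \<Rightarrow>
    ('v \<Rightarrow> 'w \<Rightarrow> real) set"
  where "bilinear_forms E F = {B \<in> lin_maps E. \<forall>x\<in>carrier E. B x \<in> lin_maps F}"

definition tensor :: "'v::real_vector nspace \<Rightarrow> 'w::real_vector nspace \<Rightarrow> 'v \<Rightarrow> 'w \<Rightarrow>
    ('v \<Rightarrow> 'w \<Rightarrow> real) \<Rightarrow> real"
  where "tensor E F x y = (\<lambda>B. if B \<in> bilinear_forms E F then B x y else 0)"

definition proj_norm :: "'v::real_vector nspace \<Rightarrow> 'w::real_vector nspace \<Rightarrow>
    (('v \<Rightarrow> 'w \<Rightarrow> real) \<Rightarrow> real) \<Rightarrow> real"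
  where "proj_norm E F u =
    Inf {(\<Sum>i<n. nrm E (x i) * nrm F (y i)) | (n::nat) x y.
      (\<forall>i<n. x i \<in> carrier E \<and> y i \<in> carrier F) \<and> u = (\<Sum>i<n. tensor E F (x i) (y i))}"

definition alg_tensor :: "'v::real_vector nspace \<Rightarrow> 'w::real_vector nspace \<Rightarrow>
    (('v \<Rightarrow> 'w \<Rightarrow> real) \<Rightarrow> real) nspace"
  where "alg_tensor E F =
    NSpace (span {tensor E F x y | x y. x \<in> carrier E \<and> y \<in> carrier F}) (proj_norm E F)"

text \<open>The completion of a normed space, realized as the closure of its image in the bidual.\<close>

definition bidual_embedding :: "'v::real_vector nspace \<Rightarrow> 'v \<Rightarrow> ('v \<Rightarrow> real) \<Rightarrow> real"
  where "bidual_embedding E x = (\<lambda>g. if g \<in> carrier (dual_space E) then g x else 0)"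

definition completion :: "'v::real_vector nspace \<Rightarrow> (('v \<Rightarrow> real) \<Rightarrow> real) nspace"
  where "completion E =
    NSpace (norm_closure (dual_space (dual_space E)) (bidual_embedding E ` carrier E))
      (nrm (dual_space (dual_space E)))"

definition proj_tensor :: "'v::real_vector nspace \<Rightarrow> 'w::real_vector nspace \<Rightarrow>
    (((('v \<Rightarrow> 'w \<Rightarrow> real) \<Rightarrow> real) \<Rightarrow> real) \<Rightarrow> real) nspace"
  where "proj_tensor E F = completion (alg_tensor E F)"

text \<open>
  The functional on \<open>E \<otimes> F\<close> corresponding to \<open>T \<in> L(E, F\<^sup>*)\<close>: it sends a tensor to its value at the
  bilinear form \<open>(x, y) \<mapsto> (T x)(y)\<close>, so \<open>x \<otimes> y\<close> is sent to \<open>(T x)(y)\<close>. An element \<open>u\<close> of the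
  completion, being a functional on the dual of \<open>E \<otimes> F\<close>, is paired with \<open>T\<close> by evaluating \<open>u\<close> there.
\<close>

definition tensor_functional :: "'v::real_vector nspace \<Rightarrow> 'w::real_vector nspace \<Rightarrow>
    ('v \<Rightarrow> 'w \<Rightarrow> real) \<Rightarrow> (('v \<Rightarrow> 'w \<Rightarrow> real) \<Rightarrow> real) \<Rightarrow> real"
  where "tensor_functional E F T = (\<lambda>v. if v \<in> carrier (alg_tensor E F) then v T else 0)"

definition weak_star_topology :: "'v::real_vector nspace \<Rightarrow> 'w::real_vector nspace \<Rightarrow>
    ('v \<Rightarrow> 'w \<Rightarrow> real) topology"
  where "weak_star_topology E F =
    topology_generated_by
      {{T \<in> bd_ops E (dual_space F). u (tensor_functional E F T) \<in> U} | u U.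
        u \<in> carrier (proj_tensor E F) \<and> open U}"

end

theory Submission
  imports Defs
begin

text \<open>
  Write \<open>X\<close> for the ambient space and let \<open>f\<close> run through the maps in \<open>Lip\<^sub>\<A>(X, X)\<close> with Lipschitz
  norm at most \<open>r\<close> that approximate the identity. Three operators turn \<open>f\<close> into an operator
  \<open>T\<^sub>f : M\<^sup>* \<rightarrow> F(M)\<^sup>*\<close>: the Hahn-Banach extension operator \<open>\<sigma> : M\<^sup>* \<rightarrow> X\<^sup>*\<close> that exists because \<open>M\<close> is an
  ideal, the adjoint of the linearization \<open>L\<^sub>f : F(X) \<rightarrow> X\<close>, and the adjoint of the canonical contraction
  \<open>\<iota> : F(M) \<rightarrow> F(X)\<close>. Their composite satisfies

    \<open>(T\<^sub>f y\<^sup>*)(\<delta>\<^sub>m) = (\<sigma> y\<^sup>*)(f m)\<close>.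

  Since \<open>L\<^sub>f\<close> lies in \<open>\<A>\<close> and \<open>\<A> = \<A>\<^sup>d\<close>, its adjoint lies in \<open>\<A>\<close> (\<open>dual_op_ideal_ops\<close>), and so does
  \<open>T\<^sub>f\<close> by the ideal property (\<open>ideal_ops_comp\<close>). The two outer operators are contractions and
  \<open>\<parallel>L\<^sub>f\<parallel> \<le> r\<close>, hence \<open>\<parallel>T\<^sub>f\<parallel> \<le> r\<close>.

  As \<open>f\<close> tends to the identity, \<open>(\<sigma> y\<^sup>*)(f m)\<close> tends to \<open>(\<sigma> y\<^sup>*)(m) = y\<^sup>*(m) = (\<beta>\<^sup>* y\<^sup>*)(\<delta>\<^sub>m)\<close>.
  The uniform bound on the norms spreads the convergence from the point
  evaluations to all of \<open>F(M)\<close>, because they span a dense subspace (\<open>tendsto_on_closed_span\<close>), and then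
  from the elementary tensors to all of the projective tensor product (\<open>tendsto_proj_tensor\<close>), which
  is weak-star convergence \<open>T\<^sub>f \<rightarrow> \<beta>\<^sup>*\<close>.

  Two facts about Banach spaces carry the construction of the operators involved. The
  Hahn-Banach theorem (\<open>hahn_banach\<close>) gives \<open>\<sigma>\<close> and makes the dual separate points. The linearization
  is obtained by duality (\<open>linearization_by_duality\<close>): \<open>L\<^sub>f \<mu>\<close> is the unique point \<open>x\<close> with
  \<open>g(x) = \<mu>(g \<circ> f)\<close> for all functionals \<open>g\<close>; for \<open>f\<close> the identity this is \<open>\<beta>\<close>.
\<close>

section \<open>Normed spaces and their duals\<close>


lemma scaleR_fun_apply [simp]: "(c *\<^sub>R f) x = c *\<^sub>R f x"
  by (simp add: scaleR_fun_def)

lemma sum_fun_apply: "(\<Sum>i\<in>A. f i) x = (\<Sum>i\<in>A. f i x)"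
  by (induction A rule: infinite_finite_induct) auto

text \<open>
  Norms without definiteness and without the triangle inequality. Duals, adjoints and operator norms
  behave well over such spaces already. This matters for the algebraic tensor product, where the
  projective norm is obviously homogeneous and nonnegative, while its definiteness would need a
  Hahn-Banach argument.
\<close>

definition gauged_space :: "'v::real_vector nspace \<Rightarrow> bool"
  where "gauged_space E \<longleftrightarrow>
    subspace (carrier E) \<and>
    (\<forall>x\<in>carrier E. 0 \<le> nrm E x) \<and>
    (\<forall>c. \<forall>x\<in>carrier E. nrm E (c *\<^sub>R x) = \<bar>c\<bar> * nrm E x)"

lemma gauged_space_subspace: "gauged_space E \<Longrightarrow> subspace (carrier E)"
  by (simp add: gauged_space_def)

lemma gauged_space_nonneg: "gauged_space E \<Longrightarrow> x \<in> carrier E \<Longrightarrow> 0 \<le> nrm E x"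
  by (simp add: gauged_space_def)

lemma gauged_space_scale: "gauged_space E \<Longrightarrow> x \<in> carrier E \<Longrightarrow> nrm E (c *\<^sub>R x) = \<bar>c\<bar> * nrm E x"
  by (simp add: gauged_space_def)

lemma normed_imp_gauged: "normed_space E \<Longrightarrow> gauged_space E"
  by (simp add: normed_space_def gauged_space_def)

declare gauged_space_subspace [simp] gauged_space_nonneg [simp]

lemma gauged_space_zero [simp]: "gauged_space E \<Longrightarrow> 0 \<in> carrier E"
  by (simp add: subspace_0)

lemma gauged_space_nrm_zero [simp]: "gauged_space E \<Longrightarrow> nrm E 0 = 0"
  using gauged_space_scale[of E 0 0] by simp

lemma gauged_space_minus: "gauged_space E \<Longrightarrow> x \<in> carrier E \<Longrightarrow> nrm E (- x) = nrm E x"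
  using gauged_space_scale[of E x "-1"] by simp

lemma normed_space_triangle:
  "normed_space E \<Longrightarrow> x \<in> carrier E \<Longrightarrow> y \<in> carrier E \<Longrightarrow> nrm E (x + y) \<le> nrm E x + nrm E y"
  by (simp add: normed_space_def)

lemma normed_space_triangle_diff:
  assumes "normed_space E" "x \<in> carrier E" "y \<in> carrier E" "z \<in> carrier E"
  shows "nrm E (x - z) \<le> nrm E (x - y) + nrm E (y - z)"
proof -
  have "subspace (carrier E)"
    using assms by (simp add: normed_space_def)
  then have "x - y \<in> carrier E" "y - z \<in> carrier E"
    using assms by (auto simp: subspace_diff)
  from normed_space_triangle[OF assms(1) this] show ?thesis by simp
qed

lemma normed_space_definite:
  "normed_space E \<Longrightarrow> x \<in> carrier E \<Longrightarrow> nrm E x = 0 \<longleftrightarrow> x = 0"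
  by (simp add: normed_space_def)

lemma normed_space_dist_commute:
  assumes "normed_space E" "x \<in> carrier E" "y \<in> carrier E"
  shows "nrm E (x - y) = nrm E (y - x)"
  using gauged_space_minus[OF normed_imp_gauged[OF assms(1)], of "x - y"] assms
  by (simp add: normed_space_def subspace_diff)

lemma banach_imp_normed: "banach_space E \<Longrightarrow> normed_space E"
  by (simp add: banach_space_def)

lemma banach_imp_gauged: "banach_space E \<Longrightarrow> gauged_space E"
  by (simp add: banach_imp_normed normed_imp_gauged)

lemma type_space_simps [simp]:
  "carrier (type_space S) = S" "nrm (type_space S) = norm"
  by (simp_all add: type_space_def)

lemma normed_type_space: "subspace S \<Longrightarrow> normed_space (type_space S)"
  by (auto simp: normed_space_def norm_triangle_ineq)

lemma gauged_type_space: "subspace S \<Longrightarrow> gauged_space (type_space S)"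
  by (simp add: normed_imp_gauged normed_type_space)

lemma banach_type_space:
  fixes S :: "'a::banach set"
  assumes "subspace S" "closed S"
  shows "banach_space (type_space S)"
  unfolding banach_space_def
proof (intro conjI allI impI)
  show "normed_space (type_space S)"
    using assms(1) by (rule normed_type_space)
  fix s :: "nat \<Rightarrow> 'a"
  assume s: "(\<forall>n. s n \<in> carrier (type_space S)) \<and>
    (\<forall>\<epsilon>>0. \<exists>N. \<forall>m\<ge>N. \<forall>n\<ge>N. nrm (type_space S) (s m - s n) < \<epsilon>)"
  then have "Cauchy s"
    by (simp add: Cauchy_def dist_norm)
  then obtain l where l: "s \<longlonglongrightarrow> l"
    using convergent_eq_Cauchy by blast
  then have "l \<in> S"
    using assms(2) s closed_sequentially by (metis type_space_simps(1))
  moreover have "(\<lambda>n. norm (s n - l)) \<longlonglongrightarrow> 0"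
    using l by (simp add: LIM_zero tendsto_norm_zero)
  ultimately show "\<exists>x\<in>carrier (type_space S). (\<lambda>n. nrm (type_space S) (s n - x)) \<longlonglongrightarrow> 0"
    by auto
qed

lemma lin_maps_add: "T \<in> lin_maps E \<Longrightarrow> x \<in> carrier E \<Longrightarrow> y \<in> carrier E \<Longrightarrow> T (x + y) = T x + T y"
  by (simp add: lin_maps_def)

lemma lin_maps_scale: "T \<in> lin_maps E \<Longrightarrow> x \<in> carrier E \<Longrightarrow> T (c *\<^sub>R x) = c *\<^sub>R T x"
  by (simp add: lin_maps_def)

lemma lin_maps_off: "T \<in> lin_maps E \<Longrightarrow> x \<notin> carrier E \<Longrightarrow> T x = 0"
  by (simp add: lin_maps_def)

lemma lin_maps_zero: "subspace (carrier E) \<Longrightarrow> T \<in> lin_maps E \<Longrightarrow> T 0 = 0"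
  using lin_maps_scale[of T E 0 0] by (simp add: subspace_0)

lemma lin_maps_diff:
  assumes "subspace (carrier E)" "T \<in> lin_maps E" "x \<in> carrier E" "y \<in> carrier E"
  shows "T (x - y) = T x - T y"
  using lin_maps_add[OF assms(2) assms(3), of "(-1) *\<^sub>R y"] lin_maps_scale[OF assms(2,4), of "-1"] assms
  by (simp add: subspace_neg)

lemma bd_ops_lin: "T \<in> bd_ops E F \<Longrightarrow> T \<in> lin_maps E"
  by (simp add: bd_ops_def)

lemma bd_ops_range: "T \<in> bd_ops E F \<Longrightarrow> x \<in> carrier E \<Longrightarrow> T x \<in> carrier F"
  by (auto simp: bd_ops_def)

lemma bd_opsI:
  assumes "T \<in> lin_maps E" "\<And>x. x \<in> carrier E \<Longrightarrow> T x \<in> carrier F"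
    "\<And>x. x \<in> carrier E \<Longrightarrow> nrm F (T x) \<le> C * nrm E x"
  shows "T \<in> bd_ops E F"
  using assms by (auto simp: bd_ops_def)

lemma bd_ops_bdd_ball:
  assumes "gauged_space E" "T \<in> bd_ops E F"
  shows "bdd_above ((\<lambda>x. nrm F (T x)) ` {x \<in> carrier E. nrm E x \<le> 1})"
proof -
  obtain C where C: "\<forall>x\<in>carrier E. nrm F (T x) \<le> C * nrm E x"
    using assms(2) by (auto simp: bd_ops_def)
  have "nrm F (T x) \<le> \<bar>C\<bar>" if "x \<in> carrier E" "nrm E x \<le> 1" for x
  proof -
    have "nrm F (T x) \<le> C * nrm E x" using C that by simp
    also have "\<dots> \<le> \<bar>C\<bar> * nrm E x"
      using assms(1) that by (intro mult_right_mono) auto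
    also have "\<dots> \<le> \<bar>C\<bar> * 1" using that by (intro mult_left_mono) auto
    finally show ?thesis by simp
  qed
  then show ?thesis by (auto intro!: bdd_aboveI2)
qed

text \<open>
  A vector of positive norm is scaled to norm one, where the supremum applies; a bounded operator
  sends a vector of norm zero to one of norm zero.
\<close>

lemma op_norm_bound:
  assumes "gauged_space E" "gauged_space F" "T \<in> bd_ops E F" "x \<in> carrier E"
  shows "nrm F (T x) \<le> op_norm E F T * nrm E x"
proof (cases "nrm E x = 0")
  case True
  then show ?thesis using assms(3,4) by (auto simp: bd_ops_def)
next
  case False
  then have pos: "nrm E x > 0"
    using assms(1,4) by (metis gauged_space_nonneg less_eq_real_def)
  define y where "y = (1 / nrm E x) *\<^sub>R x"
  have y: "y \<in> carrier E" "nrm E y \<le> 1"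
    using pos assms(1,4) by (auto simp: y_def subspace_scale gauged_space_scale)
  have "nrm F (T y) \<le> op_norm E F T"
    unfolding op_norm_def using y bd_ops_bdd_ball[OF assms(1,3)]
    by (intro cSUP_upper) auto
  moreover have "T y = (1 / nrm E x) *\<^sub>R T x"
    using lin_maps_scale[OF bd_ops_lin[OF assms(3)] assms(4)] by (simp add: y_def)
  then have "nrm F (T y) = nrm F (T x) / nrm E x"
    using pos assms by (simp add: gauged_space_scale bd_ops_range)
  ultimately show ?thesis using pos by (simp add: field_simps)
qed

lemma op_norm_least:
  assumes "gauged_space E" "0 \<le> C" "\<And>x. x \<in> carrier E \<Longrightarrow> nrm F (T x) \<le> C * nrm E x"
  shows "op_norm E F T \<le> C"
  unfolding op_norm_def
proof (rule cSUP_least)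
  show "{x \<in> carrier E. nrm E x \<le> 1} \<noteq> {}"
    using gauged_space_zero[OF assms(1)] gauged_space_nrm_zero[OF assms(1)] by force
  fix x assume x: "x \<in> {x \<in> carrier E. nrm E x \<le> 1}"
  then have "nrm F (T x) \<le> C * nrm E x" using assms(3) by simp
  also have "\<dots> \<le> C" using x assms(2) by (simp add: mult_left_le)
  finally show "nrm F (T x) \<le> C" .
qed

lemma op_norm_nonneg:
  assumes "gauged_space E" "gauged_space F" "T \<in> bd_ops E F"
  shows "0 \<le> op_norm E F T"
proof -
  have "nrm F (T 0) \<le> op_norm E F T"
    unfolding op_norm_def using bd_ops_bdd_ball[OF assms(1,3)] assms(1)
    by (intro cSUP_upper) auto
  then show ?thesis
    using assms lin_maps_zero[OF gauged_space_subspace[OF assms(1)] bd_ops_lin[OF assms(3)]] by simp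
qed

lemma bd_ops_comp:
  assumes "gauged_space E" "gauged_space F" "gauged_space G" "T \<in> bd_ops E F" "S \<in> bd_ops F G"
  shows "S \<circ> T \<in> bd_ops E G"
proof (rule bd_opsI[where C = "op_norm F G S * op_norm E F T"])
  note lT = bd_ops_lin[OF assms(4)] and lS = bd_ops_lin[OF assms(5)]
  have "S 0 = 0" using lin_maps_zero[OF gauged_space_subspace[OF assms(2)] lS] .
  then show "S \<circ> T \<in> lin_maps E"
    using lT lS bd_ops_range[OF assms(4)] by (auto simp: lin_maps_def)
  fix x assume x: "x \<in> carrier E"
  then show "(S \<circ> T) x \<in> carrier G"
    using assms by (auto intro: bd_ops_range)
  have "nrm G (S (T x)) \<le> op_norm F G S * nrm F (T x)"
    using assms x by (intro op_norm_bound) (auto intro: bd_ops_range)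
  also have "\<dots> \<le> op_norm F G S * (op_norm E F T * nrm E x)"
    using assms x by (intro mult_left_mono op_norm_bound op_norm_nonneg)
  finally show "nrm G ((S \<circ> T) x) \<le> op_norm F G S * op_norm E F T * nrm E x" by simp
qed



lemma gauged_real_space [simp]: "gauged_space real_space"
  by (simp add: gauged_type_space)

lemma nrm_dual: "nrm (dual_space E) = op_norm E real_space"
  and carrier_dual: "carrier (dual_space E) = bd_ops E real_space"
  by (simp_all add: dual_space_def)

lemma dual_lin: "g \<in> carrier (dual_space E) \<Longrightarrow> g \<in> lin_maps E"
  by (simp add: carrier_dual bd_ops_lin)

lemma in_dualI:
  fixes g :: "'v::real_vector \<Rightarrow> real"
  assumes "g \<in> lin_maps E" "\<And>x. x \<in> carrier E \<Longrightarrow> \<bar>g x\<bar> \<le> C * nrm E x"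
  shows "g \<in> carrier (dual_space E)"
  using assms by (auto simp: carrier_dual intro: bd_opsI[where C = C])

lemma dual_norm_bound:
  assumes "gauged_space E" "g \<in> carrier (dual_space E)" "x \<in> carrier E"
  shows "\<bar>g x\<bar> \<le> nrm (dual_space E) g * nrm E x"
  using op_norm_bound[OF assms(1) gauged_real_space, of g x] assms
  by (simp add: carrier_dual nrm_dual)

lemma dual_norm_least:
  assumes "gauged_space E" "0 \<le> C" "\<And>x. x \<in> carrier E \<Longrightarrow> \<bar>g x\<bar> \<le> C * nrm E x"
  shows "nrm (dual_space E) g \<le> C"
  using assms by (auto simp: nrm_dual intro: op_norm_least)

lemma subspace_lin_maps: "subspace (lin_maps E :: ('v::real_vector \<Rightarrow> 'w::real_vector) set)"
  unfolding subspace_def lin_maps_def by (auto simp: algebra_simps)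

lemma normed_dual_space:
  assumes E: "gauged_space E"
  shows "normed_space (dual_space E)"
proof -
  let ?D = "dual_space E"
  have nn: "0 \<le> nrm ?D g" if "g \<in> carrier ?D" for g
    using op_norm_nonneg[OF E gauged_real_space, of g] that by (simp add: carrier_dual nrm_dual)
  have zero: "(0 :: 'a \<Rightarrow> real) \<in> carrier ?D"
    by (rule in_dualI[where C = 0]) (auto simp: subspace_0 subspace_lin_maps)
  have bound_add: "\<bar>(g + h) x\<bar> \<le> (nrm ?D g + nrm ?D h) * nrm E x"
    if "g \<in> carrier ?D" "h \<in> carrier ?D" "x \<in> carrier E" for g h x
    using dual_norm_bound[OF E that(1,3)] dual_norm_bound[OF E that(2,3)]
    by (simp add: algebra_simps)
  have bound_scale: "\<bar>(c *\<^sub>R g) x\<bar> \<le> (\<bar>c\<bar> * nrm ?D g) * nrm E x"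
    if "g \<in> carrier ?D" "x \<in> carrier E" for c g x
    using mult_left_mono[OF dual_norm_bound[OF E that], of "\<bar>c\<bar>"]
    by (simp add: abs_mult mult.assoc)
  have scale_le: "nrm ?D (c *\<^sub>R g) \<le> \<bar>c\<bar> * nrm ?D g" if "g \<in> carrier ?D" for c g
    using that nn bound_scale by (intro dual_norm_least[OF E]) auto
  have sub: "subspace (carrier ?D)"
    unfolding subspace_def
  proof (intro conjI ballI allI)
    show "0 \<in> carrier ?D" by (rule zero)
    show "g + h \<in> carrier ?D" if "g \<in> carrier ?D" "h \<in> carrier ?D" for g h
      using subspace_add[OF subspace_lin_maps dual_lin[OF that(1)] dual_lin[OF that(2)]]
        bound_add[OF that] by (rule in_dualI)
    show "c *\<^sub>R g \<in> carrier ?D" if "g \<in> carrier ?D" for c g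
      using subspace_scale[OF subspace_lin_maps dual_lin[OF that]]
        bound_scale[OF that] by (rule in_dualI)
  qed
  have "nrm ?D (c *\<^sub>R g) = \<bar>c\<bar> * nrm ?D g" if g: "g \<in> carrier ?D" for c g
  proof (cases "c = 0")
    case True
    have "nrm ?D (0 :: 'a \<Rightarrow> real) \<le> 0" by (rule dual_norm_least[OF E]) auto
    then show ?thesis using True nn[OF zero] by simp
  next
    case False
    have "nrm ?D ((1/c) *\<^sub>R (c *\<^sub>R g)) \<le> \<bar>1/c\<bar> * nrm ?D (c *\<^sub>R g)"
      using g sub by (intro scale_le) (simp add: subspace_scale)
    then have "\<bar>c\<bar> * nrm ?D g \<le> nrm ?D (c *\<^sub>R g)"
      using False by (simp add: field_simps)
    then show ?thesis using scale_le[OF g, of c] by simp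
  qed
  moreover have "nrm ?D g = 0 \<longleftrightarrow> g = 0" if g: "g \<in> carrier ?D" for g
  proof
    assume 0: "nrm ?D g = 0"
    have "g x = 0" for x
      using dual_norm_bound[OF E g, of x] 0 lin_maps_off[OF dual_lin[OF g], of x]
      by (cases "x \<in> carrier E") auto
    then show "g = 0" by auto
  next
    assume "g = 0"
    moreover have "nrm ?D (0 :: 'a \<Rightarrow> real) \<le> 0" by (rule dual_norm_least[OF E]) auto
    ultimately show "nrm ?D g = 0" using nn[OF g] by simp
  qed
  moreover have "nrm ?D (g + h) \<le> nrm ?D g + nrm ?D h"
    if "g \<in> carrier ?D" "h \<in> carrier ?D" for g h
    using that nn bound_add by (intro dual_norm_least[OF E]) auto
  ultimately show ?thesis
    unfolding normed_space_def using sub nn by blast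
qed

lemma gauged_dual_space: "gauged_space E \<Longrightarrow> gauged_space (dual_space E)"
  by (simp add: normed_dual_space normed_imp_gauged)

text \<open>
  A Cauchy sequence of functionals converges pointwise, and uniformly relative to the norm of the
  argument, so that the pointwise limit is bounded and is the limit in norm.
\<close>

lemma banach_dual_space:
  assumes E: "gauged_space E"
  shows "banach_space (dual_space E)"
  unfolding banach_space_def
proof (intro conjI allI impI)
  let ?D = "dual_space E"
  show nD: "normed_space ?D" using E by (rule normed_dual_space)
  have sD: "subspace (carrier ?D)" using nD by (simp add: normed_space_def)
  fix s :: "nat \<Rightarrow> 'a \<Rightarrow> real"
  assume "(\<forall>n. s n \<in> carrier ?D) \<and>
    (\<forall>\<epsilon>>0. \<exists>N. \<forall>m\<ge>N. \<forall>n\<ge>N. nrm ?D (s m - s n) < \<epsilon>)"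
  then have s: "\<And>n. s n \<in> carrier ?D"
    and cau: "\<And>\<epsilon>. \<epsilon> > 0 \<Longrightarrow> \<exists>N. \<forall>m\<ge>N. \<forall>n\<ge>N. nrm ?D (s m - s n) < \<epsilon>"
    by auto
  have unif: "\<exists>N. \<forall>m\<ge>N. \<forall>n\<ge>N. \<forall>x\<in>carrier E. \<bar>s m x - s n x\<bar> \<le> \<epsilon> * nrm E x"
    if "\<epsilon> > 0" for \<epsilon>
  proof -
    obtain N where N: "\<forall>m\<ge>N. \<forall>n\<ge>N. nrm ?D (s m - s n) < \<epsilon>" using cau \<open>\<epsilon> > 0\<close> by blast
    have "\<bar>s m x - s n x\<bar> \<le> \<epsilon> * nrm E x" if "m \<ge> N" "n \<ge> N" "x \<in> carrier E" for m n x
    proof -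
      have "\<bar>(s m - s n) x\<bar> \<le> nrm ?D (s m - s n) * nrm E x"
        using s sD that E by (intro dual_norm_bound subspace_diff)
      also have "\<dots> \<le> \<epsilon> * nrm E x"
        using N that E by (intro mult_right_mono) (auto simp: less_imp_le)
      finally show ?thesis by simp
    qed
    then show ?thesis by blast
  qed
  define g where "g x = lim (\<lambda>n. s n x)" for x
  have g: "(\<lambda>n. s n x) \<longlonglongrightarrow> g x" for x
  proof (cases "x \<in> carrier E")
    case True
    have "Cauchy (\<lambda>n. s n x)"
    proof (rule CauchyI)
      fix e :: real assume "e > 0"
      define d where "d = e / (nrm E x + 1)"
      have p: "nrm E x + 1 > 0" using E True gauged_space_nonneg[of E x] by linarith
      then have "d > 0" using \<open>e > 0\<close> by (simp add: d_def)
      have "d * nrm E x < d * (nrm E x + 1)" using \<open>d > 0\<close> by simp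
      also have "\<dots> = e" using p by (simp add: d_def)
      finally have "d * nrm E x < e" .
      moreover obtain N where "\<forall>m\<ge>N. \<forall>n\<ge>N. \<bar>s m x - s n x\<bar> \<le> d * nrm E x"
        using unif[OF \<open>d > 0\<close>] True by blast
      ultimately have "\<forall>m\<ge>N. \<forall>n\<ge>N. norm (s m x - s n x) < e"
        by (metis le_less_trans real_norm_def)
      then show "\<exists>M. \<forall>m\<ge>M. \<forall>n\<ge>M. norm (s m x - s n x) < e" by blast
    qed
    then show ?thesis
      unfolding g_def by (simp add: Cauchy_convergent_iff convergent_LIMSEQ_iff)
  next
    case False
    then have "s n x = 0" for n using lin_maps_off[OF dual_lin[OF s]] by blast
    then show ?thesis by (simp add: g_def)
  qed
  have lin: "g \<in> lin_maps E"
    unfolding lin_maps_def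
  proof (safe)
    fix x y assume "x \<in> carrier E" "y \<in> carrier E"
    then have "(\<lambda>n. s n (x + y)) = (\<lambda>n. s n x + s n y)"
      using lin_maps_add[OF dual_lin[OF s]] by auto
    then show "g (x + y) = g x + g y"
      using LIMSEQ_unique[OF g[of "x + y"]] tendsto_add[OF g[of x] g[of y]] by simp
  next
    fix c x assume "x \<in> carrier E"
    then have "(\<lambda>n. s n (c *\<^sub>R x)) = (\<lambda>n. c *\<^sub>R s n x)"
      using lin_maps_scale[OF dual_lin[OF s]] by auto
    then show "g (c *\<^sub>R x) = c *\<^sub>R g x"
      using LIMSEQ_unique[OF g[of "c *\<^sub>R x"]] tendsto_scaleR[OF tendsto_const[of c] g[of x]] by simp
  next
    fix x assume "x \<notin> carrier E"
    then have "s n x = 0" for n using lin_maps_off[OF dual_lin[OF s]] by blast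
    then show "g x = 0" using g[of x] by (simp add: LIMSEQ_const_iff)
  qed
  have close: "\<exists>N. \<forall>n\<ge>N. \<forall>x\<in>carrier E. \<bar>s n x - g x\<bar> \<le> \<epsilon> * nrm E x" if "\<epsilon> > 0" for \<epsilon>
  proof -
    obtain N where N: "\<forall>m\<ge>N. \<forall>n\<ge>N. \<forall>x\<in>carrier E. \<bar>s m x - s n x\<bar> \<le> \<epsilon> * nrm E x"
      using unif[OF \<open>\<epsilon> > 0\<close>] by blast
    have "\<bar>s n x - g x\<bar> \<le> \<epsilon> * nrm E x" if "n \<ge> N" "x \<in> carrier E" for n x
    proof (rule LIMSEQ_le_const2)
      show "(\<lambda>m. \<bar>s n x - s m x\<bar>) \<longlonglongrightarrow> \<bar>s n x - g x\<bar>"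
        by (intro tendsto_intros g)
      show "\<exists>N. \<forall>m\<ge>N. \<bar>s n x - s m x\<bar> \<le> \<epsilon> * nrm E x"
        using N that by blast
    qed
    then show ?thesis by blast
  qed
  have gD: "g \<in> carrier ?D"
  proof -
    obtain N where N: "\<forall>x\<in>carrier E. \<bar>s N x - g x\<bar> \<le> 1 * nrm E x" using close[of 1] by auto
    show ?thesis
    proof (rule in_dualI[OF lin, where C = "nrm ?D (s N) + 1"])
      fix x assume "x \<in> carrier E"
      then show "\<bar>g x\<bar> \<le> (nrm ?D (s N) + 1) * nrm E x"
        using bspec[OF N, of x] dual_norm_bound[OF E s, of x N] by (simp add: algebra_simps)
    qed
  qed
  have "(\<lambda>n. nrm ?D (s n - g)) \<longlonglongrightarrow> 0"
  proof (rule LIMSEQ_I)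
    fix r :: real assume "r > 0"
    then obtain N where N: "\<forall>n\<ge>N. \<forall>x\<in>carrier E. \<bar>s n x - g x\<bar> \<le> (r/2) * nrm E x"
      using close[of "r/2"] by auto
    have "norm (nrm ?D (s n - g) - 0) < r" if "n \<ge> N" for n
    proof -
      have "nrm ?D (s n - g) \<le> r/2"
        using N that \<open>r > 0\<close> by (intro dual_norm_least[OF E]) auto
      moreover have "0 \<le> nrm ?D (s n - g)"
        using gauged_space_nonneg[OF normed_imp_gauged[OF nD] subspace_diff[OF sD s gD]] .
      ultimately show ?thesis using \<open>r > 0\<close> by simp
    qed
    then show "\<exists>no. \<forall>n\<ge>no. norm (nrm ?D (s n - g) - 0) < r" by blast
  qed
  then show "\<exists>x\<in>carrier ?D. (\<lambda>n. nrm ?D (s n - x)) \<longlonglongrightarrow> 0"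
    using gD by blast
qed

lemma dual_op_apply: "g \<in> carrier (dual_space F) \<Longrightarrow> dual_op E F T g x = g (T x)"
  by (simp add: dual_op_def)

lemma dual_op_bounded:
  assumes "gauged_space E" "gauged_space F" "T \<in> bd_ops E F"
  shows "dual_op E F T \<in> bd_ops (dual_space F) (dual_space E)"
    and "\<And>C g. 0 \<le> C \<Longrightarrow> (\<And>x. x \<in> carrier E \<Longrightarrow> nrm F (T x) \<le> C * nrm E x) \<Longrightarrow>
      g \<in> carrier (dual_space F) \<Longrightarrow>
      nrm (dual_space E) (dual_op E F T g) \<le> C * nrm (dual_space F) g"
proof -
  have comp: "dual_op E F T g \<in> carrier (dual_space E)" if "g \<in> carrier (dual_space F)" for g
    using bd_ops_comp[OF assms(1,2) gauged_real_space assms(3), of g] that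
    by (simp add: dual_op_def carrier_dual)
  show 1: "nrm (dual_space E) (dual_op E F T g) \<le> C * nrm (dual_space F) g"
    if "0 \<le> C" "\<And>x. x \<in> carrier E \<Longrightarrow> nrm F (T x) \<le> C * nrm E x" "g \<in> carrier (dual_space F)" for C g
  proof (rule dual_norm_least[OF assms(1)])
    have nn: "0 \<le> nrm (dual_space F) g"
      using assms(2) that(3) by (simp add: gauged_dual_space)
    then show "0 \<le> C * nrm (dual_space F) g" using that(1) by simp
    fix x assume x: "x \<in> carrier E"
    have "\<bar>g (T x)\<bar> \<le> nrm (dual_space F) g * nrm F (T x)"
      using assms x that(3) by (intro dual_norm_bound) (auto intro: bd_ops_range)
    also have "\<dots> \<le> nrm (dual_space F) g * (C * nrm E x)"
      using nn x that(2) by (intro mult_left_mono) auto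
    finally show "\<bar>dual_op E F T g x\<bar> \<le> C * nrm (dual_space F) g * nrm E x"
      using that(3) by (simp add: dual_op_def mult.commute mult.left_commute)
  qed
  show "dual_op E F T \<in> bd_ops (dual_space F) (dual_space E)"
  proof (rule bd_opsI[where C = "op_norm E F T"])
    have "subspace (carrier (dual_space F))" using assms(2) by (simp add: gauged_dual_space)
    then show "dual_op E F T \<in> lin_maps (dual_space F)"
      unfolding lin_maps_def by (auto simp: dual_op_def subspace_add subspace_scale)
  next
    fix g assume g: "g \<in> carrier (dual_space F)"
    show "dual_op E F T g \<in> carrier (dual_space E)" using g by (rule comp)
    show "nrm (dual_space E) (dual_op E F T g) \<le> op_norm E F T * nrm (dual_space F) g"
      using assms g by (intro 1 op_norm_nonneg op_norm_bound)
  qed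
qed

lemmas dual_op_bd = dual_op_bounded(1) and dual_op_norm = dual_op_bounded(2)


section \<open>The Hahn-Banach theorem\<close>

text \<open>
  A functional dominated by a seminorm \<open>p\<close> is represented by its graph, a linear subspace \<open>G\<close> of
  \<open>V \<times> \<real>\<close> with \<open>b \<le> p y\<close> for all \<open>(y, b)\<close> in \<open>G\<close>. Such a subspace is automatically the graph of a
  function: if \<open>(0, a)\<close> lies in it then so does \<open>(0, -a)\<close>, and \<open>p 0 = 0\<close> forces \<open>a = 0\<close>. So the
  extensions are ordered by inclusion of subspaces.
\<close>

lemma sup_inf_gap:
  fixes A B :: "real set"
  assumes "A \<noteq> {}" "B \<noteq> {}" "\<And>a b. a \<in> A \<Longrightarrow> b \<in> B \<Longrightarrow> a \<le> b"
  shows "\<exists>c. (\<forall>a\<in>A. a \<le> c) \<and> (\<forall>b\<in>B. c \<le> b)"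
proof (intro exI[of _ "Sup A"] conjI ballI)
  obtain b0 where "b0 \<in> B" using assms(2) by blast
  then have bdd: "bdd_above A" using assms(3) by (meson bdd_aboveI)
  show "a \<le> Sup A" if "a \<in> A" for a using cSup_upper[OF that bdd] .
  show "Sup A \<le> b" if "b \<in> B" for b using assms(1,3) that by (meson cSup_least)
qed

context
  fixes V :: "'v::real_vector set" and p :: "'v \<Rightarrow> real"
  assumes V: "subspace V"
    and triangle: "\<And>x y. x \<in> V \<Longrightarrow> y \<in> V \<Longrightarrow> p (x + y) \<le> p x + p y"
    and homogeneous: "\<And>c x. x \<in> V \<Longrightarrow> p (c *\<^sub>R x) = \<bar>c\<bar> * p x"
begin

text \<open>
  The value \<open>c\<close> at the new vector \<open>z\<close> has to satisfy \<open>b - p(y - z) \<le> c \<le> p(y' + z) - b'\<close> for all pairs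
  in \<open>G\<close>; the triangle inequality says that every lower bound is below every upper bound. General
  multiples of \<open>z\<close> reduce to \<open>z\<close> and \<open>-z\<close> by homogeneity.
\<close>

lemma hahn_banach_step:
  fixes G :: "('v \<times> real) set"
  assumes G: "subspace G"
    and dom: "\<And>y b. (y, b) \<in> G \<Longrightarrow> y \<in> V \<and> b \<le> p y"
    and z: "z \<in> V"
  shows "\<exists>c. \<forall>y b t. (y, b) \<in> G \<longrightarrow> b + t * c \<le> p (y + t *\<^sub>R z)"
proof -
  have G0: "(0, 0) \<in> G" using subspace_0[OF G] by (simp add: zero_prod_def)
  have Vz: "y - z \<in> V" "y + z \<in> V" if "(y, b) \<in> G" for y b
    using subspace_diff[OF V _ z] subspace_add[OF V _ z] dom[OF that] by auto
  define A where "A = {b - p (y - z) | y b. (y, b) \<in> G}"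
  define B where "B = {p (y + z) - b | y b. (y, b) \<in> G}"
  have "\<exists>c. (\<forall>a\<in>A. a \<le> c) \<and> (\<forall>b\<in>B. c \<le> b)"
  proof (rule sup_inf_gap)
    show "A \<noteq> {}" "B \<noteq> {}" using G0 unfolding A_def B_def by blast+
    fix a a' assume "a \<in> A" "a' \<in> B"
    then obtain y b y' b' where yb: "(y, b) \<in> G" "(y', b') \<in> G"
      and a: "a = b - p (y - z)" "a' = p (y' + z) - b'"
      unfolding A_def B_def by blast
    have "(y + y', b + b') \<in> G" using subspace_add[OF G yb] by simp
    from dom[OF this] have "b + b' \<le> p ((y - z) + (y' + z))" by simp
    also have "\<dots> \<le> p (y - z) + p (y' + z)"
      using triangle[OF Vz(1)[OF yb(1)] Vz(2)[OF yb(2)]] .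
    finally show "a \<le> a'" by (simp add: a)
  qed
  then obtain c where c: "\<forall>a\<in>A. a \<le> c" "\<forall>b\<in>B. c \<le> b" by blast
  have cA: "b - p (y - z) \<le> c" if "(y, b) \<in> G" for y b
    by (rule bspec[OF c(1)]) (use that A_def in blast)
  have cB: "c \<le> p (y + z) - b" if "(y, b) \<in> G" for y b
    by (rule bspec[OF c(2)]) (use that B_def in blast)
  have "b + t * c \<le> p (y + t *\<^sub>R z)" if yb: "(y, b) \<in> G" for y b t
  proof -
    have scaled: "((1/s) *\<^sub>R y, b / s) \<in> G" for s
      using subspace_scale[OF G yb, of "1/s"] by simp
    consider "t = 0" | "t > 0" | "t < 0" by linarith
    then show ?thesis
    proof cases
      case 1
      then show ?thesis using dom[OF yb] by simp
    next
      case 2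
      have "b + t * c \<le> t * p ((1/t) *\<^sub>R y + z)"
        using mult_left_mono[OF cB[OF scaled[of t]], of t] 2 by (simp add: algebra_simps)
      also have "\<dots> = p (t *\<^sub>R ((1/t) *\<^sub>R y + z))"
        using homogeneous[OF Vz(2)[OF scaled[of t]], of t] 2 by simp
      also have "t *\<^sub>R ((1/t) *\<^sub>R y + z) = y + t *\<^sub>R z"
        using 2 by (simp add: scaleR_add_right)
      finally show ?thesis .
    next
      case 3
      define s where "s = - t"
      have s: "s > 0" "t = - s" using 3 by (auto simp: s_def)
      have "b + t * c \<le> s * p ((1/s) *\<^sub>R y - z)"
        using mult_left_mono[OF cA[OF scaled[of s]], of s] s by (simp add: algebra_simps)
      also have "\<dots> = p (s *\<^sub>R ((1/s) *\<^sub>R y - z))"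
        using homogeneous[OF Vz(1)[OF scaled[of s]], of s] s by simp
      also have "s *\<^sub>R ((1/s) *\<^sub>R y - z) = y + t *\<^sub>R z"
        using s by (simp add: scaleR_diff_right)
      finally show ?thesis .
    qed
  qed
  then show ?thesis by blast
qed

text \<open>
  Zorn's lemma gives a maximal graph above \<open>G0\<close>. If it missed a vector \<open>z\<close> in \<open>V\<close>, adding the line
  through \<open>(z, c)\<close> with the \<open>c\<close> of the previous lemma would enlarge it.
\<close>

lemma hahn_banach_graph:
  fixes G0 :: "('v \<times> real) set"
  assumes G0: "subspace G0" "\<And>y b. (y, b) \<in> G0 \<Longrightarrow> y \<in> V \<and> b \<le> p y"
  obtains G where "subspace G" "G0 \<subseteq> G" "\<And>y b. (y, b) \<in> G \<Longrightarrow> y \<in> V \<and> b \<le> p y"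
    "fst ` G = V"
proof -
  define \<G> where "\<G> = {G. subspace G \<and> G0 \<subseteq> G \<and> (\<forall>(y, b)\<in>G. y \<in> V \<and> b \<le> p y)}"
  have "\<exists>G\<in>\<G>. \<forall>H\<in>\<G>. G \<subseteq> H \<longrightarrow> H = G"
  proof (rule subset_Zorn_nonempty)
    show "\<G> \<noteq> {}" using G0 unfolding \<G>_def by blast
    fix \<C> assume ne: "\<C> \<noteq> {}" and ch: "subset.chain \<G> \<C>"
    have mem: "G \<in> \<G>" if "G \<in> \<C>" for G
      using ch that unfolding subset.chain_def by blast
    then have sub: "subspace G" if "G \<in> \<C>" for G using that by (simp add: \<G>_def)
    have "subspace (\<Union>\<C>)"
      unfolding subspace_def
    proof (intro conjI ballI allI)
      show "0 \<in> \<Union>\<C>" using ne sub subspace_0 by blast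
      show "c *\<^sub>R x \<in> \<Union>\<C>" if "x \<in> \<Union>\<C>" for c x
        using that sub subspace_scale by blast
      show "x + y \<in> \<Union>\<C>" if xy: "x \<in> \<Union>\<C>" "y \<in> \<Union>\<C>" for x y
      proof -
        obtain G H where GH: "G \<in> \<C>" "H \<in> \<C>" "x \<in> G" "y \<in> H" using xy by blast
        then have "G \<subseteq> H \<or> H \<subseteq> G"
          using ch unfolding subset.chain_def by blast
        then have "\<exists>K\<in>\<C>. x \<in> K \<and> y \<in> K" using GH by blast
        then show ?thesis using sub subspace_add by blast
      qed
    qed
    moreover have "G0 \<subseteq> \<Union>\<C>" using ne mem unfolding \<G>_def by blast
    moreover have "\<forall>(y, b)\<in>\<Union>\<C>. y \<in> V \<and> b \<le> p y" using mem unfolding \<G>_def by blast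
    ultimately show "\<Union>\<C> \<in> \<G>" by (simp add: \<G>_def)
  qed
  then obtain G where "G \<in> \<G>" and max: "\<And>H. H \<in> \<G> \<Longrightarrow> G \<subseteq> H \<Longrightarrow> H = G" by blast
  then have G: "subspace G" "G0 \<subseteq> G" "\<And>y b. (y, b) \<in> G \<Longrightarrow> y \<in> V \<and> b \<le> p y"
    unfolding \<G>_def by auto
  have "V \<subseteq> fst ` G"
  proof
    fix z assume z: "z \<in> V"
    obtain c where c: "\<And>y b t. (y, b) \<in> G \<Longrightarrow> b + t * c \<le> p (y + t *\<^sub>R z)"
      using hahn_banach_step[OF G(1,3) z] by blast
    define H where "H = {x + y | x y. x \<in> G \<and> y \<in> span {(z, c)}}"
    have "subspace H"
      unfolding H_def using subspace_sums[OF G(1) subspace_span[of "{(z, c)}"]] .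
    moreover have "G \<subseteq> H"
    proof
      fix x assume "x \<in> G"
      then have "x + 0 \<in> H" unfolding H_def using span_zero by blast
      then show "x \<in> H" by simp
    qed
    moreover have "\<forall>(x, a)\<in>H. x \<in> V \<and> a \<le> p x"
    proof safe
      fix x a assume "(x, a) \<in> H"
      then obtain y b t where yb: "(y, b) \<in> G" and xa: "x = y + t *\<^sub>R z" "a = b + t * c"
        unfolding H_def span_singleton by auto
      show "x \<in> V" using subspace_add[OF V _ subspace_scale[OF V z]] G(3)[OF yb] xa by auto
      show "a \<le> p x" using c[OF yb] xa by simp
    qed
    ultimately have "H = G" using G(2) by (intro max) (auto simp: \<G>_def)
    have "0 + (z, c) \<in> H"
      unfolding H_def using subspace_0[OF G(1)] span_base[of "(z, c)" "{(z, c)}"] by blast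
    then show "z \<in> fst ` G" using \<open>H = G\<close> by force
  qed
  then have "fst ` G = V" using G(3) by force
  then show thesis using that G by blast
qed

lemma hahn_banach:
  fixes f :: "'v \<Rightarrow> real"
  assumes S: "subspace S" "S \<subseteq> V"
    and f_add: "\<And>x y. x \<in> S \<Longrightarrow> y \<in> S \<Longrightarrow> f (x + y) = f x + f y"
    and f_scale: "\<And>c x. x \<in> S \<Longrightarrow> f (c *\<^sub>R x) = c * f x"
    and f_bound: "\<And>x. x \<in> S \<Longrightarrow> f x \<le> p x"
  obtains g where "\<And>x. x \<in> S \<Longrightarrow> g x = f x"
    "\<And>x y. x \<in> V \<Longrightarrow> y \<in> V \<Longrightarrow> g (x + y) = g x + g y"
    "\<And>c x. x \<in> V \<Longrightarrow> g (c *\<^sub>R x) = c * g x"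
    "\<And>x. x \<in> V \<Longrightarrow> \<bar>g x\<bar> \<le> p x"
proof -
  have f0: "f 0 = 0" using f_scale[of 0 0] S(1) by (simp add: subspace_0)
  have subG0: "subspace ((\<lambda>x. (x, f x)) ` S)"
    unfolding subspace_def
  proof (intro conjI ballI allI)
    show "0 \<in> (\<lambda>x. (x, f x)) ` S"
      using subspace_0[OF S(1)] f0 by (auto simp: zero_prod_def)
    show "u + v \<in> (\<lambda>x. (x, f x)) ` S" if "u \<in> (\<lambda>x. (x, f x)) ` S" "v \<in> (\<lambda>x. (x, f x)) ` S" for u v
    proof -
      obtain x y where "x \<in> S" "u = (x, f x)" "y \<in> S" "v = (y, f y)" using \<open>u \<in> _\<close> \<open>v \<in> _\<close> by blast
      then have "x + y \<in> S" "u + v = (x + y, f (x + y))" using subspace_add[OF S(1)] f_add by auto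
      then show ?thesis by blast
    qed
    show "c *\<^sub>R u \<in> (\<lambda>x. (x, f x)) ` S" if "u \<in> (\<lambda>x. (x, f x)) ` S" for c u
    proof -
      obtain x where "x \<in> S" "u = (x, f x)" using \<open>u \<in> _\<close> by blast
      then have "c *\<^sub>R x \<in> S" "c *\<^sub>R u = (c *\<^sub>R x, f (c *\<^sub>R x))"
        using subspace_scale[OF S(1)] f_scale by auto
      then show ?thesis by blast
    qed
  qed
  obtain G where G: "subspace G" "(\<lambda>x. (x, f x)) ` S \<subseteq> G"
    and dom: "\<And>y b. (y, b) \<in> G \<Longrightarrow> y \<in> V \<and> b \<le> p y" and ran: "fst ` G = V"
  proof (rule hahn_banach_graph[OF subG0])
    show "y \<in> V \<and> b \<le> p y" if "(y, b) \<in> (\<lambda>x. (x, f x)) ` S" for y b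
      using that S(2) f_bound by auto
  qed blast
  have p0: "p 0 = 0" using homogeneous[of 0 0] subspace_0[OF V] by simp
  have zero: "a = 0" if "(0, a) \<in> G" for a
  proof -
    have "a \<le> 0" using dom[OF that] p0 by simp
    moreover have "(0, - a) \<in> G" using subspace_scale[OF G(1) that, of "-1"] by simp
    then have "- a \<le> 0" using dom p0 by fastforce
    ultimately show ?thesis by simp
  qed
  have uniq: "a = b" if "(x, a) \<in> G" "(x, b) \<in> G" for x a b
    using zero[of "a - b"] subspace_diff[OF G(1) that] by simp
  define g where "g x = (THE a. (x, a) \<in> G)" for x
  have gI: "g x = a" if "(x, a) \<in> G" for x a
    unfolding g_def using that uniq by (intro the_equality) auto
  have gG: "(x, g x) \<in> G" if "x \<in> V" for x
  proof -
    from that ran obtain a where "(x, a) \<in> G" by (metis imageE prod.collapse)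
    then show ?thesis using gI by metis
  qed
  have scale: "g (c *\<^sub>R x) = c * g x" if "x \<in> V" for c x
    using subspace_scale[OF G(1) gG[OF that], of c] by (intro gI) simp
  show thesis
  proof (rule that[of g])
    show "g x = f x" if "x \<in> S" for x using that G(2) by (intro gI) blast
    show "g (x + y) = g x + g y" if "x \<in> V" "y \<in> V" for x y
      using subspace_add[OF G(1) gG[OF that(1)] gG[OF that(2)]] by (intro gI) simp
    show "g (c *\<^sub>R x) = c * g x" if "x \<in> V" for c x using that by (rule scale)
    show "\<bar>g x\<bar> \<le> p x" if "x \<in> V" for x
    proof -
      have "- x \<in> V" using subspace_neg[OF V that] .
      then have "g (- x) \<le> p (- x)" using dom[OF gG] by blast
      moreover have "g (- x) = - g x" "p (- x) = p x"
        using scale[OF that, of "-1"] homogeneous[OF that, of "-1"] by auto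
      moreover have "g x \<le> p x" using dom[OF gG[OF that]] by blast
      ultimately show ?thesis by linarith
    qed
  qed
qed

end

lemma hahn_banach_dual:
  fixes E :: "'v::real_vector nspace" and f :: "'v \<Rightarrow> real"
  assumes E: "normed_space E" and S: "subspace S" "S \<subseteq> carrier E"
    and f_add: "\<And>x y. x \<in> S \<Longrightarrow> y \<in> S \<Longrightarrow> f (x + y) = f x + f y"
    and f_scale: "\<And>c x. x \<in> S \<Longrightarrow> f (c *\<^sub>R x) = c * f x"
    and C: "0 \<le> C" and f_bound: "\<And>x. x \<in> S \<Longrightarrow> \<bar>f x\<bar> \<le> C * nrm E x"
  obtains g where "g \<in> carrier (dual_space E)" "\<And>x. x \<in> S \<Longrightarrow> g x = f x"
    "nrm (dual_space E) g \<le> C"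
proof -
  have gE: "gauged_space E" using E by (rule normed_imp_gauged)
  have sE: "subspace (carrier E)" using gE by simp
  obtain g where g: "\<And>x. x \<in> S \<Longrightarrow> g x = f x"
    "\<And>x y. x \<in> carrier E \<Longrightarrow> y \<in> carrier E \<Longrightarrow> g (x + y) = g x + g y"
    "\<And>c x. x \<in> carrier E \<Longrightarrow> g (c *\<^sub>R x) = c * g x"
    "\<And>x. x \<in> carrier E \<Longrightarrow> \<bar>g x\<bar> \<le> C * nrm E x"
  proof (rule hahn_banach[OF sE _ _ S, where p = "\<lambda>x. C * nrm E x" and f = f])
    show "C * nrm E (x + y) \<le> C * nrm E x + C * nrm E y" if "x \<in> carrier E" "y \<in> carrier E" for x y
      using mult_left_mono[OF normed_space_triangle[OF E that] C] by (simp add: algebra_simps)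
    show "C * nrm E (c *\<^sub>R x) = \<bar>c\<bar> * (C * nrm E x)" if "x \<in> carrier E" for c x
      using gauged_space_scale[OF gE that] by simp
    show "f x \<le> C * nrm E x" if "x \<in> S" for x using f_bound[OF that] by simp
  qed (use f_add f_scale in auto)
  define g' where "g' x = (if x \<in> carrier E then g x else 0)" for x
  have lin: "g' \<in> lin_maps E"
    unfolding lin_maps_def g'_def using g(2,3) subspace_add[OF sE] subspace_scale[OF sE] by simp
  show thesis
  proof (rule that[of g'])
    show "g' \<in> carrier (dual_space E)"
      using g(4) by (intro in_dualI[OF lin, of C]) (simp add: g'_def)
    show "g' x = f x" if "x \<in> S" for x using g(1) S(2) that by (auto simp: g'_def)
    show "nrm (dual_space E) g' \<le> C"
      using g(4) by (intro dual_norm_least[OF gE C]) (simp add: g'_def)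
  qed
qed

lemma norming_functional:
  assumes E: "normed_space E" and x: "x \<in> carrier E"
  obtains g where "g \<in> carrier (dual_space E)" "g x = nrm E x" "nrm (dual_space E) g \<le> 1"
proof (cases "x = 0")
  case True
  have gE: "gauged_space E" using E by (rule normed_imp_gauged)
  have "0 \<in> carrier (dual_space E)" using gauged_dual_space[OF gE] by simp
  moreover have "nrm (dual_space E) 0 \<le> 1" using gauged_dual_space[OF gE] by simp
  ultimately show thesis using that[of 0] True gE by simp
next
  case False
  have gE: "gauged_space E" using E by (rule normed_imp_gauged)
  define f where "f y = (THE c. y = c *\<^sub>R x) * nrm E x" for y
  have f: "f (c *\<^sub>R x) = c * nrm E x" for c
  proof -
    have "(THE d. c *\<^sub>R x = d *\<^sub>R x) = c" using False by (intro the_equality) auto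
    then show ?thesis by (simp add: f_def)
  qed
  obtain g where "g \<in> carrier (dual_space E)" "\<And>y. y \<in> span {x} \<Longrightarrow> g y = f y"
    "nrm (dual_space E) g \<le> 1"
  proof (rule hahn_banach_dual[OF E subspace_span, of "{x}" f 1])
    show "span {x} \<subseteq> carrier E"
      using x gE by (intro span_minimal) auto
    show "f (y + z) = f y + f z" if "y \<in> span {x}" "z \<in> span {x}" for y z
    proof -
      obtain c d where "y = c *\<^sub>R x" "z = d *\<^sub>R x" using \<open>y \<in> _\<close> \<open>z \<in> _\<close> unfolding span_singleton by blast
      then show ?thesis using f[of "c + d"] f[of c] f[of d] by (simp add: algebra_simps)
    qed
    show "f (c *\<^sub>R y) = c * f y" if "y \<in> span {x}" for c y
    proof -
      obtain d where "y = d *\<^sub>R x" using \<open>y \<in> _\<close> unfolding span_singleton by blast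
      then show ?thesis using f[of "c * d"] f[of d] by simp
    qed
    show "\<bar>f y\<bar> \<le> 1 * nrm E y" if "y \<in> span {x}" for y
    proof -
      obtain d where "y = d *\<^sub>R x" using \<open>y \<in> _\<close> unfolding span_singleton by blast
      then show ?thesis using f[of d] gauged_space_scale[OF gE x] x gE by (simp add: abs_mult)
    qed
  qed auto
  moreover have "f x = nrm E x" using f[of 1] by simp
  ultimately show thesis using that span_base[of x "{x}"] by simp
qed

section \<open>Isometric copies and composition in operator ideals\<close>

lemma isometry_ontoD:
  assumes "isometry_onto E F \<phi>"
  shows "\<phi> \<in> bd_ops E F" "\<phi> ` carrier E = carrier F" "\<And>x. x \<in> carrier E \<Longrightarrow> nrm F (\<phi> x) = nrm E x"
  using assms by (auto simp: isometry_onto_def)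

lemma isometry_onto_inverse:
  assumes E: "normed_space E" and F: "gauged_space F" and iso: "isometry_onto E F \<phi>"
  obtains \<psi> where "isometry_onto F E \<psi>" "\<And>x. x \<in> carrier E \<Longrightarrow> \<psi> (\<phi> x) = x"
    "\<And>y. y \<in> carrier F \<Longrightarrow> \<phi> (\<psi> y) = y"
proof -
  note \<phi> = isometry_ontoD[OF iso]
  have gE: "gauged_space E" using E by (rule normed_imp_gauged)
  note sE = gauged_space_subspace[OF gE] and sF = gauged_space_subspace[OF F]
  note lin = bd_ops_lin[OF \<phi>(1)]
  have inj: "x = y" if "x \<in> carrier E" "y \<in> carrier E" "\<phi> x = \<phi> y" for x y
  proof -
    have d: "x - y \<in> carrier E" using subspace_diff[OF sE that(1,2)] .
    have "\<phi> (x - y) = 0" using lin_maps_diff[OF sE lin that(1,2)] that(3) by simp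
    then have "nrm E (x - y) = 0" using \<phi>(3)[OF d] F by simp
    then show ?thesis using normed_space_definite[OF E d] by simp
  qed
  define \<psi> where "\<psi> y = (if y \<in> carrier F then (SOME x. x \<in> carrier E \<and> \<phi> x = y) else 0)" for y
  have \<psi>: "\<psi> y \<in> carrier E \<and> \<phi> (\<psi> y) = y" if "y \<in> carrier F" for y
  proof -
    have "\<exists>x. x \<in> carrier E \<and> \<phi> x = y" using that \<phi>(2) by (metis imageE)
    from someI_ex[OF this] that show ?thesis by (simp add: \<psi>_def)
  qed
  have left: "\<psi> (\<phi> x) = x" if "x \<in> carrier E" for x
    using inj \<psi>[OF bd_ops_range[OF \<phi>(1) that]] that by blast
  have "\<psi> \<in> bd_ops F E"
  proof (rule bd_opsI[where C = 1])
    show "\<psi> \<in> lin_maps F"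
      unfolding lin_maps_def
    proof (safe)
      fix y z assume yz: "y \<in> carrier F" "z \<in> carrier F"
      have "\<phi> (\<psi> y + \<psi> z) = y + z" "\<psi> y + \<psi> z \<in> carrier E"
        using lin_maps_add[OF lin, of "\<psi> y" "\<psi> z"] \<psi>[OF yz(1)] \<psi>[OF yz(2)] subspace_add[OF sE] by auto
      then show "\<psi> (y + z) = \<psi> y + \<psi> z" using left by metis
    next
      fix c y assume y: "y \<in> carrier F"
      have "\<phi> (c *\<^sub>R \<psi> y) = c *\<^sub>R y" "c *\<^sub>R \<psi> y \<in> carrier E"
        using lin_maps_scale[OF lin, of "\<psi> y"] \<psi>[OF y] subspace_scale[OF sE] by auto
      then show "\<psi> (c *\<^sub>R y) = c *\<^sub>R \<psi> y" using left by metis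
    qed (simp add: \<psi>_def)
    show "\<psi> y \<in> carrier E" if "y \<in> carrier F" for y using \<psi>[OF that] by blast
    show "nrm E (\<psi> y) \<le> 1 * nrm F y" if "y \<in> carrier F" for y
      using \<psi>[OF that] \<phi>(3)[of "\<psi> y"] by simp
  qed
  moreover have "\<psi> ` carrier F = carrier E"
  proof
    show "\<psi> ` carrier F \<subseteq> carrier E" using \<psi> by blast
    show "carrier E \<subseteq> \<psi> ` carrier F"
    proof
      fix x assume "x \<in> carrier E"
      then show "x \<in> \<psi> ` carrier F" using left[of x] bd_ops_range[OF \<phi>(1), of x] by (metis imageI)
    qed
  qed
  moreover have "nrm E (\<psi> y) = nrm F y" if "y \<in> carrier F" for y
    using \<psi>[OF that] \<phi>(3)[of "\<psi> y"] by simp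
  ultimately show thesis using that[of \<psi>] left \<psi> by (auto simp: isometry_onto_def)
qed

lemma isometry_onto_comp:
  assumes "gauged_space D" "gauged_space E" "gauged_space F" "isometry_onto D E \<theta>" "isometry_onto E F \<phi>"
  shows "isometry_onto D F (\<phi> \<circ> \<theta>)"
  unfolding isometry_onto_def
proof (intro conjI ballI)
  note \<theta> = isometry_ontoD[OF assms(4)] and \<phi> = isometry_ontoD[OF assms(5)]
  show "\<phi> \<circ> \<theta> \<in> bd_ops D F" using bd_ops_comp[OF assms(1-3) \<theta>(1) \<phi>(1)] .
  show "(\<phi> \<circ> \<theta>) ` carrier D = carrier F" using \<theta>(2) \<phi>(2) by (metis image_comp)
  show "nrm F ((\<phi> \<circ> \<theta>) x) = nrm D x" if "x \<in> carrier D" for x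
    using \<theta>(3)[OF that] \<phi>(3)[OF bd_ops_range[OF \<theta>(1) that]] by simp
qed

lemma isometry_onto_dual_op:
  assumes E: "normed_space E" and F: "gauged_space F" and iso: "isometry_onto E F \<phi>"
  shows "isometry_onto (dual_space F) (dual_space E) (dual_op E F \<phi>)"
  unfolding isometry_onto_def
proof (intro conjI ballI)
  note \<phi> = isometry_ontoD[OF iso]
  have gE: "gauged_space E" using E by (rule normed_imp_gauged)
  obtain \<psi> where iso': "isometry_onto F E \<psi>" and inv: "\<And>x. x \<in> carrier E \<Longrightarrow> \<psi> (\<phi> x) = x"
    "\<And>y. y \<in> carrier F \<Longrightarrow> \<phi> (\<psi> y) = y"
    by (rule isometry_onto_inverse[OF E F iso]) blast
  note \<psi> = isometry_ontoD[OF iso']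
  show bd: "dual_op E F \<phi> \<in> bd_ops (dual_space F) (dual_space E)"
    using dual_op_bd[OF gE F \<phi>(1)] .
  have right: "dual_op E F \<phi> (dual_op F E \<psi> g) = g" "dual_op F E \<psi> g \<in> carrier (dual_space F)"
    if g: "g \<in> carrier (dual_space E)" for g
  proof -
    show *: "dual_op F E \<psi> g \<in> carrier (dual_space F)"
      using bd_ops_range[OF dual_op_bd[OF F gE \<psi>(1)] g] .
    show "dual_op E F \<phi> (dual_op F E \<psi> g) = g"
    proof
      fix x
      have "g (\<psi> (\<phi> x)) = g x"
      proof (cases "x \<in> carrier E")
        case False
        then have "\<psi> (\<phi> x) = 0"
          using lin_maps_off[OF bd_ops_lin[OF \<phi>(1)]] lin_maps_zero[OF _ bd_ops_lin[OF \<psi>(1)]] F by simp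
        then show ?thesis
          using False lin_maps_off[OF dual_lin[OF g]] lin_maps_zero[OF _ dual_lin[OF g]] gE by simp
      qed (simp add: inv)
      then show "dual_op E F \<phi> (dual_op F E \<psi> g) x = g x"
        using g * by (simp add: dual_op_apply)
    qed
  qed
  show "dual_op E F \<phi> ` carrier (dual_space F) = carrier (dual_space E)"
    using bd_ops_range[OF bd] right by (metis (no_types, lifting) image_eqI image_subsetI subsetI subset_antisym)
  fix g assume g: "g \<in> carrier (dual_space F)"
  show "nrm (dual_space E) (dual_op E F \<phi> g) = nrm (dual_space F) g"
  proof (rule antisym)
    show "nrm (dual_space E) (dual_op E F \<phi> g) \<le> nrm (dual_space F) g"
      using dual_op_norm[OF gE F \<phi>(1), of 1] \<phi>(3) g by simp
    have h: "dual_op E F \<phi> g \<in> carrier (dual_space E)" using bd_ops_range[OF bd g] .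
    show "nrm (dual_space F) g \<le> nrm (dual_space E) (dual_op E F \<phi> g)"
    proof (rule dual_norm_least[OF F])
      show "0 \<le> nrm (dual_space E) (dual_op E F \<phi> g)"
        using gauged_space_nonneg[OF gauged_dual_space[OF gE] h] .
      fix y assume y: "y \<in> carrier F"
      have "\<bar>dual_op E F \<phi> g (\<psi> y)\<bar> \<le> nrm (dual_space E) (dual_op E F \<phi> g) * nrm E (\<psi> y)"
        using dual_norm_bound[OF gE h bd_ops_range[OF \<psi>(1) y]] .
      then show "\<bar>g y\<bar> \<le> nrm (dual_space E) (dual_op E F \<phi> g) * nrm F y"
        using \<psi>(3)[OF y] inv(2)[OF y] g by (simp add: dual_op_apply)
    qed
  qed
qed

lemma is_copy_precomp:
  assumes "gauged_space D" "gauged_space E" "isometry_onto D E \<theta>" "is_copy E G \<eta>"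
  shows "is_copy D G (\<eta> \<circ> \<theta>)"
  using assms(4) isometry_onto_comp[OF assms(1,2) _ assms(3), of G \<eta>] by (simp add: is_copy_def banach_imp_gauged)

text \<open>
  Transport of structure: the image of a Banach space under an injective linear map carries the
  transported norm.
\<close>

lemma copy_along_injection:
  fixes h :: "'v::real_vector \<Rightarrow> 'u::real_vector"
  assumes E: "banach_space (E :: 'v nspace)" and h: "linear h" "inj h"
  obtains E' \<phi> where "is_copy E (E' :: 'u nspace) \<phi>"
proof -
  define E' where "E' = NSpace (h ` carrier E) (\<lambda>y. nrm E (inv h y))"
  define \<phi> where "\<phi> x = (if x \<in> carrier E then h x else 0)" for x
  have inv [simp]: "inv h (h x) = x" for x using h(2) by simp
  have cE': "carrier E' = h ` carrier E" and nE': "\<And>x. nrm E' (h x) = nrm E x"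
    by (auto simp: E'_def)
  have nE: "normed_space E" using E by (rule banach_imp_normed)
  have gE: "gauged_space E" using E by (rule banach_imp_gauged)
  note sE = gauged_space_subspace[OF gE]
  have h_eq: "h x + h y = h (x + y)" "c *\<^sub>R h x = h (c *\<^sub>R x)" "h x - h y = h (x - y)" "h x = 0 \<longleftrightarrow> x = 0"
    for x y c
    using linear_add[OF h(1)] linear_scale[OF h(1)] linear_diff[OF h(1)] linear_injective_0[OF h(1)] h(2)
      linear_0[OF h(1)] by auto
  have "normed_space E'"
    unfolding normed_space_def cE'
    using nE linear_subspace_image[OF h(1) sE]
    by (auto simp: h_eq nE' normed_space_def)
  moreover have "\<exists>x\<in>carrier E'. (\<lambda>n. nrm E' (s n - x)) \<longlonglongrightarrow> 0"
    if s: "\<And>n. s n \<in> carrier E'"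
      and cau: "\<forall>\<epsilon>>0. \<exists>N. \<forall>m\<ge>N. \<forall>n\<ge>N. nrm E' (s m - s n) < \<epsilon>" for s
  proof -
    have "\<forall>n. \<exists>x. x \<in> carrier E \<and> s n = h x" using s cE' by blast
    then obtain t where t: "\<And>n. t n \<in> carrier E" "\<And>n. s n = h (t n)" by metis
    then have "\<forall>\<epsilon>>0. \<exists>N. \<forall>m\<ge>N. \<forall>n\<ge>N. nrm E (t m - t n) < \<epsilon>"
      using cau by (simp add: h_eq nE')
    then obtain x where "x \<in> carrier E" "(\<lambda>n. nrm E (t n - x)) \<longlonglongrightarrow> 0"
      using E t(1) unfolding banach_space_def by blast
    then have "h x \<in> carrier E'" "(\<lambda>n. nrm E' (s n - h x)) \<longlonglongrightarrow> 0"
      using t(2) by (auto simp: h_eq nE' cE')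
    then show ?thesis by blast
  qed
  ultimately have "banach_space E'" unfolding banach_space_def by blast
  moreover have "isometry_onto E E' \<phi>"
    unfolding isometry_onto_def
  proof (intro conjI ballI)
    show "\<phi> \<in> bd_ops E E'"
    proof (rule bd_opsI[where C = 1])
      show "\<phi> \<in> lin_maps E"
        unfolding lin_maps_def \<phi>_def using subspace_add[OF sE] subspace_scale[OF sE] by (simp add: h_eq)
    qed (auto simp: \<phi>_def cE' nE')
    show "\<phi> ` carrier E = carrier E'" by (auto simp: \<phi>_def cE')
    show "nrm E' (\<phi> x) = nrm E x" if "x \<in> carrier E" for x using that by (simp add: \<phi>_def nE')
  qed
  ultimately show thesis using that by (simp add: is_copy_def)
qed

text \<open>
  Membership of \<open>T\<close> in the ideal is witnessed on some copies of \<open>E\<close> and \<open>F\<close>. Conjugating \<open>R\<close> and \<open>S\<close>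
  with these copies and with the given copies of \<open>D\<close> and \<open>G\<close> brings the composite into the range of
  the ideal property.
\<close>

lemma ideal_ops_comp:
  fixes \<A> :: "'u::real_vector op_class"
  assumes \<A>: "operator_ideal \<A>" and T: "T \<in> ideal_ops \<A> E F"
    and sp: "normed_space D" "normed_space E" "normed_space F" "normed_space G"
    and R: "R \<in> bd_ops D E" and S: "S \<in> bd_ops F G"
    and copies: "is_copy D (D' :: 'u nspace) \<theta>" "is_copy G (G' :: 'u nspace) \<eta>"
  shows "S \<circ> T \<circ> R \<in> ideal_ops \<A> D G"
proof -
  note g = sp[THEN normed_imp_gauged]
  obtain E' F' :: "'u nspace" and \<phi> \<psi> T' where E': "is_copy E E' \<phi>" and F': "is_copy F F' \<psi>"
    and T': "T' \<in> \<A> E' F'" "\<And>x. x \<in> carrier E \<Longrightarrow> T' (\<phi> x) = \<psi> (T x)" and bT: "T \<in> bd_ops E F"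
    using T unfolding ideal_ops_def by blast
  have b: "banach_space D'" "banach_space E'" "banach_space F'" "banach_space G'"
    and iso: "isometry_onto D D' \<theta>" "isometry_onto E E' \<phi>" "isometry_onto F F' \<psi>" "isometry_onto G G' \<eta>"
    using copies E' F' by (auto simp: is_copy_def)
  note g' = b[THEN banach_imp_gauged]
  obtain \<theta>' where \<theta>': "isometry_onto D' D \<theta>'" "\<And>x. x \<in> carrier D \<Longrightarrow> \<theta>' (\<theta> x) = x"
    by (rule isometry_onto_inverse[OF sp(1) g'(1) iso(1)]) blast
  obtain \<psi>' where \<psi>': "isometry_onto F' F \<psi>'" "\<And>x. x \<in> carrier F \<Longrightarrow> \<psi>' (\<psi> x) = x"
    by (rule isometry_onto_inverse[OF sp(3) g'(3) iso(3)]) blast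
  have 1: "\<phi> \<circ> R \<circ> \<theta>' \<in> bd_ops D' E'"
    using bd_ops_comp[OF g'(1) g(1) g'(2) isometry_ontoD(1)[OF \<theta>'(1)]
      bd_ops_comp[OF g(1,2) g'(2) R isometry_ontoD(1)[OF iso(2)]]] .
  have 2: "\<eta> \<circ> S \<circ> \<psi>' \<in> bd_ops F' G'"
    using bd_ops_comp[OF g'(3) g(3) g'(4) isometry_ontoD(1)[OF \<psi>'(1)]
      bd_ops_comp[OF g(3,4) g'(4) S isometry_ontoD(1)[OF iso(4)]]] .
  have 3: "(\<eta> \<circ> S \<circ> \<psi>') \<circ> T' \<circ> (\<phi> \<circ> R \<circ> \<theta>') \<in> \<A> D' G'"
  proof -
    have "\<forall>E\<^sub>0 E F F\<^sub>0. banach_space E\<^sub>0 \<and> banach_space E \<and> banach_space F \<and> banach_space F\<^sub>0 \<longrightarrow>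
      (\<forall>R\<in>bd_ops E\<^sub>0 E. \<forall>S\<in>\<A> E F. \<forall>T\<in>bd_ops F F\<^sub>0. T \<circ> S \<circ> R \<in> \<A> E\<^sub>0 F\<^sub>0)"
      using \<A> unfolding operator_ideal_def by (rule conjunct2)
    from this[rule_format, OF _ 1 T'(1) 2] b show ?thesis by blast
  qed
  have 4: "((\<eta> \<circ> S \<circ> \<psi>') \<circ> T' \<circ> (\<phi> \<circ> R \<circ> \<theta>')) (\<theta> x) = \<eta> ((S \<circ> T \<circ> R) x)" if "x \<in> carrier D" for x
    using \<theta>'(2)[OF that] T'(2)[OF bd_ops_range[OF R that]]
      \<psi>'(2)[OF bd_ops_range[OF bT bd_ops_range[OF R that]]] by simp
  have 5: "S \<circ> T \<circ> R \<in> bd_ops D G"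
    using bd_ops_comp[OF g(1,2,4) R bd_ops_comp[OF g(2-4) bT S]] by (simp add: comp_assoc)
  show ?thesis
    unfolding ideal_ops_def
    by (rule CollectI, intro conjI exI bexI ballI, rule 5, rule copies(1), rule copies(2), rule 4, assumption, rule 3)
qed


section \<open>Norm closures and convergence of bounded nets\<close>

lemma norm_closureI:
  assumes "x \<in> carrier E" "\<And>\<epsilon>. \<epsilon> > 0 \<Longrightarrow> \<exists>y\<in>S. nrm E (x - y) < \<epsilon>"
  shows "x \<in> norm_closure E S"
  using assms by (simp add: norm_closure_def)

lemma norm_closure_carrier: "x \<in> norm_closure E S \<Longrightarrow> x \<in> carrier E"
  by (simp add: norm_closure_def)

lemma norm_closure_approx:
  assumes "x \<in> norm_closure E S" "\<epsilon> > 0"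
  obtains y where "y \<in> S" "nrm E (x - y) < \<epsilon>"
  using assms unfolding norm_closure_def by blast

lemma norm_closure_superset:
  assumes "gauged_space E" "S \<subseteq> carrier E"
  shows "S \<subseteq> norm_closure E S"
proof
  fix x assume x: "x \<in> S"
  then have "nrm E (x - x) = 0" using assms(1) by simp
  then show "x \<in> norm_closure E S" using x assms(2) by (intro norm_closureI bexI[of _ x]) auto
qed

lemma subspace_norm_closure:
  assumes E: "normed_space E" and S: "subspace S" "S \<subseteq> carrier E"
  shows "subspace (norm_closure E S)"
  unfolding subspace_def
proof (intro conjI ballI allI)
  have gE: "gauged_space E" using E by (rule normed_imp_gauged)
  note sE = gauged_space_subspace[OF gE]
  show "0 \<in> norm_closure E S"
    using norm_closure_superset[OF gE S(2)] subspace_0[OF S(1)] by blast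
  show "x + y \<in> norm_closure E S" if xy: "x \<in> norm_closure E S" "y \<in> norm_closure E S" for x y
  proof (rule norm_closureI)
    note c = norm_closure_carrier[OF xy(1)] norm_closure_carrier[OF xy(2)]
    show "x + y \<in> carrier E" using subspace_add[OF sE c] .
    fix \<epsilon> :: real assume "\<epsilon> > 0"
    then have "\<epsilon>/2 > 0" by simp
    obtain a where a: "a \<in> S" "nrm E (x - a) < \<epsilon>/2" using norm_closure_approx[OF xy(1) \<open>\<epsilon>/2 > 0\<close>] .
    obtain b where b: "b \<in> S" "nrm E (y - b) < \<epsilon>/2" using norm_closure_approx[OF xy(2) \<open>\<epsilon>/2 > 0\<close>] .
    have ab: "a \<in> carrier E" "b \<in> carrier E" using a b S(2) by auto
    have "nrm E ((x - a) + (y - b)) \<le> nrm E (x - a) + nrm E (y - b)"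
      using normed_space_triangle[OF E subspace_diff[OF sE c(1) ab(1)] subspace_diff[OF sE c(2) ab(2)]] .
    also have "\<dots> < \<epsilon>" using a b by simp
    finally have "nrm E ((x + y) - (a + b)) < \<epsilon>" by (simp add: add_diff_add)
    then show "\<exists>z\<in>S. nrm E ((x + y) - z) < \<epsilon>" using subspace_add[OF S(1) a(1) b(1)] by blast
  qed
  show "c *\<^sub>R x \<in> norm_closure E S" if x: "x \<in> norm_closure E S" for c x
  proof (rule norm_closureI)
    note cx = norm_closure_carrier[OF x]
    show "c *\<^sub>R x \<in> carrier E" using subspace_scale[OF sE cx] .
    fix \<epsilon> :: real assume "\<epsilon> > 0"
    then have "\<epsilon> / (\<bar>c\<bar> + 1) > 0" by simp
    then obtain a where a: "a \<in> S" "nrm E (x - a) < \<epsilon> / (\<bar>c\<bar> + 1)"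
      using norm_closure_approx[OF x] by blast
    have d: "x - a \<in> carrier E" using subspace_diff[OF sE cx] a(1) S(2) by blast
    have "nrm E (c *\<^sub>R x - c *\<^sub>R a) = \<bar>c\<bar> * nrm E (x - a)"
      using gauged_space_scale[OF gE d, of c] by (simp add: scaleR_diff_right)
    also have "\<dots> \<le> (\<bar>c\<bar> + 1) * nrm E (x - a)"
      using gauged_space_nonneg[OF gE d] by (intro mult_right_mono) auto
    also have "\<dots> < \<epsilon>" using a(2) by (simp add: field_simps add_pos_nonneg)
    finally show "\<exists>z\<in>S. nrm E (c *\<^sub>R x - z) < \<epsilon>" using subspace_scale[OF S(1) a(1)] by blast
  qed
qed

lemma normed_space_restrict:
  assumes "normed_space E" "subspace W" "W \<subseteq> carrier E"
  shows "normed_space (NSpace W (nrm E))"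
proof -
  have "x \<in> carrier E" if "x \<in> W" for x using assms(3) that by blast
  with assms(1,2) show ?thesis by (simp add: normed_space_def)
qed

text \<open>
  An \<open>\<epsilon>/3\<close> argument: the common Lipschitz constant \<open>C\<close> allows one to replace \<open>x\<close> by a nearby point
  of \<open>D\<close> simultaneously in all members of the family and in the limit.
\<close>

lemma tendsto_on_norm_closure:
  fixes \<Phi> :: "'i \<Rightarrow> 'v::real_vector \<Rightarrow> real"
  assumes E: "gauged_space E" and x: "x \<in> norm_closure E D" and D: "D \<subseteq> carrier E"
    and lip: "\<forall>\<^sub>F i in F. \<forall>y\<in>carrier E. \<forall>z\<in>carrier E. \<bar>\<Phi> i y - \<Phi> i z\<bar> \<le> C * nrm E (y - z)"
    and lip': "\<forall>y\<in>carrier E. \<forall>z\<in>carrier E. \<bar>\<phi> y - \<phi> z\<bar> \<le> C * nrm E (y - z)"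
    and lim: "\<And>y. y \<in> D \<Longrightarrow> ((\<lambda>i. \<Phi> i y) \<longlongrightarrow> \<phi> y) F"
  shows "((\<lambda>i. \<Phi> i x) \<longlongrightarrow> \<phi> x) F"
proof (rule tendstoI)
  fix \<epsilon> :: real assume \<epsilon>: "\<epsilon> > 0"
  define \<eta> where "\<eta> = \<epsilon> / (3 * (\<bar>C\<bar> + 1))"
  have \<eta>: "\<eta> > 0" using \<epsilon> by (simp add: \<eta>_def add_nonneg_pos)
  have C\<eta>: "\<bar>C\<bar> * \<eta> \<le> \<epsilon> / 3"
    using \<epsilon> by (simp add: \<eta>_def field_simps add_nonneg_pos)
  obtain y where y: "y \<in> D" "nrm E (x - y) < \<eta>" using norm_closure_approx[OF x \<eta>] .
  have xE: "x \<in> carrier E" using norm_closure_carrier[OF x] .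
  have yE: "y \<in> carrier E" using y(1) D by blast
  have small: "\<bar>g x - g y\<bar> \<le> \<epsilon> / 3"
    if g: "\<forall>y\<in>carrier E. \<forall>z\<in>carrier E. \<bar>g y - g z\<bar> \<le> C * nrm E (y - z)" for g :: "'v \<Rightarrow> real"
  proof -
    have *: "\<bar>g x - g y\<bar> \<le> C * nrm E (x - y)" using g xE yE by blast
    have nn: "0 \<le> nrm E (x - y)"
      using gauged_space_nonneg[OF E subspace_diff[OF gauged_space_subspace[OF E] xE yE]] .
    have "C * nrm E (x - y) \<le> \<bar>C\<bar> * nrm E (x - y)" using nn by (intro mult_right_mono) auto
    also have "\<dots> \<le> \<bar>C\<bar> * \<eta>" using y(2) by (intro mult_left_mono) auto
    finally show ?thesis using * C\<eta> by linarith
  qed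
  have "\<forall>\<^sub>F i in F. dist (\<Phi> i y) (\<phi> y) < \<epsilon> / 3"
    using tendstoD[OF lim[OF y(1)], of "\<epsilon>/3"] \<epsilon> by simp
  then show "\<forall>\<^sub>F i in F. dist (\<Phi> i x) (\<phi> x) < \<epsilon>"
    using lip
  proof eventually_elim
    case (elim i)
    have "\<bar>\<Phi> i x - \<Phi> i y\<bar> \<le> \<epsilon> / 3" using small[OF elim(2)] .
    moreover have "\<bar>\<phi> x - \<phi> y\<bar> \<le> \<epsilon> / 3" using small[OF lip'] .
    ultimately show ?case using elim(1) unfolding dist_real_def by linarith
  qed
qed

lemma tendsto_on_span:
  fixes \<Phi> :: "'i \<Rightarrow> 'v::real_vector \<Rightarrow> real"
  assumes E: "subspace (carrier E)" and S: "S \<subseteq> carrier E"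
    and lin: "\<forall>\<^sub>F i in F. \<Phi> i \<in> lin_maps E" "\<phi> \<in> lin_maps E"
    and lim: "\<And>y. y \<in> S \<Longrightarrow> ((\<lambda>i. \<Phi> i y) \<longlongrightarrow> \<phi> y) F"
    and x: "x \<in> span S"
  shows "((\<lambda>i. \<Phi> i x) \<longlongrightarrow> \<phi> x) F"
proof -
  have split: "\<psi> (c *\<^sub>R y + z) = c * \<psi> y + \<psi> z"
    if "\<psi> \<in> lin_maps E" "y \<in> carrier E" "z \<in> carrier E" for \<psi> :: "'v \<Rightarrow> real" and c y z
    using lin_maps_add[OF that(1) subspace_scale[OF E that(2)] that(3)] lin_maps_scale[OF that(1,2)] by simp
  from x have "x \<in> carrier E \<and> ((\<lambda>i. \<Phi> i x) \<longlongrightarrow> \<phi> x) F"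
  proof (induction rule: span_induct_alt)
    case base
    have "\<forall>\<^sub>F i in F. \<Phi> i 0 = 0"
      using lin(1) by eventually_elim (rule lin_maps_zero[OF E])
    then show ?case using lin_maps_zero[OF E lin(2)] subspace_0[OF E] by (simp add: tendsto_eventually)
  next
    case (step c y z)
    have y: "y \<in> carrier E" and z: "z \<in> carrier E" using S step by auto
    have "((\<lambda>i. c * \<Phi> i y + \<Phi> i z) \<longlongrightarrow> c * \<phi> y + \<phi> z) F"
      using lim[OF step(1)] step(2) by (intro tendsto_intros) auto
    moreover have "\<forall>\<^sub>F i in F. c * \<Phi> i y + \<Phi> i z = \<Phi> i (c *\<^sub>R y + z)"
      using lin(1) by eventually_elim (simp add: split y z)
    ultimately have "((\<lambda>i. \<Phi> i (c *\<^sub>R y + z)) \<longlongrightarrow> \<phi> (c *\<^sub>R y + z)) F"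
      unfolding split[OF lin(2) y z] by (rule Lim_transform_eventually)
    then show ?case using subspace_add[OF E subspace_scale[OF E y] z] by blast
  qed
  then show ?thesis ..
qed

text \<open>
  The form in which a norm bound enters \<open>tendsto_on_norm_closure\<close>.
\<close>

lemma dual_lipschitz:
  assumes E: "gauged_space E" and g: "g \<in> carrier (dual_space E)" "nrm (dual_space E) g \<le> C"
  shows "\<forall>y\<in>carrier E. \<forall>z\<in>carrier E. \<bar>g y - g z\<bar> \<le> C * nrm E (y - z)"
proof (intro ballI)
  fix y z assume yz: "y \<in> carrier E" "z \<in> carrier E"
  note sE = gauged_space_subspace[OF E]
  have d: "y - z \<in> carrier E" using subspace_diff[OF sE yz] .
  have "\<bar>g (y - z)\<bar> \<le> nrm (dual_space E) g * nrm E (y - z)"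
    using dual_norm_bound[OF E g(1) d] .
  also have "\<dots> \<le> C * nrm E (y - z)"
    using g(2) gauged_space_nonneg[OF E d] by (rule mult_right_mono)
  finally show "\<bar>g y - g z\<bar> \<le> C * nrm E (y - z)"
    using lin_maps_diff[OF sE dual_lin[OF g(1)] yz] by simp
qed

lemma tendsto_on_closed_span:
  assumes E: "gauged_space E" and S: "S \<subseteq> carrier E"
    and \<Phi>: "\<forall>\<^sub>F i in F. \<Phi> i \<in> carrier (dual_space E) \<and> nrm (dual_space E) (\<Phi> i) \<le> C"
    and \<phi>: "\<phi> \<in> carrier (dual_space E)"
    and lim: "\<And>y. y \<in> S \<Longrightarrow> ((\<lambda>i. \<Phi> i y) \<longlongrightarrow> \<phi> y) F"
    and x: "x \<in> norm_closure E (span S)"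
  shows "((\<lambda>i. \<Phi> i x) \<longlongrightarrow> \<phi> x) F"
proof (rule tendsto_on_norm_closure[OF E x])
  note sE = gauged_space_subspace[OF E]
  define K where "K = max C (nrm (dual_space E) \<phi>)"
  show "span S \<subseteq> carrier E" using span_minimal[OF S sE] .
  show "\<forall>\<^sub>F i in F. \<forall>y\<in>carrier E. \<forall>z\<in>carrier E. \<bar>\<Phi> i y - \<Phi> i z\<bar> \<le> K * nrm E (y - z)"
    using \<Phi>
  proof eventually_elim
    case (elim i)
    then show ?case by (intro dual_lipschitz[OF E]) (simp_all add: K_def le_max_iff_disj)
  qed
  show "\<forall>y\<in>carrier E. \<forall>z\<in>carrier E. \<bar>\<phi> y - \<phi> z\<bar> \<le> K * nrm E (y - z)"
    by (rule dual_lipschitz[OF E \<phi>]) (simp add: K_def)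
  have "\<forall>\<^sub>F i in F. \<Phi> i \<in> lin_maps E"
    using \<Phi> by eventually_elim (simp add: dual_lin)
  then show "((\<lambda>i. \<Phi> i y) \<longlongrightarrow> \<phi> y) F" if "y \<in> span S" for y
    using tendsto_on_span[OF sE S _ dual_lin[OF \<phi>] lim that] by blast
qed

section \<open>Lipschitz functions\<close>

lemma lip0_space_simps: "carrier (lip0_space E) = lip0 E real_space" "nrm (lip0_space E) = lip_norm E real_space"
  by (simp_all add: lip0_space_def)

lemma lip0D:
  assumes "f \<in> lip0 E F"
  shows "\<And>x. x \<in> carrier E \<Longrightarrow> f x \<in> carrier F" "f 0 = 0" "\<And>x. x \<notin> carrier E \<Longrightarrow> f x = 0"
  using assms by (auto simp: lip0_def)

lemma lip0I:
  assumes "\<And>x. x \<in> carrier E \<Longrightarrow> f x \<in> carrier F" "f 0 = 0" "\<And>x. x \<notin> carrier E \<Longrightarrow> f x = 0"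
    "\<And>x y. x \<in> carrier E \<Longrightarrow> y \<in> carrier E \<Longrightarrow> nrm F (f x - f y) \<le> C * nrm E (x - y)"
  shows "f \<in> lip0 E F"
  using assms by (auto simp: lip0_def intro!: exI[of _ C])

lemma lip_norm_bdd:
  assumes E: "normed_space E" and f: "f \<in> lip0 E F"
  shows "bdd_above (insert 0 {nrm F (f x - f y) / nrm E (x - y) | x y.
      x \<in> carrier E \<and> y \<in> carrier E \<and> x \<noteq> y})"
proof -
  have gE: "gauged_space E" using E by (rule normed_imp_gauged)
  obtain C where C: "\<And>x y. x \<in> carrier E \<Longrightarrow> y \<in> carrier E \<Longrightarrow> nrm F (f x - f y) \<le> C * nrm E (x - y)"
    using f unfolding lip0_def by blast
  have "nrm F (f x - f y) / nrm E (x - y) \<le> \<bar>C\<bar>" if "x \<in> carrier E" "y \<in> carrier E" "x \<noteq> y" for x y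
  proof -
    have d: "x - y \<in> carrier E" using subspace_diff[OF gauged_space_subspace[OF gE] that(1,2)] .
    then have "nrm E (x - y) > 0"
      using gauged_space_nonneg[OF gE d] normed_space_definite[OF E d] that(3) by simp
    then have "nrm F (f x - f y) / nrm E (x - y) \<le> C"
      using C[OF that(1,2)] by (simp add: divide_simps)
    then show ?thesis by simp
  qed
  then show ?thesis by (intro bdd_aboveI[of _ "\<bar>C\<bar>"]) auto
qed

lemma lip_norm_bound:
  assumes E: "normed_space E" and F: "gauged_space F" and f: "f \<in> lip0 E F"
    and xy: "x \<in> carrier E" "y \<in> carrier E"
  shows "nrm F (f x - f y) \<le> lip_norm E F f * nrm E (x - y)"
proof (cases "x = y")
  case True
  then show ?thesis using F normed_imp_gauged[OF E] by simp
next
  case False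
  have gE: "gauged_space E" using E by (rule normed_imp_gauged)
  have d: "x - y \<in> carrier E" using subspace_diff[OF gauged_space_subspace[OF gE] xy] .
  then have "nrm E (x - y) > 0"
    using gauged_space_nonneg[OF gE d] normed_space_definite[OF E d] False by simp
  moreover have "nrm F (f x - f y) / nrm E (x - y) \<le> lip_norm E F f"
    unfolding lip_norm_def using xy False by (intro cSup_upper lip_norm_bdd[OF E f]) blast
  ultimately show ?thesis by (simp add: divide_simps)
qed

lemma lip_norm_nonneg:
  assumes "normed_space E" "f \<in> lip0 E F"
  shows "0 \<le> lip_norm E F f"
  unfolding lip_norm_def by (rule cSup_upper[OF insertI1 lip_norm_bdd[OF assms]])

lemma lip_norm_least:
  assumes E: "normed_space E" and "0 \<le> C"
    "\<And>x y. x \<in> carrier E \<Longrightarrow> y \<in> carrier E \<Longrightarrow> nrm F (f x - f y) \<le> C * nrm E (x - y)"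
  shows "lip_norm E F f \<le> C"
  unfolding lip_norm_def
proof (rule cSup_least)
  have gE: "gauged_space E" using E by (rule normed_imp_gauged)
  fix q assume "q \<in> insert 0 {nrm F (f x - f y) / nrm E (x - y) | x y.
      x \<in> carrier E \<and> y \<in> carrier E \<and> x \<noteq> y}"
  then consider "q = 0" | x y where "x \<in> carrier E" "y \<in> carrier E" "x \<noteq> y"
    "q = nrm F (f x - f y) / nrm E (x - y)" by blast
  then show "q \<le> C"
  proof cases
    case (2 x y)
    have d: "x - y \<in> carrier E" using subspace_diff[OF gauged_space_subspace[OF gE] 2(1,2)] .
    then have "nrm E (x - y) > 0"
      using gauged_space_nonneg[OF gE d] normed_space_definite[OF E d] 2(3) by simp
    then show ?thesis using assms(3)[OF 2(1,2)] unfolding 2(4) by (simp add: pos_divide_le_eq)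
  qed (use assms(2) in simp)
qed simp

lemma lip0_real_bound:
  assumes "normed_space E" "f \<in> carrier (lip0_space E)" "x \<in> carrier E" "y \<in> carrier E"
  shows "\<bar>f x - f y\<bar> \<le> nrm (lip0_space E) f * nrm E (x - y)"
  using lip_norm_bound[OF assms(1) gauged_real_space _ assms(3,4), of f] assms(2)
  by (simp add: lip0_space_simps)

lemma gauged_lip0_space:
  assumes E: "normed_space E"
  shows "gauged_space (lip0_space E)"
proof -
  let ?L = "lip0_space E"
  note simps = lip0_space_simps
  have gE: "gauged_space E" using E by (rule normed_imp_gauged)
  have scale: "\<bar>(c *\<^sub>R f) x - (c *\<^sub>R f) y\<bar> \<le> (\<bar>c\<bar> * nrm ?L f) * nrm E (x - y)"
    if "f \<in> carrier ?L" "x \<in> carrier E" "y \<in> carrier E" for c f x y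
    using mult_left_mono[OF lip0_real_bound[OF E that], of "\<bar>c\<bar>"]
    by (simp add: abs_mult[symmetric] right_diff_distrib)
  have nn: "0 \<le> nrm ?L f" if "f \<in> carrier ?L" for f
    using lip_norm_nonneg[OF E, of f real_space] that by (simp add: simps)
  have scale_le: "nrm ?L (c *\<^sub>R f) \<le> \<bar>c\<bar> * nrm ?L f" if f: "f \<in> carrier ?L" for c f
    unfolding simps
    by (rule lip_norm_least[OF E]) (use nn[OF f] scale[OF f] in \<open>simp_all add: simps\<close>)
  have sub: "subspace (carrier ?L)"
    unfolding subspace_def
  proof (intro conjI ballI allI)
    show "0 \<in> carrier ?L" unfolding simps by (rule lip0I[where C = 0]) auto
    show "f + g \<in> carrier ?L" if fg: "f \<in> carrier ?L" "g \<in> carrier ?L" for f g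
      unfolding simps
    proof (rule lip0I[where C = "nrm ?L f + nrm ?L g"])
      fix x y assume "x \<in> carrier E" "y \<in> carrier E"
      from lip0_real_bound[OF E fg(1) this] lip0_real_bound[OF E fg(2) this]
      show "nrm real_space ((f + g) x - (f + g) y) \<le> (nrm ?L f + nrm ?L g) * nrm E (x - y)"
        by (simp add: algebra_simps)
    qed (use lip0D[of f E real_space] lip0D[of g E real_space] fg in \<open>auto simp: simps\<close>)
    show "c *\<^sub>R f \<in> carrier ?L" if f: "f \<in> carrier ?L" for c f
      unfolding simps
      by (rule lip0I[where C = "\<bar>c\<bar> * nrm ?L f"])
        (use lip0D[of f E real_space] f scale[OF f] in \<open>auto simp: simps\<close>)
  qed
  have "nrm ?L (c *\<^sub>R f) = \<bar>c\<bar> * nrm ?L f" if f: "f \<in> carrier ?L" for c f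
  proof (cases "c = 0")
    case True
    have "nrm ?L 0 \<le> 0" unfolding simps by (rule lip_norm_least[OF E]) auto
    then show ?thesis using True nn[OF subspace_0[OF sub]] by simp
  next
    case False
    have "nrm ?L ((1/c) *\<^sub>R (c *\<^sub>R f)) \<le> \<bar>1/c\<bar> * nrm ?L (c *\<^sub>R f)"
      using scale_le[OF subspace_scale[OF sub f]] .
    then have "\<bar>c\<bar> * nrm ?L f \<le> nrm ?L (c *\<^sub>R f)"
      using False by (simp add: field_simps)
    then show ?thesis using scale_le[OF f, of c] by simp
  qed
  then show ?thesis unfolding gauged_space_def using sub nn by blast
qed

lemma dual_comp_lip0:
  assumes E: "normed_space E" and F: "gauged_space F" and f: "f \<in> lip0 E F"
    and g: "g \<in> carrier (dual_space F)"
  shows "g \<circ> f \<in> carrier (lip0_space E)"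
    and "nrm (lip0_space E) (g \<circ> f) \<le> lip_norm E F f * nrm (dual_space F) g"
proof -
  have b: "\<bar>g (f x) - g (f y)\<bar> \<le> (lip_norm E F f * nrm (dual_space F) g) * nrm E (x - y)"
    if xy: "x \<in> carrier E" "y \<in> carrier E" for x y
  proof -
    note fxy = lip0D(1)[OF f xy(1)] lip0D(1)[OF f xy(2)]
    have "\<bar>g (f x) - g (f y)\<bar> = \<bar>g (f x - f y)\<bar>"
      using lin_maps_diff[OF gauged_space_subspace[OF F] dual_lin[OF g] fxy] by simp
    also have "\<dots> \<le> nrm (dual_space F) g * nrm F (f x - f y)"
      using dual_norm_bound[OF F g subspace_diff[OF gauged_space_subspace[OF F] fxy]] .
    also have "\<dots> \<le> nrm (dual_space F) g * (lip_norm E F f * nrm E (x - y))"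
      using lip_norm_bound[OF E F f xy] gauged_space_nonneg[OF gauged_dual_space[OF F] g]
      by (rule mult_left_mono)
    finally show ?thesis by (simp add: mult.commute mult.left_commute)
  qed
  have g0: "g 0 = 0" using lin_maps_zero[OF gauged_space_subspace[OF F] dual_lin[OF g]] .
  show "g \<circ> f \<in> carrier (lip0_space E)"
    unfolding lip0_space_simps
    by (rule lip0I[where C = "lip_norm E F f * nrm (dual_space F) g"])
      (use b g0 lip0D[OF f] in auto)
  show "nrm (lip0_space E) (g \<circ> f) \<le> lip_norm E F f * nrm (dual_space F) g"
    unfolding lip0_space_simps
    by (rule lip_norm_least[OF E])
      (use b lip_norm_nonneg[OF E f] gauged_space_nonneg[OF gauged_dual_space[OF F] g] in auto)
qed

section \<open>Lipschitz-free spaces\<close>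

lemma delta_apply: "f \<in> carrier (lip0_space E) \<Longrightarrow> delta E x f = f x"
  by (simp add: delta_def)

lemma delta_dual:
  assumes E: "normed_space E" and x: "x \<in> carrier E"
  shows "delta E x \<in> carrier (dual_space (lip0_space E))"
proof (rule in_dualI[where C = "nrm E x"])
  have gE: "gauged_space E" using E by (rule normed_imp_gauged)
  have "subspace (carrier (lip0_space E))" using gauged_lip0_space[OF E] by simp
  then show "delta E x \<in> lin_maps (lip0_space E)"
    unfolding lin_maps_def delta_def by (simp add: subspace_add subspace_scale)
  fix f assume f: "f \<in> carrier (lip0_space E)"
  have "\<bar>f x - f 0\<bar> \<le> nrm (lip0_space E) f * nrm E (x - 0)"
    using lip0_real_bound[OF E f x gauged_space_zero[OF gE]] .
  moreover have "f 0 = 0" using lip0D(2)[of f E real_space] f by (simp add: lip0_space_simps)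
  ultimately show "\<bar>delta E x f\<bar> \<le> nrm E x * nrm (lip0_space E) f"
    using f by (simp add: delta_def mult.commute)
qed

lemma span_delta_dual:
  assumes "normed_space E"
  shows "span (delta E ` carrier E) \<subseteq> carrier (dual_space (lip0_space E))"
  using delta_dual[OF assms] gauged_dual_space[OF gauged_lip0_space[OF assms]]
  by (intro span_minimal) auto

lemma free_space_simps:
  "carrier (free_space E) = norm_closure (dual_space (lip0_space E)) (span (delta E ` carrier E))"
  "nrm (free_space E) = nrm (dual_space (lip0_space E))"
  by (simp_all add: free_space_def)

lemma normed_free_space:
  assumes "normed_space E"
  shows "normed_space (free_space E)"
  unfolding free_space_def
proof (rule normed_space_restrict)
  show n: "normed_space (dual_space (lip0_space E))"
    using normed_dual_space[OF gauged_lip0_space[OF assms]] .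
  show "subspace (norm_closure (dual_space (lip0_space E)) (span (delta E ` carrier E)))"
    using subspace_norm_closure[OF n subspace_span span_delta_dual[OF assms]] .
qed (auto simp: norm_closure_def)

lemma free_space_dual: "\<mu> \<in> carrier (free_space E) \<Longrightarrow> \<mu> \<in> carrier (dual_space (lip0_space E))"
  by (auto simp: free_space_simps norm_closure_def)

lemma span_delta_free:
  assumes "normed_space E"
  shows "span (delta E ` carrier E) \<subseteq> carrier (free_space E)"
  unfolding free_space_simps
  using norm_closure_superset[OF gauged_dual_space[OF gauged_lip0_space[OF assms]] span_delta_dual[OF assms]] .

lemma delta_free:
  assumes "normed_space E" "x \<in> carrier E"
  shows "delta E x \<in> carrier (free_space E)"
  using span_delta_free[OF assms(1)] assms(2) span_base by blast

lemma free_space_closure: "\<mu> \<in> carrier (free_space E) \<Longrightarrow> \<mu> \<in> norm_closure (free_space E) (span (delta E ` carrier E))"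
  by (auto simp: free_space_simps norm_closure_def)

lemma free_space_apply_bound:
  assumes "normed_space E" "\<mu> \<in> carrier (free_space E)" "f \<in> carrier (lip0_space E)"
  shows "\<bar>\<mu> f\<bar> \<le> nrm (free_space E) \<mu> * nrm (lip0_space E) f"
  using dual_norm_bound[OF gauged_lip0_space[OF assms(1)] free_space_dual[OF assms(2)] assms(3)]
  by (simp add: free_space_simps)

lemma dual_separates:
  assumes E: "normed_space E" and xy: "x \<in> carrier E" "y \<in> carrier E"
    and eq: "\<And>g. g \<in> carrier (dual_space E) \<Longrightarrow> g x = g y"
  shows "x = y"
proof -
  note sE = gauged_space_subspace[OF normed_imp_gauged[OF E]]
  have d: "x - y \<in> carrier E" using subspace_diff[OF sE xy] .
  obtain g where g: "g \<in> carrier (dual_space E)" "g (x - y) = nrm E (x - y)"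
    by (rule norming_functional[OF E d])
  then have "nrm E (x - y) = 0" using lin_maps_diff[OF sE dual_lin[OF g(1)] xy] eq[OF g(1)] by simp
  then show ?thesis using normed_space_definite[OF E d] by simp
qed

lemma norm_le_by_duality:
  assumes E: "normed_space E" and x: "x \<in> carrier E" and C: "0 \<le> C"
    and le: "\<And>g. g \<in> carrier (dual_space E) \<Longrightarrow> \<bar>g x\<bar> \<le> C * nrm (dual_space E) g"
  shows "nrm E x \<le> C"
proof -
  obtain g where g: "g \<in> carrier (dual_space E)" "g x = nrm E x" "nrm (dual_space E) g \<le> 1"
    by (rule norming_functional[OF E x])
  have "nrm E x \<le> C * nrm (dual_space E) g" using le[OF g(1)] g(2) by simp
  also have "\<dots> \<le> C" using g(3) C by (simp add: mult_left_le)
  finally show ?thesis .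
qed

text \<open>
  The elements \<open>\<mu>\<close> of the free space for which a point \<open>x\<close> with \<open>g(x) = \<mu>(g \<circ> f)\<close> for all \<open>g\<close> exists contain the
  evaluations, where \<open>x\<close> is a value of \<open>f\<close>, and form a subspace. By Hahn-Banach \<open>x\<close> is unique and its norm
  is at most \<open>\<parallel>f\<parallel> \<parallel>\<mu>\<parallel>\<close>, so a convergent sequence of such \<open>\<mu>\<close> yields a Cauchy sequence of points, and
  completeness of \<open>F\<close> shows that the subspace is closed. Uniqueness also gives linearity in \<open>\<mu>\<close>.
\<close>

lemma linearization_by_duality:
  assumes E: "normed_space E" and F: "banach_space F" and f: "f \<in> lip0 E F"
  obtains L where "L \<in> bd_ops (free_space E) F" "\<And>x. x \<in> carrier E \<Longrightarrow> L (delta E x) = f x"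
    "\<And>\<mu> g. \<mu> \<in> carrier (free_space E) \<Longrightarrow> g \<in> carrier (dual_space F) \<Longrightarrow> g (L \<mu>) = \<mu> (g \<circ> f)"
    "\<And>\<mu>. \<mu> \<in> carrier (free_space E) \<Longrightarrow> nrm F (L \<mu>) \<le> lip_norm E F f * nrm (free_space E) \<mu>"
proof -
  let ?X = "free_space E" and ?r = "lip_norm E F f"
  have nF: "normed_space F" using F by (rule banach_imp_normed)
  have gF: "gauged_space F" using F by (rule banach_imp_gauged)
  have nX: "normed_space ?X" using E by (rule normed_free_space)
  have gX: "gauged_space ?X" using nX by (rule normed_imp_gauged)
  note sF = gauged_space_subspace[OF gF] and sX = gauged_space_subspace[OF gX]
  have r: "0 \<le> ?r" using lip_norm_nonneg[OF E f] .
  \<comment> \<open>\<open>P \<mu> x\<close> is the graph of the operator to be constructed.\<close>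
  define P where "P \<mu> x \<longleftrightarrow> x \<in> carrier F \<and> (\<forall>g\<in>carrier (dual_space F). g x = \<mu> (g \<circ> f))" for \<mu> x
  have P_add: "P (\<mu> + \<nu>) (x + y)" if "P \<mu> x" "P \<nu> y" for \<mu> \<nu> x y
    using that subspace_add[OF sF] lin_maps_add[OF dual_lin, of _ F] by (simp add: P_def)
  have P_scale: "P (c *\<^sub>R \<mu>) (c *\<^sub>R x)" if "P \<mu> x" for c \<mu> x
    using that subspace_scale[OF sF] lin_maps_scale[OF dual_lin, of _ F] by (simp add: P_def)
  have P_diff: "P (\<mu> - \<nu>) (x - y)" if "P \<mu> x" "P \<nu> y" for \<mu> \<nu> x y
    using P_add[OF that(1) P_scale[OF that(2), of "-1"]] by simp
  have P_delta: "P (delta E x) (f x)" if "x \<in> carrier E" for x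
    using that lip0D(1)[OF f] delta_apply[OF dual_comp_lip0(1)[OF E gF f]] by (simp add: P_def)
  have P_zero: "P 0 0"
    unfolding P_def using lin_maps_zero[OF sF dual_lin] gF by simp
  have P_unique: "x = y" if "P \<mu> x" "P \<mu> y" for \<mu> x y
    using that by (intro dual_separates[OF nF]) (auto simp: P_def)
  have P_bound: "nrm F x \<le> ?r * nrm ?X \<mu>" if Px: "P \<mu> x" and \<mu>: "\<mu> \<in> carrier ?X" for \<mu> x
  proof (rule norm_le_by_duality[OF nF])
    show "x \<in> carrier F" using Px by (simp add: P_def)
    show "0 \<le> ?r * nrm ?X \<mu>" using r gauged_space_nonneg[OF gX \<mu>] by simp
    fix g assume g: "g \<in> carrier (dual_space F)"
    have "\<bar>g x\<bar> \<le> nrm ?X \<mu> * nrm (lip0_space E) (g \<circ> f)"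
      using Px free_space_apply_bound[OF E \<mu> dual_comp_lip0(1)[OF E gF f g]] g by (simp add: P_def)
    also have "\<dots> \<le> nrm ?X \<mu> * (?r * nrm (dual_space F) g)"
      using dual_comp_lip0(2)[OF E gF f g] gauged_space_nonneg[OF gX \<mu>] by (rule mult_left_mono)
    finally show "\<bar>g x\<bar> \<le> ?r * nrm ?X \<mu> * nrm (dual_space F) g"
      by (simp add: mult.commute mult.left_commute)
  qed
  have P_span: "\<exists>x. P \<mu> x" if "\<mu> \<in> span (delta E ` carrier E)" for \<mu>
    using that
  proof (induction rule: span_induct_alt)
    case base
    then show ?case using P_zero by blast
  next
    case (step c d \<nu>)
    then show ?case using P_add P_scale P_delta by blast
  qed
  have P_ex: "\<exists>x. P \<mu> x" if \<mu>: "\<mu> \<in> carrier ?X" for \<mu>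
  proof -
    have "\<exists>\<nu>. \<nu> \<in> span (delta E ` carrier E) \<and> nrm ?X (\<mu> - \<nu>) < inverse (real (Suc n))" for n
      by (rule norm_closure_approx[OF free_space_closure[OF \<mu>], of "inverse (real (Suc n))"]) auto
    then obtain \<nu> where \<nu>: "\<And>n. \<nu> n \<in> span (delta E ` carrier E)"
      and close: "\<And>n. nrm ?X (\<mu> - \<nu> n) < inverse (real (Suc n))" by metis
    have \<nu>X: "\<nu> n \<in> carrier ?X" for n using \<nu> span_delta_free[OF E] by blast
    obtain x where x: "\<And>n. P (\<nu> n) (x n)" using P_span[OF \<nu>] by metis
    have xF: "x n \<in> carrier F" for n using x by (simp add: P_def)
    have small: "(\<lambda>n. nrm ?X (\<mu> - \<nu> n)) \<longlonglongrightarrow> 0"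
    proof (rule tendsto_sandwich[OF _ _ tendsto_const LIMSEQ_inverse_real_of_nat])
      show "\<forall>\<^sub>F n in sequentially. 0 \<le> nrm ?X (\<mu> - \<nu> n)"
        using gauged_space_nonneg[OF gX subspace_diff[OF sX \<mu> \<nu>X]] by simp
      show "\<forall>\<^sub>F n in sequentially. nrm ?X (\<mu> - \<nu> n) \<le> inverse (real (Suc n))"
        using close by (simp add: less_imp_le)
    qed
    have "\<forall>\<epsilon>>0. \<exists>N. \<forall>m\<ge>N. \<forall>n\<ge>N. nrm F (x m - x n) < \<epsilon>"
    proof (intro allI impI)
      fix \<epsilon> :: real assume "\<epsilon> > 0"
      \<comment> \<open>\<open>?r\<close> may be zero, hence the denominator \<open>?r + 1\<close>.\<close>
      define \<eta> where "\<eta> = \<epsilon> / (2 * (?r + 1))"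
      have \<eta>: "\<eta> > 0" "?r * (2 * \<eta>) < \<epsilon>" using \<open>\<epsilon> > 0\<close> r by (auto simp: \<eta>_def field_simps)
      obtain N where N: "\<And>n. n \<ge> N \<Longrightarrow> nrm ?X (\<mu> - \<nu> n) < \<eta>"
        using order_tendstoD(2)[OF small \<eta>(1)] by (auto simp: eventually_sequentially)
      have "nrm F (x m - x n) < \<epsilon>" if "m \<ge> N" "n \<ge> N" for m n
      proof -
        have "nrm F (x m - x n) \<le> ?r * nrm ?X (\<nu> m - \<nu> n)"
          using P_bound[OF P_diff[OF x x] subspace_diff[OF sX \<nu>X \<nu>X]] .
        also have "nrm ?X (\<nu> m - \<nu> n) \<le> nrm ?X (\<nu> m - \<mu>) + nrm ?X (\<mu> - \<nu> n)"
          using normed_space_triangle_diff[OF nX \<nu>X \<mu> \<nu>X] .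
        also have "\<dots> \<le> 2 * \<eta>"
          using N[OF that(1)] N[OF that(2)] normed_space_dist_commute[OF nX \<nu>X \<mu>, of m] by simp
        finally show ?thesis using \<eta>(2) r by (simp add: mult_left_mono)
      qed
      then show "\<exists>N. \<forall>m\<ge>N. \<forall>n\<ge>N. nrm F (x m - x n) < \<epsilon>" by blast
    qed
    then obtain y where y: "y \<in> carrier F" and lim: "(\<lambda>n. nrm F (x n - y)) \<longlonglongrightarrow> 0"
      using F xF unfolding banach_space_def by blast
    have "g y = \<mu> (g \<circ> f)" if g: "g \<in> carrier (dual_space F)" for g
    proof -
      have 1: "(\<lambda>n. g (x n)) \<longlonglongrightarrow> g y"
      proof (rule LIM_zero_cancel, rule Lim_null_comparison)
        show "\<forall>\<^sub>F n in sequentially. norm (g (x n) - g y) \<le> nrm (dual_space F) g * nrm F (x n - y)"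
          using dual_norm_bound[OF gF g subspace_diff[OF sF xF y]] lin_maps_diff[OF sF dual_lin[OF g] xF y]
          by simp
        show "(\<lambda>n. nrm (dual_space F) g * nrm F (x n - y)) \<longlonglongrightarrow> 0"
          using tendsto_mult_left[OF lim, of "nrm (dual_space F) g"] by simp
      qed
      note gf = dual_comp_lip0(1)[OF E gF f g]
      have 2: "(\<lambda>n. \<nu> n (g \<circ> f)) \<longlonglongrightarrow> \<mu> (g \<circ> f)"
      proof (rule LIM_zero_cancel, rule Lim_null_comparison)
        show "\<forall>\<^sub>F n in sequentially. norm (\<nu> n (g \<circ> f) - \<mu> (g \<circ> f)) \<le> nrm ?X (\<mu> - \<nu> n) * nrm (lip0_space E) (g \<circ> f)"
          using free_space_apply_bound[OF E subspace_diff[OF sX \<mu> \<nu>X] gf] by (simp add: abs_minus_commute)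
        show "(\<lambda>n. nrm ?X (\<mu> - \<nu> n) * nrm (lip0_space E) (g \<circ> f)) \<longlonglongrightarrow> 0"
          using tendsto_mult_right[OF small, of "nrm (lip0_space E) (g \<circ> f)"] by simp
      qed
      have "g (x n) = \<nu> n (g \<circ> f)" for n using x g by (simp add: P_def)
      then show ?thesis using LIMSEQ_unique[OF 1] 2 by simp
    qed
    then show ?thesis using y unfolding P_def by blast
  qed
  define L where "L \<mu> = (if \<mu> \<in> carrier ?X then (SOME x. P \<mu> x) else 0)" for \<mu>
  have L: "P \<mu> (L \<mu>)" if "\<mu> \<in> carrier ?X" for \<mu>
    using someI_ex[OF P_ex[OF that]] that by (simp add: L_def)
  show thesis
  proof (rule that[of L])
    show "L \<in> bd_ops ?X F"
    proof (rule bd_opsI[where C = ?r])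
      show "L \<in> lin_maps ?X"
        unfolding lin_maps_def
      proof safe
        fix \<mu> \<nu> assume m: "\<mu> \<in> carrier ?X" "\<nu> \<in> carrier ?X"
        show "L (\<mu> + \<nu>) = L \<mu> + L \<nu>"
          using P_unique[OF L[OF subspace_add[OF sX m]] P_add[OF L[OF m(1)] L[OF m(2)]]] .
      next
        fix c \<mu> assume m: "\<mu> \<in> carrier ?X"
        show "L (c *\<^sub>R \<mu>) = c *\<^sub>R L \<mu>"
          using P_unique[OF L[OF subspace_scale[OF sX m]] P_scale[OF L[OF m]]] .
      qed (simp add: L_def)
      show "L \<mu> \<in> carrier F" if "\<mu> \<in> carrier ?X" for \<mu> using L[OF that] by (simp add: P_def)
      show "nrm F (L \<mu>) \<le> ?r * nrm ?X \<mu>" if "\<mu> \<in> carrier ?X" for \<mu> using P_bound[OF L[OF that] that] .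
    qed
    show "L (delta E x) = f x" if "x \<in> carrier E" for x
      using P_unique[OF L[OF delta_free[OF E that]] P_delta[OF that]] .
    show "g (L \<mu>) = \<mu> (g \<circ> f)" if "\<mu> \<in> carrier ?X" "g \<in> carrier (dual_space F)" for \<mu> g
      using L[OF that(1)] that(2) by (simp add: P_def)
    show "nrm F (L \<mu>) \<le> ?r * nrm ?X \<mu>" if "\<mu> \<in> carrier ?X" for \<mu> using P_bound[OF L[OF that] that] .
  qed
qed

text \<open>
  The evaluations span a dense subspace. Testing with functionals turns this into the density
  argument for scalar functions, applied to a constant net.
\<close>

lemma bd_ops_free_space_unique:
  assumes E: "normed_space E" and F: "normed_space F"
    and L: "L \<in> bd_ops (free_space E) F" "L' \<in> bd_ops (free_space E) F"
    and eq: "\<And>x. x \<in> carrier E \<Longrightarrow> L (delta E x) = L' (delta E x)"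
  shows "L = L'"
proof
  fix \<mu>
  let ?X = "free_space E"
  have gX: "gauged_space ?X" using normed_imp_gauged[OF normed_free_space[OF E]] .
  have gF: "gauged_space F" using F by (rule normed_imp_gauged)
  show "L \<mu> = L' \<mu>"
  proof (cases "\<mu> \<in> carrier ?X")
    case True
    show ?thesis
    proof (rule dual_separates[OF F bd_ops_range[OF L(1) True] bd_ops_range[OF L(2) True]])
      fix g assume g: "g \<in> carrier (dual_space F)"
      have comp: "g \<circ> K \<in> carrier (dual_space ?X)" if "K \<in> bd_ops ?X F" for K
        using bd_ops_comp[OF gX gF gauged_real_space that] g by (simp add: carrier_dual)
      have "((\<lambda>i::nat. (g \<circ> L) \<mu>) \<longlonglongrightarrow> (g \<circ> L') \<mu>)"
      proof (rule tendsto_on_closed_span[OF gX _ _ comp[OF L(2)] _ free_space_closure[OF True]])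
        show "\<forall>\<^sub>F i::nat in sequentially. g \<circ> L \<in> carrier (dual_space ?X) \<and>
            nrm (dual_space ?X) (g \<circ> L) \<le> nrm (dual_space ?X) (g \<circ> L)"
          using comp[OF L(1)] by (intro always_eventually allI conjI order_refl)
      qed (use delta_free[OF E] eq in auto)
      then show "g (L \<mu>) = g (L' \<mu>)" by (simp add: LIMSEQ_const_iff)
    qed
  next
    case False
    then show ?thesis using lin_maps_off[OF bd_ops_lin[OF L(1)]] lin_maps_off[OF bd_ops_lin[OF L(2)]] by simp
  qed
qed

lemma linearization_props:
  assumes E: "normed_space E" and F: "banach_space F" and f: "f \<in> lip0 E F"
  shows "linearization E F f \<in> bd_ops (free_space E) F"
    and "\<And>x. x \<in> carrier E \<Longrightarrow> linearization E F f (delta E x) = f x"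
    and "\<And>\<mu>. \<mu> \<in> carrier (free_space E) \<Longrightarrow>
      nrm F (linearization E F f \<mu>) \<le> lip_norm E F f * nrm (free_space E) \<mu>"
proof -
  obtain L where L: "L \<in> bd_ops (free_space E) F" "\<And>x. x \<in> carrier E \<Longrightarrow> L (delta E x) = f x"
    "\<And>\<mu>. \<mu> \<in> carrier (free_space E) \<Longrightarrow> nrm F (L \<mu>) \<le> lip_norm E F f * nrm (free_space E) \<mu>"
    by (rule linearization_by_duality[OF E F f]) blast
  have "linearization E F f = L"
    unfolding linearization_def
  proof (rule the_equality)
    fix K assume "K \<in> bd_ops (free_space E) F \<and> (\<forall>x\<in>carrier E. K (delta E x) = f x)"
    then show "K = L" using L by (intro bd_ops_free_space_unique[OF E banach_imp_normed[OF F]]) auto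
  qed (use L in blast)
  then show "linearization E F f \<in> bd_ops (free_space E) F"
    and "\<And>x. x \<in> carrier E \<Longrightarrow> linearization E F f (delta E x) = f x"
    and "\<And>\<mu>. \<mu> \<in> carrier (free_space E) \<Longrightarrow>
      nrm F (linearization E F f \<mu>) \<le> lip_norm E F f * nrm (free_space E) \<mu>"
    using L by auto
qed

text \<open>
  The map \<open>\<beta>\<close> is the linearization of the identity, which has to be cut off outside the carrier to be a
  map on the space; functionals vanish there, so composing them with it changes nothing.
\<close>

lemma beta_props:
  assumes E: "banach_space E"
  shows "beta E \<in> bd_ops (free_space E) E"
    and "\<And>\<mu> g. \<mu> \<in> carrier (free_space E) \<Longrightarrow> g \<in> carrier (dual_space E) \<Longrightarrow> g (beta E \<mu>) = \<mu> g"
    and "\<And>x. x \<in> carrier E \<Longrightarrow> beta E (delta E x) = x"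
proof -
  have nE: "normed_space E" using E by (rule banach_imp_normed)
  have gE: "gauged_space E" using E by (rule banach_imp_gauged)
  define j where "j x = (if x \<in> carrier E then x else 0)" for x
  have j: "j \<in> lip0 E E" by (rule lip0I[where C = 1]) (auto simp: j_def gE)
  have gj: "g \<circ> j = g" if "g \<in> carrier (dual_space E)" for g
    using lin_maps_off[OF dual_lin[OF that]] lin_maps_zero[OF gauged_space_subspace[OF gE] dual_lin[OF that]]
    by (auto simp: j_def)
  obtain L where L: "L \<in> bd_ops (free_space E) E"
    "\<And>\<mu> g. \<mu> \<in> carrier (free_space E) \<Longrightarrow> g \<in> carrier (dual_space E) \<Longrightarrow> g (L \<mu>) = \<mu> (g \<circ> j)"
    "\<And>x. x \<in> carrier E \<Longrightarrow> L (delta E x) = j x"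
    by (rule linearization_by_duality[OF nE E j]) blast
  have "beta E = L"
    unfolding beta_def
  proof (rule the_equality)
    show "L \<in> bd_ops (free_space E) E \<and>
        (\<forall>g\<in>carrier (dual_space E). \<forall>\<mu>\<in>carrier (free_space E). g (L \<mu>) = \<mu> g)"
      using L gj by simp
    fix b assume b: "b \<in> bd_ops (free_space E) E \<and>
        (\<forall>g\<in>carrier (dual_space E). \<forall>\<mu>\<in>carrier (free_space E). g (b \<mu>) = \<mu> g)"
    then have bb: "b \<in> bd_ops (free_space E) E" by blast
    show "b = L"
    proof
      fix \<mu>
      show "b \<mu> = L \<mu>"
      proof (cases "\<mu> \<in> carrier (free_space E)")
        case True
        show ?thesis
        proof (rule dual_separates[OF nE bd_ops_range[OF bb True] bd_ops_range[OF L(1) True]])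
          fix g assume g: "g \<in> carrier (dual_space E)"
          then have "g (b \<mu>) = \<mu> g" using b True by blast
          then show "g (b \<mu>) = g (L \<mu>)" using L(2)[OF True g] gj[OF g] by simp
        qed
      next
        case False
        then show ?thesis using lin_maps_off[OF bd_ops_lin[OF bb]] lin_maps_off[OF bd_ops_lin[OF L(1)]] by simp
      qed
    qed
  qed
  then show "beta E \<in> bd_ops (free_space E) E"
    and "\<And>\<mu> g. \<mu> \<in> carrier (free_space E) \<Longrightarrow> g \<in> carrier (dual_space E) \<Longrightarrow> g (beta E \<mu>) = \<mu> g"
    and "\<And>x. x \<in> carrier E \<Longrightarrow> beta E (delta E x) = x"
    using L gj by (auto simp: j_def)
qed

text \<open>
  The inclusion is the adjoint of the restriction of Lipschitz functions from \<open>E\<close> to \<open>D\<close>. The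
  restriction does not increase the Lipschitz norm, and its adjoint maps evaluations to evaluations,
  hence the closed span of the former into that of the latter.
\<close>

lemma free_space_inclusion:
  assumes D: "normed_space D" and E: "normed_space E" and sub: "carrier D \<subseteq> carrier E"
    and nrm: "\<And>x. x \<in> carrier D \<Longrightarrow> nrm D x = nrm E x"
  obtains \<iota> where "\<iota> \<in> bd_ops (free_space D) (free_space E)"
    "\<And>x. x \<in> carrier D \<Longrightarrow> \<iota> (delta D x) = delta E x"
    "\<And>\<mu>. \<mu> \<in> carrier (free_space D) \<Longrightarrow> nrm (free_space E) (\<iota> \<mu>) \<le> nrm (free_space D) \<mu>"
proof -
  let ?LD = "lip0_space D" and ?LE = "lip0_space E"
  have gLD: "gauged_space ?LD" and gLE: "gauged_space ?LE"
    using gauged_lip0_space D E by auto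
  have gFD: "gauged_space (free_space D)" using normed_imp_gauged[OF normed_free_space[OF D]] .
  note sD = gauged_space_subspace[OF normed_imp_gauged[OF D]]
  define \<rho> where "\<rho> g = (if g \<in> carrier ?LE then (\<lambda>x. if x \<in> carrier D then g x else 0) else 0)"
    for g :: "'a \<Rightarrow> real"
  have \<rho>_lip: "\<bar>\<rho> g x - \<rho> g y\<bar> \<le> nrm ?LE g * nrm D (x - y)"
    if "g \<in> carrier ?LE" "x \<in> carrier D" "y \<in> carrier D" for g x y
    using lip0_real_bound[OF E that(1), of x y] that sub nrm[OF subspace_diff[OF sD that(2,3)]]
    by (auto simp: \<rho>_def)
  have \<rho>_nrm: "nrm ?LD (\<rho> g) \<le> 1 * nrm ?LE g" if "g \<in> carrier ?LE" for g
    unfolding lip0_space_simps(2)[of D]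
    by (rule lip_norm_least[OF D]) (use \<rho>_lip[OF that] gauged_space_nonneg[OF gLE that] in auto)
  have \<rho>_bd: "\<rho> \<in> bd_ops ?LE ?LD"
  proof (rule bd_opsI[OF _ _ \<rho>_nrm])
    show "\<rho> \<in> lin_maps ?LE"
      unfolding lin_maps_def
      using subspace_add[OF gauged_space_subspace[OF gLE]] subspace_scale[OF gauged_space_subspace[OF gLE]]
      by (auto simp: \<rho>_def)
    fix g assume g: "g \<in> carrier ?LE"
    show "\<rho> g \<in> carrier ?LD"
      unfolding lip0_space_simps(1)[of D]
      by (rule lip0I[where C = "nrm ?LE g"])
        (use \<rho>_lip[OF g] lip0D(2)[of g E real_space] g in \<open>auto simp: \<rho>_def lip0_space_simps(1)[of E]\<close>)
  qed
  define \<iota> where "\<iota> \<mu> = (if \<mu> \<in> carrier (free_space D) then dual_op ?LE ?LD \<rho> \<mu> else 0)" for \<mu>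
  note dl = dual_op_bd[OF gLE gLD \<rho>_bd]
  have bound: "nrm (dual_space ?LE) (dual_op ?LE ?LD \<rho> \<mu>) \<le> nrm (dual_space ?LD) \<mu>"
    if "\<mu> \<in> carrier (dual_space ?LD)" for \<mu>
    using dual_op_norm[OF gLE gLD \<rho>_bd _ \<rho>_nrm that] by simp
  have delta: "dual_op ?LE ?LD \<rho> (delta D x) = delta E x" if x: "x \<in> carrier D" for x
  proof
    fix g
    have "dual_op ?LE ?LD \<rho> (delta D x) g = delta D x (\<rho> g)"
      using dual_op_apply[OF delta_dual[OF D x]] .
    also have "\<dots> = delta E x g"
    proof (cases "g \<in> carrier ?LE")
      case True
      then show ?thesis
        using bd_ops_range[OF \<rho>_bd True] x by (simp add: delta_apply) (simp add: \<rho>_def)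
    next
      case False
      then have "\<rho> g = 0" by (simp add: \<rho>_def)
      then show ?thesis using False by (simp add: delta_def)
    qed
    finally show "dual_op ?LE ?LD \<rho> (delta D x) g = delta E x g" .
  qed
  have "subspace {\<mu> \<in> carrier (dual_space ?LD). dual_op ?LE ?LD \<rho> \<mu> \<in> span (delta E ` carrier E)}"
    using gauged_space_subspace[OF gauged_dual_space[OF gLD]]
      lin_maps_zero[OF gauged_space_subspace[OF gauged_dual_space[OF gLD]] bd_ops_lin[OF dl]]
    unfolding subspace_def
    by (simp add: lin_maps_add[OF bd_ops_lin[OF dl]] lin_maps_scale[OF bd_ops_lin[OF dl]] span_add span_scale span_zero)
  then have span: "span (delta D ` carrier D) \<subseteq> {\<mu> \<in> carrier (dual_space ?LD). dual_op ?LE ?LD \<rho> \<mu> \<in> span (delta E ` carrier E)}"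
    using delta_dual[OF D] delta sub by (intro span_minimal) (auto intro!: span_base)
  have range: "dual_op ?LE ?LD \<rho> \<mu> \<in> carrier (free_space E)" if \<mu>: "\<mu> \<in> carrier (free_space D)" for \<mu>
    unfolding free_space_simps(1)
  proof (rule norm_closureI)
    note \<mu>' = free_space_dual[OF \<mu>]
    show "dual_op ?LE ?LD \<rho> \<mu> \<in> carrier (dual_space ?LE)" using bd_ops_range[OF dl \<mu>'] .
    fix \<epsilon> :: real assume "\<epsilon> > 0"
    then obtain \<nu> where \<nu>: "\<nu> \<in> span (delta D ` carrier D)" "nrm (dual_space ?LD) (\<mu> - \<nu>) < \<epsilon>"
      using norm_closure_approx[OF \<mu>[unfolded free_space_simps(1)]] by blast
    have \<nu>': "\<nu> \<in> carrier (dual_space ?LD)" using span \<nu>(1) by blast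
    note sDual = gauged_space_subspace[OF gauged_dual_space[OF gLD]]
    have "nrm (dual_space ?LE) (dual_op ?LE ?LD \<rho> \<mu> - dual_op ?LE ?LD \<rho> \<nu>) < \<epsilon>"
      using bound[OF subspace_diff[OF sDual \<mu>' \<nu>']] \<nu>(2) lin_maps_diff[OF sDual bd_ops_lin[OF dl] \<mu>' \<nu>'] by simp
    then show "\<exists>\<nu>\<in>span (delta E ` carrier E). nrm (dual_space ?LE) (dual_op ?LE ?LD \<rho> \<mu> - \<nu>) < \<epsilon>"
      using span \<nu>(1) by blast
  qed
  have \<iota>_bound: "nrm (free_space E) (\<iota> \<mu>) \<le> nrm (free_space D) \<mu>" if "\<mu> \<in> carrier (free_space D)" for \<mu>
    using bound[OF free_space_dual[OF that]] that by (simp add: \<iota>_def free_space_simps(2))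
  show thesis
  proof (rule that[of \<iota>])
    show "\<iota> \<in> bd_ops (free_space D) (free_space E)"
    proof (rule bd_opsI[where C = 1])
      show "\<iota> \<in> lin_maps (free_space D)"
        unfolding lin_maps_def
        using subspace_add[OF gauged_space_subspace[OF gFD]] subspace_scale[OF gauged_space_subspace[OF gFD]]
          lin_maps_add[OF bd_ops_lin[OF dl]] lin_maps_scale[OF bd_ops_lin[OF dl]] free_space_dual[of _ D]
        by (simp add: \<iota>_def)
    qed (use range \<iota>_bound in \<open>auto simp: \<iota>_def\<close>)
    show "\<iota> (delta D x) = delta E x" if "x \<in> carrier D" for x
      using delta[OF that] delta_free[OF D that] by (simp add: \<iota>_def)
  qed (rule \<iota>_bound)
qed


section \<open>The projective tensor product\<close>

lemma tensor_scale: "x \<in> carrier E \<Longrightarrow> c *\<^sub>R tensor E F x y = tensor E F (c *\<^sub>R x) y"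
  by (rule ext) (simp add: tensor_def bilinear_forms_def lin_maps_scale[of _ E])

lemma alg_tensor_simps:
  "carrier (alg_tensor E F) = span {tensor E F x y | x y. x \<in> carrier E \<and> y \<in> carrier F}"
  "nrm (alg_tensor E F) = proj_norm E F"
  by (simp_all add: alg_tensor_def)

text \<open>
  The coefficients of a linear combination are absorbed into the first factors. In particular the
  infimum in the projective norm is over a nonempty set.
\<close>

lemma alg_tensor_rep:
  assumes E: "gauged_space E" and v: "v \<in> carrier (alg_tensor E F)"
  obtains n x y where "\<forall>i<n. x i \<in> carrier E \<and> y i \<in> carrier F"
    "v = (\<Sum>i<(n::nat). tensor E F (x i) (y i))"
proof -
  from v have "\<exists>(n::nat) x y. (\<forall>i<n. x i \<in> carrier E \<and> y i \<in> carrier F) \<and>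
      v = (\<Sum>i<n. tensor E F (x i) (y i))"
    unfolding alg_tensor_simps
  proof (induction rule: span_induct_alt)
    case base
    show ?case by (rule exI[of _ 0]) simp
  next
    case (step c t v)
    obtain a b where ab: "a \<in> carrier E" "b \<in> carrier F" "t = tensor E F a b" using step(1) by blast
    obtain n x y where nxy: "\<forall>i<n. x i \<in> carrier E \<and> y i \<in> carrier F"
      "v = (\<Sum>i<(n::nat). tensor E F (x i) (y i))" using step(2) by blast
    have ca: "c *\<^sub>R a \<in> carrier E" using subspace_scale[OF gauged_space_subspace[OF E] ab(1)] .
    define x' y' where "x' = x(n := c *\<^sub>R a)" and "y' = y(n := b)"
    have "(\<Sum>i<n. tensor E F (x' i) (y' i)) = v"
      unfolding nxy(2) by (rule sum.cong) (auto simp: x'_def y'_def)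
    then have "c *\<^sub>R t + v = (\<Sum>i<Suc n. tensor E F (x' i) (y' i))"
      using tensor_scale[OF ab(1), of c F b] by (simp add: ab(3) x'_def y'_def add.commute)
    moreover have "\<forall>i<Suc n. x' i \<in> carrier E \<and> y' i \<in> carrier F"
      using nxy(1) ab(2) ca by (auto simp: x'_def y'_def less_Suc_eq)
    ultimately show ?case by blast
  qed
  then show thesis using that by blast
qed

lemma proj_norm_greatest:
  assumes E: "gauged_space E" and v: "v \<in> carrier (alg_tensor E F)"
    and le: "\<And>(n::nat) x y. (\<forall>i<n. x i \<in> carrier E \<and> y i \<in> carrier F) \<Longrightarrow>
      v = (\<Sum>i<n. tensor E F (x i) (y i)) \<Longrightarrow> C \<le> (\<Sum>i<n. nrm E (x i) * nrm F (y i))"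
  shows "C \<le> proj_norm E F v"
  unfolding proj_norm_def
proof (rule cInf_greatest)
  show "{\<Sum>i<n. nrm E (x i) * nrm F (y i) | (n::nat) x y.
      (\<forall>i<n. x i \<in> carrier E \<and> y i \<in> carrier F) \<and> v = (\<Sum>i<n. tensor E F (x i) (y i))} \<noteq> {}"
    by (rule alg_tensor_rep[OF E v]) blast
qed (use le in blast)

lemma proj_norm_lower:
  fixes n :: nat
  assumes E: "gauged_space E" and F: "gauged_space F"
    and xy: "\<forall>i<n. x i \<in> carrier E \<and> y i \<in> carrier F"
  shows "proj_norm E F (\<Sum>i<n. tensor E F (x i) (y i)) \<le> (\<Sum>i<n. nrm E (x i) * nrm F (y i))"
  unfolding proj_norm_def
proof (rule cInf_lower)
  show "(\<Sum>i<n. nrm E (x i) * nrm F (y i)) \<in> {\<Sum>i<m. nrm E (a i) * nrm F (b i) | (m::nat) a b.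
      (\<forall>i<m. a i \<in> carrier E \<and> b i \<in> carrier F) \<and>
      (\<Sum>i<n. tensor E F (x i) (y i)) = (\<Sum>i<m. tensor E F (a i) (b i))}"
    using xy by blast
  show "bdd_below {\<Sum>i<m. nrm E (a i) * nrm F (b i) | (m::nat) a b.
      (\<forall>i<m. a i \<in> carrier E \<and> b i \<in> carrier F) \<and>
      (\<Sum>i<n. tensor E F (x i) (y i)) = (\<Sum>i<m. tensor E F (a i) (b i))}"
    by (rule bdd_belowI[of _ 0]) (auto intro!: sum_nonneg mult_nonneg_nonneg gauged_space_nonneg[OF E] gauged_space_nonneg[OF F])
qed

lemma gauged_alg_tensor:
  assumes E: "gauged_space E" and F: "gauged_space F"
  shows "gauged_space (alg_tensor E F)"
proof -
  let ?P = "proj_norm E F" and ?V = "carrier (alg_tensor E F)"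
  have sub: "subspace ?V" by (simp add: alg_tensor_simps)
  have nonneg: "0 \<le> ?P v" if "v \<in> ?V" for v
  proof (rule proj_norm_greatest[OF E that])
    fix n :: nat and x y assume "\<forall>i<n. x i \<in> carrier E \<and> y i \<in> carrier F"
    then show "0 \<le> (\<Sum>i<n. nrm E (x i) * nrm F (y i))"
      using E F by (intro sum_nonneg mult_nonneg_nonneg) auto
  qed
  have scale_le: "?P (c *\<^sub>R v) \<le> \<bar>c\<bar> * ?P v" if v: "v \<in> ?V" for c v
  proof (cases "c = 0")
    case True
    then show ?thesis using proj_norm_lower[OF E F, of 0 "\<lambda>_. 0" "\<lambda>_. 0"] by simp
  next
    case False
    have "?P (c *\<^sub>R v) / \<bar>c\<bar> \<le> ?P v"
    proof (rule proj_norm_greatest[OF E v])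
      fix n :: nat and x y
      assume xy: "\<forall>i<n. x i \<in> carrier E \<and> y i \<in> carrier F" and v: "v = (\<Sum>i<n. tensor E F (x i) (y i))"
      have "c *\<^sub>R v = (\<Sum>i<n. tensor E F (c *\<^sub>R x i) (y i))"
        using xy by (simp add: v scaleR_sum_right tensor_scale)
      moreover have "\<forall>i<n. c *\<^sub>R x i \<in> carrier E \<and> y i \<in> carrier F"
        using xy subspace_scale[OF gauged_space_subspace[OF E]] by blast
      ultimately have "?P (c *\<^sub>R v) \<le> (\<Sum>i<n. nrm E (c *\<^sub>R x i) * nrm F (y i))"
        using proj_norm_lower[OF E F, of n "\<lambda>i. c *\<^sub>R x i" y] by simp
      also have "\<dots> = \<bar>c\<bar> * (\<Sum>i<n. nrm E (x i) * nrm F (y i))"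
        using xy by (simp add: gauged_space_scale[OF E] sum_distrib_left mult.assoc)
      finally show "?P (c *\<^sub>R v) / \<bar>c\<bar> \<le> (\<Sum>i<n. nrm E (x i) * nrm F (y i))"
        using False by (simp add: pos_divide_le_eq mult.commute)
    qed
    then show ?thesis using False by (simp add: pos_divide_le_eq mult.commute)
  qed
  have "?P (c *\<^sub>R v) = \<bar>c\<bar> * ?P v" if v: "v \<in> ?V" for c v
  proof (cases "c = 0")
    case True
    then show ?thesis using scale_le[OF v, of 0] nonneg[OF subspace_0[OF sub]] by simp
  next
    case False
    have "?P ((1/c) *\<^sub>R (c *\<^sub>R v)) \<le> \<bar>1/c\<bar> * ?P (c *\<^sub>R v)"
      using scale_le[OF subspace_scale[OF sub v]] .
    then have "\<bar>c\<bar> * ?P v \<le> ?P (c *\<^sub>R v)"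
      using False by (simp add: field_simps)
    then show ?thesis using scale_le[OF v, of c] by simp
  qed
  then show ?thesis
    unfolding gauged_space_def alg_tensor_simps(2) using sub nonneg by blast
qed

lemma op_bilinear:
  assumes "T \<in> bd_ops E (dual_space F)"
  shows "T \<in> bilinear_forms E F"
  using bd_ops_lin[OF assms] dual_lin[OF bd_ops_range[OF assms]] by (simp add: bilinear_forms_def)

lemma tensor_sum_apply:
  fixes n :: nat
  assumes "T \<in> bd_ops E (dual_space F)"
  shows "(\<Sum>i<n. tensor E F (x i) (y i)) T = (\<Sum>i<n. T (x i) (y i))"
  using op_bilinear[OF assms] by (simp add: sum_fun_apply tensor_def)

text \<open>
  Bounding each representation separately gives \<open>\<bar>v T\<bar> \<le> \<parallel>T\<parallel> \<Sum> \<parallel>x\<^sub>i\<parallel> \<parallel>y\<^sub>i\<parallel>\<close>; the infimum over all of them is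
  the projective norm. The case of zero operator norm is separate only because the bound is divided
  by that norm.
\<close>

lemma tensor_functional_dual:
  assumes E: "gauged_space E" and F: "gauged_space F" and T: "T \<in> bd_ops E (dual_space F)"
  shows "tensor_functional E F T \<in> carrier (dual_space (alg_tensor E F))"
    and "nrm (dual_space (alg_tensor E F)) (tensor_functional E F T) \<le> op_norm E (dual_space F) T"
proof -
  let ?r = "op_norm E (dual_space F) T"
  have gA: "gauged_space (alg_tensor E F)" using gauged_alg_tensor[OF E F] .
  have gF': "gauged_space (dual_space F)" using gauged_dual_space[OF F] .
  have r: "0 \<le> ?r" using op_norm_nonneg[OF E gF' T] .
  have bound: "\<bar>v T\<bar> \<le> ?r * proj_norm E F v" if v: "v \<in> carrier (alg_tensor E F)" for v
  proof (cases "?r = 0")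
    case True
    obtain n x y where xy: "\<forall>i<n. x i \<in> carrier E \<and> y i \<in> carrier F"
      and v': "v = (\<Sum>i<(n::nat). tensor E F (x i) (y i))"
      by (rule alg_tensor_rep[OF E v])
    have "T (x i) (y i) = 0" if "i < n" for i
      using dual_norm_bound[OF F bd_ops_range[OF T], of "x i" "y i"] xy that True
        op_norm_bound[OF E gF' T, of "x i"] gauged_space_nonneg[OF gF' bd_ops_range[OF T], of "x i"] by simp
    then show ?thesis using True by (simp add: v' tensor_sum_apply[OF T])
  next
    case False
    then have pos: "?r > 0" using r by simp
    have "\<bar>v T\<bar> / ?r \<le> proj_norm E F v"
    proof (rule proj_norm_greatest[OF E v])
      fix n :: nat and x y
      assume xy: "\<forall>i<n. x i \<in> carrier E \<and> y i \<in> carrier F" and v: "v = (\<Sum>i<n. tensor E F (x i) (y i))"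
      have "\<bar>v T\<bar> \<le> (\<Sum>i<n. \<bar>T (x i) (y i)\<bar>)"
        unfolding v tensor_sum_apply[OF T] by (rule sum_abs)
      also have "\<dots> \<le> (\<Sum>i<n. ?r * (nrm E (x i) * nrm F (y i)))"
      proof (rule sum_mono)
        fix i assume "i \<in> {..<n}"
        then have i: "x i \<in> carrier E" "y i \<in> carrier F" using xy by auto
        have "\<bar>T (x i) (y i)\<bar> \<le> nrm (dual_space F) (T (x i)) * nrm F (y i)"
          using dual_norm_bound[OF F bd_ops_range[OF T i(1)] i(2)] .
        also have "\<dots> \<le> ?r * nrm E (x i) * nrm F (y i)"
          using op_norm_bound[OF E gF' T i(1)] gauged_space_nonneg[OF F i(2)] by (rule mult_right_mono)
        finally show "\<bar>T (x i) (y i)\<bar> \<le> ?r * (nrm E (x i) * nrm F (y i))" by (simp add: mult.assoc)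
      qed
      also have "\<dots> = (\<Sum>i<n. nrm E (x i) * nrm F (y i)) * ?r"
        by (simp add: sum_distrib_left mult.commute)
      finally show "\<bar>v T\<bar> / ?r \<le> (\<Sum>i<n. nrm E (x i) * nrm F (y i))"
        using pos by (simp add: pos_divide_le_eq)
    qed
    then show ?thesis using pos by (simp add: pos_divide_le_eq mult.commute)
  qed
  show "tensor_functional E F T \<in> carrier (dual_space (alg_tensor E F))"
  proof (rule in_dualI[where C = ?r])
    show "tensor_functional E F T \<in> lin_maps (alg_tensor E F)"
      unfolding lin_maps_def tensor_functional_def
      using subspace_add[OF gauged_space_subspace[OF gA]] subspace_scale[OF gauged_space_subspace[OF gA]]
      by simp
  qed (use bound in \<open>simp add: tensor_functional_def alg_tensor_simps(2)\<close>)
  show "nrm (dual_space (alg_tensor E F)) (tensor_functional E F T) \<le> ?r"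
    by (rule dual_norm_least[OF gA r]) (use bound in \<open>simp add: tensor_functional_def alg_tensor_simps(2)\<close>)
qed

lemma bidual_embedding_bidual:
  assumes E: "gauged_space E" and x: "x \<in> carrier E"
  shows "bidual_embedding E x \<in> carrier (dual_space (dual_space E))"
proof (rule in_dualI[where C = "nrm E x"])
  show "bidual_embedding E x \<in> lin_maps (dual_space E)"
    unfolding lin_maps_def bidual_embedding_def
    using subspace_add[OF gauged_space_subspace[OF gauged_dual_space[OF E]]]
      subspace_scale[OF gauged_space_subspace[OF gauged_dual_space[OF E]]] by simp
  show "\<bar>bidual_embedding E x g\<bar> \<le> nrm E x * nrm (dual_space E) g" if "g \<in> carrier (dual_space E)" for g
    using dual_norm_bound[OF E that x] that by (simp add: bidual_embedding_def mult.commute)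
qed

lemma proj_tensor_carrier:
  "carrier (proj_tensor E F) = norm_closure (dual_space (dual_space (alg_tensor E F)))
    (bidual_embedding (alg_tensor E F) ` carrier (alg_tensor E F))"
  by (simp add: proj_tensor_def completion_def)

text \<open>
  On elements of the algebraic tensor product the pairing is a finite sum of values \<open>T x y\<close>, so it
  converges. The pairing with \<open>T\<close> is Lipschitz in \<open>u\<close> with constant \<open>\<parallel>T\<parallel>\<close>, so the uniform bound carries
  the convergence over to the completion.
\<close>

lemma tendsto_proj_tensor:
  fixes T :: "'i \<Rightarrow> 'v::real_vector \<Rightarrow> 'w::real_vector \<Rightarrow> real"
  assumes E: "gauged_space E" and F: "gauged_space F"
    and T: "\<forall>\<^sub>F i in \<F>. T i \<in> bd_ops E (dual_space F) \<and> op_norm E (dual_space F) (T i) \<le> r"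
    and S: "S \<in> bd_ops E (dual_space F)"
    and lim: "\<And>x y. x \<in> carrier E \<Longrightarrow> y \<in> carrier F \<Longrightarrow> ((\<lambda>i. T i x y) \<longlongrightarrow> S x y) \<F>"
    and u: "u \<in> carrier (proj_tensor E F)"
  shows "((\<lambda>i. u (tensor_functional E F (T i))) \<longlongrightarrow> u (tensor_functional E F S)) \<F>"
proof -
  let ?A = "alg_tensor E F"
  let ?B = "dual_space (dual_space ?A)"
  have gA: "gauged_space ?A" using gauged_alg_tensor[OF E F] .
  have gA': "gauged_space (dual_space ?A)" using gauged_dual_space[OF gA] .
  have gB: "gauged_space ?B" using gauged_dual_space[OF gA'] .
  define K where "K = max r (op_norm E (dual_space F) S)"
  have lip: "\<forall>y\<in>carrier ?B. \<forall>z\<in>carrier ?B.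
      \<bar>y (tensor_functional E F R) - z (tensor_functional E F R)\<bar> \<le> K * nrm ?B (y - z)"
    if R: "R \<in> bd_ops E (dual_space F)" "op_norm E (dual_space F) R \<le> K" for R
  proof (intro ballI)
    fix y z assume yz: "y \<in> carrier ?B" "z \<in> carrier ?B"
    have d: "y - z \<in> carrier ?B" using subspace_diff[OF gauged_space_subspace[OF gB] yz] .
    note \<phi> = tensor_functional_dual[OF E F R(1)]
    have "\<bar>(y - z) (tensor_functional E F R)\<bar> \<le> nrm ?B (y - z) * nrm (dual_space ?A) (tensor_functional E F R)"
      using dual_norm_bound[OF gA' d \<phi>(1)] .
    also have "\<dots> \<le> nrm ?B (y - z) * K"
      using \<phi>(2) R(2) gauged_space_nonneg[OF gB d] by (intro mult_left_mono) auto
    finally show "\<bar>y (tensor_functional E F R) - z (tensor_functional E F R)\<bar> \<le> K * nrm ?B (y - z)"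
      by (simp add: mult.commute)
  qed
  show ?thesis
  proof (rule tendsto_on_norm_closure[OF gB u[unfolded proj_tensor_carrier],
        where \<Phi> = "\<lambda>i w. w (tensor_functional E F (T i))" and \<phi> = "\<lambda>w. w (tensor_functional E F S)" and C = K])
    show "bidual_embedding ?A ` carrier ?A \<subseteq> carrier ?B" using bidual_embedding_bidual[OF gA] by blast
    show "\<forall>\<^sub>F i in \<F>. \<forall>y\<in>carrier ?B. \<forall>z\<in>carrier ?B.
      \<bar>y (tensor_functional E F (T i)) - z (tensor_functional E F (T i))\<bar> \<le> K * nrm ?B (y - z)"
      using T
    proof eventually_elim
      case (elim i)
      then show ?case by (intro lip) (simp_all add: K_def le_max_iff_disj)
    qed
    show "\<forall>y\<in>carrier ?B. \<forall>z\<in>carrier ?B.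
      \<bar>y (tensor_functional E F S) - z (tensor_functional E F S)\<bar> \<le> K * nrm ?B (y - z)"
      using S by (rule lip) (simp add: K_def)
    fix w assume "w \<in> bidual_embedding ?A ` carrier ?A"
    then obtain v where v: "v \<in> carrier ?A" and w: "w = bidual_embedding ?A v" by blast
    obtain n x y where xy: "\<forall>i<n. x i \<in> carrier E \<and> y i \<in> carrier F"
      and v': "v = (\<Sum>i<(n::nat). tensor E F (x i) (y i))"
      by (rule alg_tensor_rep[OF E v])
    have eval: "w (tensor_functional E F R) = (\<Sum>j<n. R (x j) (y j))" if "R \<in> bd_ops E (dual_space F)" for R
    proof -
      have "w (tensor_functional E F R) = v R"
        using tensor_functional_dual(1)[OF E F that] v by (simp add: w bidual_embedding_def tensor_functional_def)
      then show ?thesis using tensor_sum_apply[OF that] by (simp add: v')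
    qed
    have "((\<lambda>i. \<Sum>j<n. T i (x j) (y j)) \<longlongrightarrow> (\<Sum>j<n. S (x j) (y j))) \<F>"
      using lim xy by (intro tendsto_sum) auto
    moreover have "\<forall>\<^sub>F i in \<F>. (\<Sum>j<n. T i (x j) (y j)) = w (tensor_functional E F (T i))"
      using T by eventually_elim (simp add: eval)
    ultimately show "((\<lambda>i. w (tensor_functional E F (T i))) \<longlongrightarrow> w (tensor_functional E F S)) \<F>"
      unfolding eval[OF S] by (rule Lim_transform_eventually)
  qed
qed

text \<open>
  The sets that contain \<open>f i\<close> eventually, whenever they contain \<open>x\<close>, are closed under finite
  intersections and arbitrary unions.
\<close>

lemma eventually_in_generated_open:
  assumes W: "openin (topology_generated_by \<B>) W" and x: "x \<in> W"
    and basis: "\<And>B. B \<in> \<B> \<Longrightarrow> x \<in> B \<Longrightarrow> \<forall>\<^sub>F i in \<F>. f i \<in> B"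
  shows "\<forall>\<^sub>F i in \<F>. f i \<in> W"
proof -
  from W have "generate_topology_on \<B> W" by (simp add: openin_topology_generated_by_iff)
  from this x show ?thesis
  proof (induction rule: generate_topology_on.induct)
    case (Int a b)
    then show ?case by (auto intro: eventually_conj)
  next
    case (UN K)
    then obtain k where "k \<in> K" "x \<in> k" by blast
    then have "\<forall>\<^sub>F i in \<F>. f i \<in> k" using UN by blast
    then show ?case by eventually_elim (use \<open>k \<in> K\<close> in blast)
  qed (use basis in auto)
qed

text \<open>
  By \<open>tendsto_proj_tensor\<close> the bounded net \<open>T\<close> runs eventually into each subbasic weak-star
  neighbourhood of \<open>S\<close>.
\<close>

lemma weak_star_closureI:
  fixes T :: "'i \<Rightarrow> 'v::real_vector \<Rightarrow> 'w::real_vector \<Rightarrow> real"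
  assumes E: "gauged_space E" and F: "gauged_space F" and \<F>: "\<F> \<noteq> bot"
    and T: "\<forall>\<^sub>F i in \<F>. T i \<in> \<C> \<and> T i \<in> bd_ops E (dual_space F) \<and> op_norm E (dual_space F) (T i) \<le> r"
    and S: "S \<in> bd_ops E (dual_space F)"
    and lim: "\<And>x y. x \<in> carrier E \<Longrightarrow> y \<in> carrier F \<Longrightarrow> ((\<lambda>i. T i x y) \<longlongrightarrow> S x y) \<F>"
  shows "S \<in> weak_star_topology E F closure_of \<C>"
proof -
  let ?\<B> = "{{T \<in> bd_ops E (dual_space F). u (tensor_functional E F T) \<in> U} | u U.
        u \<in> carrier (proj_tensor E F) \<and> open U}"
  have T': "\<forall>\<^sub>F i in \<F>. T i \<in> bd_ops E (dual_space F) \<and> op_norm E (dual_space F) (T i) \<le> r"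
    using T by eventually_elim blast
  have gA: "gauged_space (alg_tensor E F)" using gauged_alg_tensor[OF E F] .
  \<comment> \<open>The topology lives on all bounded operators: any \<open>u\<close> together with \<open>U = UNIV\<close> gives that subbasic set.\<close>
  have "bidual_embedding (alg_tensor E F) 0 \<in> carrier (proj_tensor E F)"
    unfolding proj_tensor_carrier
    using norm_closure_superset[OF gauged_dual_space[OF gauged_dual_space[OF gA]], of
        "bidual_embedding (alg_tensor E F) ` carrier (alg_tensor E F)"] bidual_embedding_bidual[OF gA]
      gauged_space_zero[OF gA] by blast
  then have "bd_ops E (dual_space F) \<in> ?\<B>"
    by (intro CollectI exI[of _ "bidual_embedding (alg_tensor E F) 0"] exI[of _ UNIV]) auto
  then have top: "S \<in> topspace (weak_star_topology E F)"
    unfolding weak_star_topology_def topology_generated_by_topspace using S by blast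
  have "\<exists>R\<in>\<C>. R \<in> W" if W: "S \<in> W" "openin (weak_star_topology E F) W" for W
  proof -
    have "\<forall>\<^sub>F i in \<F>. T i \<in> W"
    proof (rule eventually_in_generated_open[OF W(2)[unfolded weak_star_topology_def] W(1)])
      fix B assume "B \<in> ?\<B>" "S \<in> B"
      then obtain u U where B: "B = {T \<in> bd_ops E (dual_space F). u (tensor_functional E F T) \<in> U}"
        and u: "u \<in> carrier (proj_tensor E F)" and U: "open U" by blast
      have "\<forall>\<^sub>F i in \<F>. u (tensor_functional E F (T i)) \<in> U"
        using tendsto_proj_tensor[OF E F T' S lim u] U \<open>S \<in> B\<close> by (intro topological_tendstoD) (auto simp: B)
      with T' show "\<forall>\<^sub>F i in \<F>. T i \<in> B" by eventually_elim (simp add: B)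
    qed
    with T have "\<forall>\<^sub>F i in \<F>. T i \<in> \<C> \<and> T i \<in> W" by eventually_elim blast
    then have "\<exists>i. T i \<in> \<C> \<and> T i \<in> W" by (rule eventually_happens'[OF \<F>])
    then show ?thesis by blast
  qed
  then show ?thesis using top unfolding in_closure_of by blast
qed

section \<open>Extension operators and adjoints in the ideal\<close>

text \<open>
  Let \<open>P\<close> be the projection with kernel \<open>D\<^sup>\<bottom>\<close>. Norm-preserving extensions can be chosen, but
  in general not linearly; two extensions of the same functional differ by an element of \<open>D\<^sup>\<bottom>\<close>, so applying \<open>P\<close> removes
  the dependence on the choice and with it the nonlinearity. Since \<open>g - P g\<close> lies in \<open>D\<^sup>\<bottom>\<close>, applying \<open>P\<close>
  does not change the values on \<open>D\<close>.
\<close>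

lemma hahn_banach_extension_operator:
  assumes E: "normed_space E" and D: "normed_space D" and sub: "carrier D \<subseteq> carrier E"
    and nrm: "\<And>x. x \<in> carrier D \<Longrightarrow> nrm D x = nrm E x"
    and ideal: "ideal_in (carrier D) E"
  obtains \<sigma> where "\<sigma> \<in> bd_ops (dual_space D) (dual_space E)"
    "\<And>g x. g \<in> carrier (dual_space D) \<Longrightarrow> x \<in> carrier D \<Longrightarrow> \<sigma> g x = g x"
    "\<And>g. g \<in> carrier (dual_space D) \<Longrightarrow> nrm (dual_space E) (\<sigma> g) \<le> nrm (dual_space D) g"
proof -
  let ?D = "dual_space D" and ?E = "dual_space E"
  have gE: "gauged_space E" and gD: "gauged_space D" using E D normed_imp_gauged by auto
  have gE': "gauged_space ?E" and gD': "gauged_space ?D" using gE gD gauged_dual_space by auto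
  note sE = gauged_space_subspace[OF gE'] and sD = gauged_space_subspace[OF gD']
  obtain P where P: "P \<in> bd_ops ?E ?E" "\<And>g. P (P g) = P g" "op_norm ?E ?E P \<le> 1"
    and ker: "{g \<in> carrier ?E. P g = 0} = annihilator (carrier D) E"
    using ideal unfolding ideal_in_def by blast
  have ker_iff: "P g = 0 \<longleftrightarrow> (\<forall>x\<in>carrier D. g x = 0)" if "g \<in> carrier ?E" for g
    using ker that unfolding annihilator_def by blast
  note lP = bd_ops_lin[OF P(1)]
  have P_eq: "P g = P h" if gh: "g \<in> carrier ?E" "h \<in> carrier ?E" "\<And>x. x \<in> carrier D \<Longrightarrow> g x = h x" for g h
  proof -
    have "P (g - h) = 0" using ker_iff[OF subspace_diff[OF sE gh(1,2)]] gh(3) by simp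
    then show ?thesis using lin_maps_diff[OF sE lP gh(1,2)] by simp
  qed
  have P_on: "P g x = g x" if g: "g \<in> carrier ?E" and x: "x \<in> carrier D" for g x
  proof -
    have Pg: "P g \<in> carrier ?E" using bd_ops_range[OF P(1) g] .
    have "P (g - P g) = 0" using lin_maps_diff[OF sE lP g Pg] P(2) by simp
    then have "(g - P g) x = 0" using ker_iff[OF subspace_diff[OF sE g Pg]] x by blast
    then show ?thesis by simp
  qed
  have P_norm: "nrm ?E (P g) \<le> nrm ?E g" if g: "g \<in> carrier ?E" for g
  proof -
    have "nrm ?E (P g) \<le> op_norm ?E ?E P * nrm ?E g" using op_norm_bound[OF gE' gE' P(1) g] .
    also have "\<dots> \<le> 1 * nrm ?E g" using P(3) gauged_space_nonneg[OF gE' g] by (rule mult_right_mono)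
    finally show ?thesis by simp
  qed
  have "\<exists>h. h \<in> carrier ?E \<and> (\<forall>x\<in>carrier D. h x = g x) \<and> nrm ?E h \<le> nrm ?D g"
    if g: "g \<in> carrier ?D" for g
  proof -
    obtain h where "h \<in> carrier ?E" "\<And>x. x \<in> carrier D \<Longrightarrow> h x = g x" "nrm ?E h \<le> nrm ?D g"
    proof (rule hahn_banach_dual[OF E gauged_space_subspace[OF gD] sub])
      show "g (x + y) = g x + g y" if "x \<in> carrier D" "y \<in> carrier D" for x y
        using lin_maps_add[OF dual_lin[OF g] that] .
      show "g (c *\<^sub>R x) = c * g x" if "x \<in> carrier D" for c x
        using lin_maps_scale[OF dual_lin[OF g] that] by simp
      show "0 \<le> nrm ?D g" using gauged_space_nonneg[OF gD' g] .
      show "\<bar>g x\<bar> \<le> nrm ?D g * nrm E x" if "x \<in> carrier D" for x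
        using dual_norm_bound[OF gD g that] nrm[OF that] by simp
    qed blast
    then show ?thesis by blast
  qed
  then obtain ext where ext: "\<And>g. g \<in> carrier ?D \<Longrightarrow> ext g \<in> carrier ?E"
    "\<And>g x. g \<in> carrier ?D \<Longrightarrow> x \<in> carrier D \<Longrightarrow> ext g x = g x"
    "\<And>g. g \<in> carrier ?D \<Longrightarrow> nrm ?E (ext g) \<le> nrm ?D g"
    by metis
  define \<sigma> where "\<sigma> g = (if g \<in> carrier ?D then P (ext g) else 0)" for g
  have \<sigma>_norm: "nrm ?E (\<sigma> g) \<le> nrm ?D g" if "g \<in> carrier ?D" for g
    using P_norm[OF ext(1)[OF that]] ext(3)[OF that] that by (simp add: \<sigma>_def)
  show thesis
  proof (rule that[of \<sigma>])
    show "\<sigma> \<in> bd_ops ?D ?E"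
    proof (rule bd_opsI[where C = 1])
      show "\<sigma> \<in> lin_maps ?D"
        unfolding lin_maps_def
      proof safe
        fix g h assume g: "g \<in> carrier ?D" and h: "h \<in> carrier ?D"
        have gh: "g + h \<in> carrier ?D" using subspace_add[OF sD g h] .
        have "P (ext (g + h)) = P (ext g + ext h)"
          by (rule P_eq[OF ext(1)[OF gh] subspace_add[OF sE ext(1)[OF g] ext(1)[OF h]]])
            (simp add: ext(2) g h gh)
        then show "\<sigma> (g + h) = \<sigma> g + \<sigma> h"
          using lin_maps_add[OF lP ext(1)[OF g] ext(1)[OF h]] g h gh by (simp add: \<sigma>_def)
      next
        fix c g assume g: "g \<in> carrier ?D"
        have cg: "c *\<^sub>R g \<in> carrier ?D" using subspace_scale[OF sD g] .
        have "P (ext (c *\<^sub>R g)) = P (c *\<^sub>R ext g)"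
          by (rule P_eq[OF ext(1)[OF cg] subspace_scale[OF sE ext(1)[OF g]]]) (simp add: ext(2) g cg)
        then show "\<sigma> (c *\<^sub>R g) = c *\<^sub>R \<sigma> g"
          using lin_maps_scale[OF lP ext(1)[OF g]] g cg by (simp add: \<sigma>_def)
      qed (simp add: \<sigma>_def)
    qed (use \<sigma>_norm bd_ops_range[OF P(1) ext(1)] in \<open>auto simp: \<sigma>_def\<close>)
    show "\<sigma> g x = g x" if "g \<in> carrier ?D" "x \<in> carrier D" for g x
      using P_on[OF ext(1)[OF that(1)] that(2)] ext(2)[OF that] that(1) by (simp add: \<sigma>_def)
  qed (rule \<sigma>_norm)
qed

text \<open>
  The equation \<open>\<A> = \<A>\<^sup>d\<close> is available for the copies \<open>E1\<close>, \<open>F1\<close> on which \<open>T\<close> is witnessed, because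
  their duals are isometric to those of \<open>E\<close> and \<open>F\<close> and hence have copies as well. It puts the adjoint of
  the transported operator into the ideal, and composing with adjoints of the isometries gives the
  adjoint of \<open>T\<close>.
\<close>

lemma dual_op_ideal_ops:
  fixes \<A> :: "'u::real_vector op_class"
  assumes \<A>: "operator_ideal \<A>" "eq_dual_class \<A>"
    and T: "T \<in> ideal_ops \<A> E F" and E: "normed_space E" and F: "normed_space F"
    and copies: "is_copy (dual_space E) (E' :: 'u nspace) \<phi>" "is_copy (dual_space F) (F' :: 'u nspace) \<psi>"
  shows "dual_op E F T \<in> ideal_ops \<A> (dual_space F) (dual_space E)"
proof -
  obtain E1 F1 :: "'u nspace" and \<theta> \<eta> T' where E1: "is_copy E E1 \<theta>" and F1: "is_copy F F1 \<eta>"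
    and T': "T' \<in> \<A> E1 F1" "\<And>x. x \<in> carrier E \<Longrightarrow> T' (\<theta> x) = \<eta> (T x)" and bT: "T \<in> bd_ops E F"
    using T unfolding ideal_ops_def by blast
  have b: "banach_space E1" "banach_space F1" and iso: "isometry_onto E E1 \<theta>" "isometry_onto F F1 \<eta>"
    using E1 F1 by (auto simp: is_copy_def)
  note g = normed_imp_gauged[OF E] normed_imp_gauged[OF F]
    and g1 = b[THEN banach_imp_gauged] and n1 = b[THEN banach_imp_normed]
  note iso' = isometry_onto_dual_op[OF E g1(1) iso(1)] isometry_onto_dual_op[OF F g1(2) iso(2)]
  have cE1: "is_copy (dual_space E1) E' (\<phi> \<circ> dual_op E E1 \<theta>)"
    using is_copy_precomp[OF gauged_dual_space[OF g1(1)] gauged_dual_space[OF g(1)] iso'(1) copies(1)] .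
  have cF1: "is_copy (dual_space F1) F' (\<psi> \<circ> dual_op F F1 \<eta>)"
    using is_copy_precomp[OF gauged_dual_space[OF g1(2)] gauged_dual_space[OF g(2)] iso'(2) copies(2)] .
  have "\<A> E1 F1 = dual_class \<A> E1 F1"
    using \<A>(2) b cE1 cF1 unfolding eq_dual_class_def by blast
  then have T'd: "dual_op E1 F1 T' \<in> ideal_ops \<A> (dual_space F1) (dual_space E1)"
    and bT': "T' \<in> bd_ops E1 F1"
    using T'(1) by (auto simp: dual_class_def)
  obtain \<eta>' where \<eta>': "isometry_onto F1 F \<eta>'" "\<And>x. x \<in> carrier F \<Longrightarrow> \<eta>' (\<eta> x) = x"
    by (rule isometry_onto_inverse[OF F g1(2) iso(2)]) blast
  note d\<eta> = dual_op_bd[OF g1(2) g(2) isometry_ontoD(1)[OF \<eta>'(1)]]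
  have "dual_op E E1 \<theta> \<circ> dual_op E1 F1 T' \<circ> dual_op F1 F \<eta>' \<in> ideal_ops \<A> (dual_space F) (dual_space E)"
    using ideal_ops_comp[OF \<A>(1) T'd normed_dual_space[OF g(2)] normed_dual_space[OF g1(2)]
      normed_dual_space[OF g1(1)] normed_dual_space[OF g(1)] d\<eta>
      isometry_ontoD(1)[OF iso'(1)] copies(2,1)] .
  moreover have "(dual_op E E1 \<theta> \<circ> dual_op E1 F1 T' \<circ> dual_op F1 F \<eta>') y = dual_op E F T y" for y
  proof (cases "y \<in> carrier (dual_space F)")
    case True
    have 1: "dual_op F1 F \<eta>' y \<in> carrier (dual_space F1)" using bd_ops_range[OF d\<eta> True] .
    have 2: "dual_op E1 F1 T' (dual_op F1 F \<eta>' y) \<in> carrier (dual_space E1)"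
      using bd_ops_range[OF dual_op_bd[OF g1(1) g1(2) bT'] 1] .
    have "y (\<eta>' (T' (\<theta> x))) = y (T x)" for x
    proof (cases "x \<in> carrier E")
      case xE: True
      then show ?thesis using T'(2)[OF xE] \<eta>'(2)[OF bd_ops_range[OF bT xE]] by simp
    next
      case False
      have "T x = 0" "\<theta> x = 0"
        using lin_maps_off[OF bd_ops_lin[OF bT] False] lin_maps_off[OF bd_ops_lin[OF isometry_ontoD(1)[OF iso(1)]] False] .
      moreover have "T' 0 = 0" "\<eta>' 0 = 0"
        using lin_maps_zero[OF gauged_space_subspace[OF g1(1)] bd_ops_lin[OF bT']]
          lin_maps_zero[OF gauged_space_subspace[OF g1(2)] bd_ops_lin[OF isometry_ontoD(1)[OF \<eta>'(1)]]] .
      ultimately show ?thesis by simp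
    qed
    then show ?thesis
      by (auto simp: dual_op_apply[OF 2] dual_op_apply[OF 1] dual_op_apply[OF True])
  next
    case False
    then have "dual_op F1 F \<eta>' y = 0" "dual_op E F T y = 0" by (simp_all add: dual_op_def)
    moreover have "dual_op E1 F1 T' 0 = 0" "dual_op E E1 \<theta> 0 = 0"
      using lin_maps_zero[OF gauged_space_subspace[OF gauged_dual_space[OF g1(2)]] bd_ops_lin[OF dual_op_bd[OF g1(1) g1(2) bT']]]
        lin_maps_zero[OF gauged_space_subspace[OF gauged_dual_space[OF g1(1)]] bd_ops_lin[OF isometry_ontoD(1)[OF iso'(1)]]] .
    ultimately show ?thesis by simp
  qed
  ultimately show ?thesis by (metis (no_types, lifting) ext)
qed

text \<open>
  Functions on a smaller index set embed linearly into functions on a larger one. This provides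
  copies of \<open>M\<^sup>*\<close> and \<open>X\<^sup>*\<close>, whose elements are functions on the ambient type itself, from the embedding
  of the larger function type in the hypothesis of the theorem.
\<close>

lemma precompose_surjection:
  fixes h :: "('b \<Rightarrow> 'c::real_vector) \<Rightarrow> 'u::real_vector" and \<nu> :: "'b \<Rightarrow> 'a"
  assumes h: "linear h" "inj h" and \<nu>: "surj \<nu>"
  shows "linear (\<lambda>g. h (g \<circ> \<nu>))" "inj (\<lambda>g. h (g \<circ> \<nu>))"
proof -
  show "linear (\<lambda>g. h (g \<circ> \<nu>))"
  proof (rule linearI)
    fix f g :: "'a \<Rightarrow> 'c" and c :: real
    have "(f + g) \<circ> \<nu> = (f \<circ> \<nu>) + (g \<circ> \<nu>)" "(c *\<^sub>R f) \<circ> \<nu> = c *\<^sub>R (f \<circ> \<nu>)" by auto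
    then show "h ((f + g) \<circ> \<nu>) = h (f \<circ> \<nu>) + h (g \<circ> \<nu>)" "h ((c *\<^sub>R f) \<circ> \<nu>) = c *\<^sub>R h (f \<circ> \<nu>)"
      using linear_add[OF h(1)] linear_scale[OF h(1)] by simp_all
  qed
  show "inj (\<lambda>g. h (g \<circ> \<nu>))"
  proof (rule injI)
    fix f g assume "h (f \<circ> \<nu>) = h (g \<circ> \<nu>)"
    then have "f \<circ> \<nu> = g \<circ> \<nu>" using h(2) by (simp add: inj_eq)
    then show "f = g" using \<nu> by (metis comp_apply ext surjD)
  qed
qed

section \<open>Weak-star approximation of the adjoint of \<open>\<beta>\<close>\<close>

theorem theorem4p4:
  fixes M :: "'a::banach set"
    and \<A> :: "'u::real_vector op_class"
  assumes universe_large: "\<exists>h :: ((('a \<Rightarrow> real) \<Rightarrow> real) \<Rightarrow> real) \<Rightarrow> 'u. linear h \<and> inj h"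
    and "subspace M" and "closed M"
    and "ideal_in M (type_space UNIV)"
    and "operator_ideal \<A>"
    and "eq_dual_class \<A>"
    and "lip_BAP \<A> TYPE('a)"
  shows "\<exists>r\<ge>1. dual_op (free_space (type_space M)) (type_space M) (beta (type_space M))
    \<in> weak_star_topology (dual_space (type_space M)) (free_space (type_space M)) closure_of
      ideal_ops_bd \<A> r (dual_space (type_space M)) (dual_space (free_space (type_space M)))"
proof -
  let ?M = "type_space M" and ?X = "type_space UNIV :: 'a nspace"
  let ?FM = "free_space ?M" and ?FX = "free_space ?X"
  let ?M' = "dual_space ?M" and ?X' = "dual_space ?X"
  have bX: "banach_space ?X" and bM: "banach_space ?M"
    using banach_type_space[OF subspace_UNIV closed_UNIV] banach_type_space[OF assms(2,3)] .
  note nX = banach_imp_normed[OF bX] and nM = banach_imp_normed[OF bM]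
  note gX = normed_imp_gauged[OF nX] and gM = normed_imp_gauged[OF nM]
  note nFX = normed_free_space[OF nX] and nFM = normed_free_space[OF nM]
  note gFX = normed_imp_gauged[OF nFX] and gFM = normed_imp_gauged[OF nFM]
  note gM' = gauged_dual_space[OF gM]

  obtain h :: "((('a \<Rightarrow> real) \<Rightarrow> real) \<Rightarrow> real) \<Rightarrow> 'u" where h: "linear h" "inj h"
    using universe_large by blast
  \<comment> \<open>Evaluations embed \<open>'a\<close> into \<open>('a \<Rightarrow> real) \<Rightarrow> real\<close>; a left inverse is the required surjection.\<close>
  have "inj (\<lambda>(a::'a) (g::'a \<Rightarrow> real). g a)"
  proof (rule injI)
    fix a b :: 'a assume "(\<lambda>g::'a \<Rightarrow> real. g a) = (\<lambda>g. g b)"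
    then have "(if a = a then 1 else 0 :: real) = (if b = a then 1 else 0)"
      by (rule fun_cong[where x = "\<lambda>c. if c = a then 1 else 0"])
    then show "a = b" by (simp split: if_splits)
  qed
  then have "surj (inv (\<lambda>(a::'a) (g::'a \<Rightarrow> real). g a))" by (rule inj_imp_surj_inv)
  note h' = precompose_surjection[OF h this]
  obtain M1 :: "'u nspace" and \<phi>\<^sub>M where cM: "is_copy ?M' M1 \<phi>\<^sub>M"
    by (rule copy_along_injection[OF banach_dual_space[OF gM] h'])
  obtain X1 :: "'u nspace" and \<phi>\<^sub>X where cX: "is_copy ?X' X1 \<phi>\<^sub>X"
    by (rule copy_along_injection[OF banach_dual_space[OF gX] h'])
  obtain FM1 :: "'u nspace" and \<psi>\<^sub>M where cFM: "is_copy (dual_space ?FM) FM1 \<psi>\<^sub>M"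
    by (rule copy_along_injection[OF banach_dual_space[OF gFM] h])
  obtain FX1 :: "'u nspace" and \<psi>\<^sub>X where cFX: "is_copy (dual_space ?FX) FX1 \<psi>\<^sub>X"
    by (rule copy_along_injection[OF banach_dual_space[OF gFX] h])

  obtain \<sigma> where \<sigma>: "\<sigma> \<in> bd_ops ?M' ?X'"
    "\<And>g x. g \<in> carrier ?M' \<Longrightarrow> x \<in> carrier ?M \<Longrightarrow> \<sigma> g x = g x"
    "\<And>g. g \<in> carrier ?M' \<Longrightarrow> nrm ?X' (\<sigma> g) \<le> nrm ?M' g"
    by (rule hahn_banach_extension_operator[OF nX nM]) (use assms(4) in auto)
  obtain \<iota> where \<iota>: "\<iota> \<in> bd_ops ?FM ?FX" "\<And>x. x \<in> carrier ?M \<Longrightarrow> \<iota> (delta ?M x) = delta ?X x"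
    "\<And>\<mu>. \<mu> \<in> carrier ?FM \<Longrightarrow> nrm ?FX (\<iota> \<mu>) \<le> nrm ?FM \<mu>"
    by (rule free_space_inclusion[OF nM nX]) auto
  note d\<iota> = dual_op_bd[OF gFM gFX \<iota>(1)]

  obtain r where r: "r \<ge> 1" and
    BAP: "id \<in> compact_open_topology closure_of lip_ideal_bd \<A> r ?X ?X"
    using assms(7) unfolding lip_BAP_def by blast
  let ?C = "lip_ideal_bd \<A> r ?X ?X"
  have C: "f \<in> lip0 ?X ?X" "linearization ?X ?X f \<in> ideal_ops \<A> ?FX ?X" "lip_norm ?X ?X f \<le> r"
    if "f \<in> ?C" for f
    using that by (auto simp: lip_ideal_bd_def lip_ideal_def)
  define T where "T f = dual_op ?FM ?FX \<iota> \<circ> dual_op ?FX ?X (linearization ?X ?X f) \<circ> \<sigma>" for f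
  have T_apply: "T f g \<mu> = \<sigma> g (linearization ?X ?X f (\<iota> \<mu>))"
    if f: "f \<in> lip0 ?X ?X" and g: "g \<in> carrier ?M'" for f g \<mu>
    using bd_ops_range[OF dual_op_bd[OF gFX gX linearization_props(1)[OF nX bX f]] bd_ops_range[OF \<sigma>(1) g]]
      bd_ops_range[OF \<sigma>(1) g] by (simp add: T_def dual_op_apply)
  have T_norm: "nrm (dual_space ?FM) (T f g) \<le> r * nrm ?M' g" if f: "f \<in> ?C" and g: "g \<in> carrier ?M'" for f g
  proof -
    let ?L = "linearization ?X ?X f"
    note L = linearization_props[OF nX bX C(1)[OF f]]
    have bound: "nrm ?X (?L \<mu>) \<le> r * nrm ?FX \<mu>" if "\<mu> \<in> carrier ?FX" for \<mu>
      using L(3)[OF that] mult_right_mono[OF C(3)[OF f] gauged_space_nonneg[OF gFX that]] by simp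
    have L': "dual_op ?FX ?X ?L (\<sigma> g) \<in> carrier (dual_space ?FX)"
      using bd_ops_range[OF dual_op_bd[OF gFX gX L(1)] bd_ops_range[OF \<sigma>(1) g]] .
    have "nrm (dual_space ?FM) (T f g) \<le> nrm (dual_space ?FX) (dual_op ?FX ?X ?L (\<sigma> g))"
      using dual_op_norm[OF gFM gFX \<iota>(1), of 1] \<iota>(3) L' by (simp add: T_def)
    also have "\<dots> \<le> r * nrm ?X' (\<sigma> g)"
      using dual_op_norm[OF gFX gX L(1), of r] bound bd_ops_range[OF \<sigma>(1) g] r by simp
    also have "\<dots> \<le> r * nrm ?M' g" using \<sigma>(3)[OF g] r by simp
    finally show ?thesis .
  qed
  have T_ideal: "T f \<in> ideal_ops \<A> ?M' (dual_space ?FM)" if f: "f \<in> ?C" for f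
    unfolding T_def
    using ideal_ops_comp[OF assms(5) dual_op_ideal_ops[OF assms(5,6) C(2)[OF f] nFX nX cFX cX]
      normed_dual_space[OF gM] normed_dual_space[OF gX] normed_dual_space[OF gFX] normed_dual_space[OF gFM]
      \<sigma>(1) d\<iota> cM cFM] .
  have T_bd: "T f \<in> bd_ops ?M' (dual_space ?FM)" if "f \<in> ?C" for f
    using T_ideal[OF that] by (simp add: ideal_ops_def)
  have T_op_norm: "op_norm ?M' (dual_space ?FM) (T f) \<le> r" if "f \<in> ?C" for f
    using T_norm[OF that] r by (intro op_norm_least[OF gM']) auto

  \<comment> \<open>The filter of neighbourhoods of the identity, traced on the approximating class, replaces a net.\<close>
  define \<F> where "\<F> = inf (nhdsin compact_open_topology id) (principal ?C)"
  have id_top: "id \<in> topspace (compact_open_topology :: ('a \<Rightarrow> 'a) topology)"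
    using BAP by (simp add: in_closure_of)
  have "\<F> \<noteq> bot"
    unfolding \<F>_def trivial_limit_def eventually_inf_principal eventually_nhdsin
    using BAP id_top by (auto simp: in_closure_of)
  have in_C: "\<forall>\<^sub>F f in \<F>. f \<in> ?C"
    unfolding \<F>_def eventually_inf_principal by simp
  have pointwise: "((\<lambda>f. f x) \<longlongrightarrow> x) \<F>" for x :: 'a
  proof (rule topological_tendstoI)
    fix U :: "'a set" assume "open U" "x \<in> U"
    let ?W = "{f. continuous_on UNIV f \<and> f ` {x} \<subseteq> U} :: ('a \<Rightarrow> 'a) set"
    have "openin compact_open_topology ?W"
      unfolding compact_open_topology_def using \<open>open U\<close>
      by (intro topology_generated_by_Basis CollectI exI[of _ "{x}"] exI[of _ U]) auto
    moreover have "id \<in> ?W" using \<open>x \<in> U\<close> by (auto simp: continuous_on_id id_def)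
    ultimately have "\<forall>\<^sub>F f in nhdsin compact_open_topology id. f x \<in> U"
      unfolding eventually_nhdsin by (intro disjI2 exI[of _ ?W]) auto
    then show "\<forall>\<^sub>F f in \<F>. f x \<in> U"
      unfolding \<F>_def eventually_inf_principal by (auto elim: eventually_mono)
  qed

  note \<beta> = beta_props[OF bM]
  let ?\<beta>' = "dual_op ?FM ?M (beta ?M)"
  have \<beta>'_bd: "?\<beta>' \<in> bd_ops ?M' (dual_space ?FM)" using dual_op_bd[OF gFM gM \<beta>(1)] .
  have conv: "((\<lambda>f. T f g \<mu>) \<longlongrightarrow> ?\<beta>' g \<mu>) \<F>" if g: "g \<in> carrier ?M'" and \<mu>: "\<mu> \<in> carrier ?FM" for g \<mu>
  proof (rule tendsto_on_closed_span[OF gFM _ _ bd_ops_range[OF \<beta>'_bd g] _ free_space_closure[OF \<mu>]])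
    show "delta ?M ` carrier ?M \<subseteq> carrier ?FM" using delta_free[OF nM] by blast
    show "\<forall>\<^sub>F f in \<F>. T f g \<in> carrier (dual_space ?FM) \<and> nrm (dual_space ?FM) (T f g) \<le> r * nrm ?M' g"
      using in_C by eventually_elim (simp add: T_norm g bd_ops_range[OF T_bd])
    fix \<delta> assume "\<delta> \<in> delta ?M ` carrier ?M"
    then obtain m where m: "m \<in> M" and \<delta>: "\<delta> = delta ?M m" by auto
    have \<sigma>g: "\<sigma> g \<in> carrier ?X'" using bd_ops_range[OF \<sigma>(1) g] .
    have "((\<lambda>f. \<sigma> g (f m)) \<longlongrightarrow> \<sigma> g m) \<F>"
    proof (rule LIM_zero_cancel, rule Lim_null_comparison)
      show "\<forall>\<^sub>F f in \<F>. norm (\<sigma> g (f m) - \<sigma> g m) \<le> nrm ?X' (\<sigma> g) * norm (f m - m)"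
        using dual_lipschitz[OF gX \<sigma>g order_refl] by simp
      show "((\<lambda>f. nrm ?X' (\<sigma> g) * norm (f m - m)) \<longlongrightarrow> 0) \<F>"
        using tendsto_mult_left[OF tendsto_norm_zero[OF LIM_zero[OF pointwise[of m]]], of "nrm ?X' (\<sigma> g)"] by simp
    qed
    then have "((\<lambda>f. \<sigma> g (f m)) \<longlongrightarrow> ?\<beta>' g \<delta>) \<F>"
      using \<sigma>(2)[OF g, of m] \<beta>(3)[of m] m g by (simp add: \<delta> dual_op_apply)
    then show "((\<lambda>f. T f g \<delta>) \<longlongrightarrow> ?\<beta>' g \<delta>) \<F>"
    proof (rule Lim_transform_eventually)
      show "\<forall>\<^sub>F f in \<F>. \<sigma> g (f m) = T f g \<delta>"
        using in_C
      proof eventually_elim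
        case (elim f)
        note f = C(1)[OF elim]
        show ?case
          using linearization_props(2)[OF nX bX f, of m] \<iota>(2)[of m] m by (simp add: T_apply[OF f g] \<delta>)
      qed
    qed
  qed
  have "?\<beta>' \<in> weak_star_topology ?M' ?FM closure_of ideal_ops_bd \<A> r ?M' (dual_space ?FM)"
  proof (rule weak_star_closureI[OF gM' gFM \<open>\<F> \<noteq> bot\<close> _ \<beta>'_bd conv])
    show "\<forall>\<^sub>F f in \<F>. T f \<in> ideal_ops_bd \<A> r ?M' (dual_space ?FM) \<and>
        T f \<in> bd_ops ?M' (dual_space ?FM) \<and> op_norm ?M' (dual_space ?FM) (T f) \<le> r"
      using in_C by eventually_elim (simp add: ideal_ops_bd_def T_ideal T_bd T_op_norm)
  qed
  with r show ?thesis by blast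
qed

end
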